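(* Let $V$ be a vector space of dimension $n=7$ over a perfect field $\mathbb K$ of cohomological dimension at most $1$. Then $R^\uparrow(H)\neq\emptyset$ for every hyperplane $H$ of $\mathcal G_3(V)$.
   Context: For $1\le k<n=\dim V$, $\mathcal G_k(V)$ is the point-line geometry whose points are the $k$-dimensional subspaces of $V$ and whose lines are the sets $\{X : Y\subset X\subset Z,\ \dim X=k\}$ with $Y\subset Z$ subspaces of $V$, $\dim Y=k-1$, $\dim Z=k+1$. A subspace of $\mathcal G_k(V)$ is a set $S$ of points containing every line that meets $S$ in at least two points; a hyperplane of $\mathcal G_k(V)$ is a proper subspace meeting every line non-trivially. It is known (Shult) that the hyperplanes of $\mathcal G_k(V)$ are exactly the sets of $k$-subspaces of $V$ on which a given non-trivial alternating $k$-linear form $\varphi$ on $V$ identically vanishes, $\varphi$ being unique up to a non-zero scalar. The upper radical $R^\uparrow(H)$ of a hyperplane $H$ of $\mathcal G_3(V)$ is the set of $2$-dimensional subspaces $A$ of $V$ such that every $3$-dimensional subspace of $V$ containing $A$ belongs to $H$. The cohomological dimension of a field $\mathbb K$ is the supremum over all primes $p$ of the $p$-cohomological dimension of the Galois group over $\mathbb K$ of the separable closure of $\mathbb K$. *)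

theory Defs
  imports
    "HOL-Analysis.Analysis"
    "HOL-Algebra.Bij"
    "HOL-Algebra.Algebraic_Closure_Type"
    "HOL-Library.Extended_Nat"
begin

section \<open>Grassmann geometries and their hyperplanes\<close>

definition grassmann_points :: "('k::field \<Rightarrow> 'v::ab_group_add \<Rightarrow> 'v) \<Rightarrow> nat \<Rightarrow> 'v set set" where
  "grassmann_points smul k = {P. module.subspace smul P \<and> vector_space.dim smul P = k}"

definition grassmann_lines :: "('k::field \<Rightarrow> 'v::ab_group_add \<Rightarrow> 'v) \<Rightarrow> nat \<Rightarrow> 'v set set set" where
  "grassmann_lines smul k =
     {{P \<in> grassmann_points smul k. Y \<subseteq> P \<and> P \<subseteq> Z} | Y Z.
        module.subspace smul Y \<and> module.subspace smul Z \<and> Y \<subseteq> Z \<and>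
        vector_space.dim smul Y + 1 = k \<and> vector_space.dim smul Z = k + 1}"

definition grassmann_subspace ::
    "('k::field \<Rightarrow> 'v::ab_group_add \<Rightarrow> 'v) \<Rightarrow> nat \<Rightarrow> 'v set set \<Rightarrow> bool" where
  "grassmann_subspace smul k S \<longleftrightarrow> S \<subseteq> grassmann_points smul k \<and>
     (\<forall>l\<in>grassmann_lines smul k. (\<exists>P\<in>l \<inter> S. \<exists>Q\<in>l \<inter> S. P \<noteq> Q) \<longrightarrow> l \<subseteq> S)"

definition grassmann_hyperplane ::
    "('k::field \<Rightarrow> 'v::ab_group_add \<Rightarrow> 'v) \<Rightarrow> nat \<Rightarrow> 'v set set \<Rightarrow> bool" where
  "grassmann_hyperplane smul k H \<longleftrightarrow>
     grassmann_subspace smul k H \<and> H \<noteq> grassmann_points smul k \<and>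
     (\<forall>l\<in>grassmann_lines smul k. l \<inter> H \<noteq> {})"

definition upper_radical ::
    "('k::field \<Rightarrow> 'v::ab_group_add \<Rightarrow> 'v) \<Rightarrow> 'v set set \<Rightarrow> 'v set set" where
  "upper_radical smul H =
     {A \<in> grassmann_points smul 2. \<forall>P\<in>grassmann_points smul 3. A \<subseteq> P \<longrightarrow> P \<in> H}"

section \<open>Perfect fields, separable closure and absolute Galois group\<close>

definition separable_poly :: "'k::field poly \<Rightarrow> bool" where
  "separable_poly p \<longleftrightarrow> coprime p (pderiv p)"

definition perfect_field :: "'k::field itself \<Rightarrow> bool" where
  "perfect_field _ \<longleftrightarrow> (\<forall>p :: 'k poly. Factorial_Ring.irreducible p \<longrightarrow> separable_poly p)"

definition separable_closure :: "'k::field alg_closure set" where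
  "separable_closure =
     {x. \<exists>p :: 'k poly. Factorial_Ring.irreducible p \<and> separable_poly p \<and> poly (map_poly to_ac p) x = 0}"

definition absolute_galois_group ::
    "('k::field alg_closure \<Rightarrow> 'k alg_closure) monoid" where
  "absolute_galois_group = BijGroup separable_closure
     \<lparr>carrier := {\<sigma> \<in> Bij separable_closure.
        (\<forall>x\<in>separable_closure. \<forall>y\<in>separable_closure.
           \<sigma> (x + y) = \<sigma> x + \<sigma> y \<and> \<sigma> (x * y) = \<sigma> x * \<sigma> y) \<and>
        (\<forall>a. \<sigma> (to_ac a) = to_ac a)}\<rparr>"

text \<open>The Krull topology: since each element has finitely many conjugates and every finite
  subextension is generated by finitely many elements, it is the topology of pointwise convergence
  for the discrete topology on the separable closure.\<close>

definition krull_topology :: "('k::field alg_closure \<Rightarrow> 'k alg_closure) topology" where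
  "krull_topology =
     subtopology (product_topology (\<lambda>_. discrete_topology separable_closure) separable_closure)
       (carrier absolute_galois_group)"

section \<open>Continuous cohomology and cohomological dimension\<close>

text \<open>\<open>G\<close> is a group with topology \<open>T\<close>. The discrete \<open>G\<close>-module \<open>A\<close> is written
  multiplicatively, and \<open>act\<close> is the action.\<close>

definition discrete_module ::
    "'g monoid \<Rightarrow> 'g topology \<Rightarrow> 'm monoid \<Rightarrow> ('g \<Rightarrow> 'm \<Rightarrow> 'm) \<Rightarrow> bool" where
  "discrete_module G T A act \<longleftrightarrow> comm_group A \<and> act \<in> hom G (AutoGroup A) \<and>
     continuous_map (prod_topology T (discrete_topology (carrier A)))
       (discrete_topology (carrier A)) (\<lambda>(g, a). act g a)"

definition torsion_group :: "'m monoid \<Rightarrow> bool" where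
  "torsion_group A \<longleftrightarrow> (\<forall>a\<in>carrier A. \<exists>n::nat. 0 < n \<and> a [^]\<^bsub>A\<^esub> n = \<one>\<^bsub>A\<^esub>)"

text \<open>Homogeneous cochains: continuous equivariant maps from the power \<open>G^(q+1)\<close> to \<open>A\<close>.\<close>

abbreviation tuples :: "'g monoid \<Rightarrow> nat \<Rightarrow> (nat \<Rightarrow> 'g) set" where
  "tuples G q \<equiv> {..q} \<rightarrow>\<^sub>E carrier G"

definition cochains ::
    "'g monoid \<Rightarrow> 'g topology \<Rightarrow> 'm monoid \<Rightarrow> ('g \<Rightarrow> 'm \<Rightarrow> 'm) \<Rightarrow> nat \<Rightarrow> ((nat \<Rightarrow> 'g) \<Rightarrow> 'm) monoid"
  where
  "cochains G T A act q =
     \<lparr>carrier = {f \<in> extensional (tuples G q).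
        continuous_map (product_topology (\<lambda>_. T) {..q}) (discrete_topology (carrier A)) f \<and>
        (\<forall>g\<in>carrier G. \<forall>s\<in>tuples G q. f (\<lambda>i\<in>{..q}. g \<otimes>\<^bsub>G\<^esub> s i) = act g (f s))},
      mult = (\<lambda>f h. \<lambda>s\<in>tuples G q. f s \<otimes>\<^bsub>A\<^esub> h s),
      one = (\<lambda>s\<in>tuples G q. \<one>\<^bsub>A\<^esub>)\<rparr>"

text \<open>\<open>face q i\<close> omits the \<open>i\<close>-th entry from a tuple of length \<open>q + 2\<close>.\<close>

definition face :: "nat \<Rightarrow> nat \<Rightarrow> (nat \<Rightarrow> 'g) \<Rightarrow> nat \<Rightarrow> 'g" where
  "face q i s = (\<lambda>j\<in>{..q}. s (if j < i then j else Suc j))"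

definition coboundary ::
    "'g monoid \<Rightarrow> 'm monoid \<Rightarrow> nat \<Rightarrow> ((nat \<Rightarrow> 'g) \<Rightarrow> 'm) \<Rightarrow> (nat \<Rightarrow> 'g) \<Rightarrow> 'm" where
  "coboundary G A q f = (\<lambda>s\<in>tuples G (Suc q).
     finprod A (\<lambda>i. if even i then f (face q i s) else inv\<^bsub>A\<^esub> f (face q i s)) {..Suc q})"

definition cocycles ::
    "'g monoid \<Rightarrow> 'g topology \<Rightarrow> 'm monoid \<Rightarrow> ('g \<Rightarrow> 'm \<Rightarrow> 'm) \<Rightarrow> nat \<Rightarrow> ((nat \<Rightarrow> 'g) \<Rightarrow> 'm) set" where
  "cocycles G T A act q =
     kernel (cochains G T A act q) (cochains G T A act (Suc q)) (coboundary G A q)"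

fun coboundaries ::
    "'g monoid \<Rightarrow> 'g topology \<Rightarrow> 'm monoid \<Rightarrow> ('g \<Rightarrow> 'm \<Rightarrow> 'm) \<Rightarrow> nat \<Rightarrow> ((nat \<Rightarrow> 'g) \<Rightarrow> 'm) set" where
  "coboundaries G T A act 0 = {\<one>\<^bsub>cochains G T A act 0\<^esub>}"
| "coboundaries G T A act (Suc q) = coboundary G A q ` carrier (cochains G T A act q)"

definition cohomology_group ::
    "'g monoid \<Rightarrow> 'g topology \<Rightarrow> 'm monoid \<Rightarrow> ('g \<Rightarrow> 'm \<Rightarrow> 'm) \<Rightarrow> nat \<Rightarrow> ((nat \<Rightarrow> 'g) \<Rightarrow> 'm) set monoid"
  where
  "cohomology_group G T A act q =
     (cochains G T A act q)\<lparr>carrier := cocycles G T A act q\<rparr> Mod coboundaries G T A act q"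

definition primary_component :: "nat \<Rightarrow> 'a monoid \<Rightarrow> 'a set" where
  "primary_component p M = {x \<in> carrier M. \<exists>k::nat. x [^]\<^bsub>M\<^esub> (p ^ k) = \<one>\<^bsub>M\<^esub>}"

definition primary_cohomology_vanishes ::
    "'m itself \<Rightarrow> 'g monoid \<Rightarrow> 'g topology \<Rightarrow> nat \<Rightarrow> nat \<Rightarrow> bool" where
  "primary_cohomology_vanishes _ G T p q \<longleftrightarrow>
     (\<forall>(A :: 'm monoid) act. discrete_module G T A act \<and> torsion_group A \<longrightarrow>
        primary_component p (cohomology_group G T A act q) = {\<one>\<^bsub>cohomology_group G T A act q\<^esub>})"


subsection \<open>Reduction to modules of bounded size\<close>

text \<open>A class and a cochain bounding a multiple of it take their values in a submodule generated by
  at most as many elements as there are lists over \<open>G\<close>, so vanishing for modules whose carrier lies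
  in the type of lists of such lists implies vanishing for modules over any type.\<close>

lemma hom_finprod':
  assumes "comm_group A'" "comm_group A" "h \<in> hom A' A" "finite S" "f \<in> S \<rightarrow> carrier A'"
  shows "h (finprod A' f S) = finprod A (\<lambda>i. h (f i)) S"
proof -
  interpret A': comm_group A' by fact
  interpret A: comm_group A by fact
  interpret group_hom A' A h
    using assms(3) by unfold_locales
  show ?thesis
    using assms(4,5)
  proof (induction S rule: finite_induct)
    case (insert x S)
    then have "(\<lambda>i. h (f i)) \<in> S \<rightarrow> carrier A" "h (f x) \<in> carrier A"
      by (auto simp: Pi_iff)
    with insert show ?case
      by (simp add: Pi_iff)
  qed simp
qed

lemma face_tuples: "s \<in> tuples G (Suc q) \<Longrightarrow> i \<le> Suc q \<Longrightarrow> face q i s \<in> tuples G q"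
  by (auto simp: face_def PiE_iff)

lemma continuous_map_face:
  "continuous_map (product_topology (\<lambda>_. T) {..Suc q}) (product_topology (\<lambda>_. T) {..q}) (face q i)"
  unfolding continuous_map_componentwise
  by (auto simp: face_def intro: continuous_map_product_projection)

locale cohomology_setup =
  fixes G :: "'g monoid" and T :: "'g topology" and A :: "'m monoid" and act :: "'g \<Rightarrow> 'm \<Rightarrow> 'm"
  assumes grp: "group G" and top: "topspace T = carrier G" and module: "discrete_module G T A act"
begin

sublocale gr: group G by (rule grp)
sublocale ab: comm_group A using module by (simp add: discrete_module_def)

abbreviation "C q \<equiv> cochains G T A act q"
abbreviation "P q \<equiv> product_topology (\<lambda>_. T) {..q::nat}"
abbreviation "D \<equiv> discrete_topology (carrier A)"

lemma act_hom: "g \<in> carrier G \<Longrightarrow> act g \<in> hom A A"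
  using module by (auto simp: discrete_module_def AutoGroup_def auto_def hom_def BijGroup_def)

lemma act_Bij: "g \<in> carrier G \<Longrightarrow> act g \<in> Bij (carrier A)"
  using module by (auto simp: discrete_module_def AutoGroup_def auto_def hom_def BijGroup_def)

lemma act_closed: "g \<in> carrier G \<Longrightarrow> a \<in> carrier A \<Longrightarrow> act g a \<in> carrier A"
  using act_hom by (auto simp: hom_def)

lemma act_mult: "g \<in> carrier G \<Longrightarrow> h \<in> carrier G \<Longrightarrow> a \<in> carrier A \<Longrightarrow>
    act (g \<otimes>\<^bsub>G\<^esub> h) a = act g (act h a)"
  using module by (auto simp: discrete_module_def AutoGroup_def auto_def hom_def BijGroup_def compose_def Pi_iff)

lemma act_one: "a \<in> carrier A \<Longrightarrow> act \<one>\<^bsub>G\<^esub> a = a"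
proof -
  assume a: "a \<in> carrier A"
  have "act \<one>\<^bsub>G\<^esub> (act \<one>\<^bsub>G\<^esub> a) = act \<one>\<^bsub>G\<^esub> a"
    using act_mult[of "\<one>\<^bsub>G\<^esub>" "\<one>\<^bsub>G\<^esub>" a] a by simp
  moreover have "inj_on (act \<one>\<^bsub>G\<^esub>) (carrier A)"
    using act_Bij[of "\<one>\<^bsub>G\<^esub>"] by (auto simp: Bij_def bij_betw_def)
  ultimately show ?thesis
    using a act_closed[of "\<one>\<^bsub>G\<^esub>" a] by (auto dest: inj_onD)
qed

lemma act_inv: "g \<in> carrier G \<Longrightarrow> a \<in> carrier A \<Longrightarrow> act g (inv\<^bsub>A\<^esub> a) = inv\<^bsub>A\<^esub> act g a"
proof -
  assume g: "g \<in> carrier G" and a: "a \<in> carrier A"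
  interpret group_hom A A "act g" using act_hom[OF g] by unfold_locales
  show ?thesis using a by simp
qed

lemma topspace_P: "topspace (P q) = tuples G q"
  by (simp add: top)

lemma translate: "g \<in> carrier G \<Longrightarrow> s \<in> tuples G q \<Longrightarrow> (\<lambda>i\<in>{..q}. g \<otimes>\<^bsub>G\<^esub> s i) \<in> tuples G q"
  by (auto simp: PiE_iff)

lemma face_translate: "i \<le> Suc q \<Longrightarrow>
    face q i (\<lambda>j\<in>{..Suc q}. g \<otimes>\<^bsub>G\<^esub> s j) = (\<lambda>j\<in>{..q}. g \<otimes>\<^bsub>G\<^esub> face q i s j)"
  by (auto simp: face_def fun_eq_iff)

lemma cochain_iff: "f \<in> carrier (C q) \<longleftrightarrow> f \<in> extensional (tuples G q) \<and> continuous_map (P q) D f \<and>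
    (\<forall>g\<in>carrier G. \<forall>s\<in>tuples G q. f (\<lambda>i\<in>{..q}. g \<otimes>\<^bsub>G\<^esub> s i) = act g (f s))"
  by (simp add: cochains_def)

lemma cochain_closed: "f \<in> carrier (C q) \<Longrightarrow> s \<in> tuples G q \<Longrightarrow> f s \<in> carrier A"
  unfolding cochain_iff using topspace_P[of q] by (auto simp: continuous_map_def Pi_iff)

lemma C_mult: "f \<otimes>\<^bsub>C q\<^esub> h = (\<lambda>s\<in>tuples G q. f s \<otimes>\<^bsub>A\<^esub> h s)"
  by (simp add: cochains_def)
lemma C_one: "\<one>\<^bsub>C q\<^esub> = (\<lambda>s\<in>tuples G q. \<one>\<^bsub>A\<^esub>)"
  by (simp add: cochains_def)

lemma continuous_map_restrict_D:
  "continuous_map (P q) D f \<Longrightarrow> continuous_map (P q) D (restrict f (tuples G q))"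
  by (erule continuous_map_eq) (simp add: top)

lemma continuous_map_op:
  assumes "continuous_map W D f" "continuous_map W D h"
  shows "continuous_map W D (\<lambda>s. f s \<otimes>\<^bsub>A\<^esub> h s)"
proof -
  have "continuous_map W (prod_topology D D) (\<lambda>s. (f s, h s))"
    using assms by (simp add: continuous_map_pairedI)
  moreover have "continuous_map (prod_topology D D) D (\<lambda>(a, b). a \<otimes>\<^bsub>A\<^esub> b)"
    by (auto simp flip: prod_topology_discrete_topology simp: continuous_map_from_discrete_topology)
  ultimately show ?thesis
    using continuous_map_compose[of W "prod_topology D D" "\<lambda>s. (f s, h s)" D "\<lambda>(a, b). a \<otimes>\<^bsub>A\<^esub> b"]
    by (simp add: o_def)
qed

lemma continuous_map_inv:
  assumes "continuous_map W D f"
  shows "continuous_map W D (\<lambda>s. inv\<^bsub>A\<^esub> f s)"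
  using continuous_map_compose[OF assms, of D "\<lambda>a. inv\<^bsub>A\<^esub> a"]
  by (simp add: o_def continuous_map_from_discrete_topology)

lemma continuous_map_finprod:
  assumes "finite S" "\<And>i. i \<in> S \<Longrightarrow> continuous_map W D (F i)"
  shows "continuous_map W D (\<lambda>s. finprod A (\<lambda>i. F i s) S)"
  using assms
proof (induction S rule: finite_induct)
  case empty
  show ?case by simp
next
  case (insert x S)
  have c: "continuous_map W D (\<lambda>s. F x s \<otimes>\<^bsub>A\<^esub> finprod A (\<lambda>i. F i s) S)"
    using insert by (intro continuous_map_op) auto
  show ?case
  proof (rule continuous_map_eq[OF c])
    fix s assume s: "s \<in> topspace W"
    have "F i s \<in> carrier A" if "i \<in> insert x S" for i
      using insert.prems[OF that] s by (auto simp: continuous_map_def)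
    then show "F x s \<otimes>\<^bsub>A\<^esub> finprod A (\<lambda>i. F i s) S = finprod A (\<lambda>i. F i s) (insert x S)"
      using insert.hyps by (simp add: Pi_iff)
  qed
qed

lemma C_comm_group: "comm_group (C q)"
proof (rule comm_groupI)
  fix f h assume f: "f \<in> carrier (C q)" and h: "h \<in> carrier (C q)"
  show "f \<otimes>\<^bsub>C q\<^esub> h \<in> carrier (C q)"
    using f h cochain_closed[OF f] cochain_closed[OF h]
    by (auto simp: cochain_iff C_mult translate hom_mult[OF act_hom]
        intro!: continuous_map_restrict_D continuous_map_op)
  show "f \<otimes>\<^bsub>C q\<^esub> h = h \<otimes>\<^bsub>C q\<^esub> f"
    using cochain_closed[OF f] cochain_closed[OF h]
    by (auto simp: C_mult ab.m_comm fun_eq_iff)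
next
  show "\<one>\<^bsub>C q\<^esub> \<in> carrier (C q)"
    using act_hom by (auto simp: cochain_iff C_one translate hom_one[OF _ ab.is_group ab.is_group]
        intro!: continuous_map_restrict_D)
next
  fix f g h assume f: "f \<in> carrier (C q)" and g: "g \<in> carrier (C q)" and h: "h \<in> carrier (C q)"
  show "f \<otimes>\<^bsub>C q\<^esub> g \<otimes>\<^bsub>C q\<^esub> h = f \<otimes>\<^bsub>C q\<^esub> (g \<otimes>\<^bsub>C q\<^esub> h)"
    using cochain_closed[OF f] cochain_closed[OF g] cochain_closed[OF h]
    by (auto simp: C_mult ab.m_assoc fun_eq_iff)
next
  fix f assume f: "f \<in> carrier (C q)"
  show "\<one>\<^bsub>C q\<^esub> \<otimes>\<^bsub>C q\<^esub> f = f"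
    using cochain_closed[OF f] f
    by (auto simp: C_mult C_one fun_eq_iff cochain_iff extensional_def)
  have "(\<lambda>s\<in>tuples G q. inv\<^bsub>A\<^esub> f s) \<in> carrier (C q)"
    using f cochain_closed[OF f]
    by (auto simp: cochain_iff translate act_inv
        intro!: continuous_map_restrict_D continuous_map_inv)
  moreover have "(\<lambda>s\<in>tuples G q. inv\<^bsub>A\<^esub> f s) \<otimes>\<^bsub>C q\<^esub> f = \<one>\<^bsub>C q\<^esub>"
    using cochain_closed[OF f] by (auto simp: C_mult C_one fun_eq_iff)
  ultimately show "\<exists>h\<in>carrier (C q). h \<otimes>\<^bsub>C q\<^esub> f = \<one>\<^bsub>C q\<^esub>" by blast
qed

abbreviation "sg f q s i \<equiv> (if even (i::nat) then f (face q i s) else inv\<^bsub>A\<^esub> f (face q i s))"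

lemma sg_closed: "f \<in> carrier (C q) \<Longrightarrow> s \<in> tuples G (Suc q) \<Longrightarrow> i \<le> Suc q \<Longrightarrow> sg f q s i \<in> carrier A"
  using cochain_closed face_tuples by (metis ab.inv_closed)

lemma coboundary_closed:
  assumes f: "f \<in> carrier (C q)"
  shows "coboundary G A q f \<in> carrier (C (Suc q))"
  unfolding cochain_iff
proof (intro conjI ballI)
  show "coboundary G A q f \<in> extensional (tuples G (Suc q))"
    by (simp add: coboundary_def)
  have *: "continuous_map (P (Suc q)) D (\<lambda>s. f (face q i s))" for i
    using continuous_map_compose[OF continuous_map_face[of T q i], of D f] f
    by (simp add: cochain_iff o_def)
  have "continuous_map (P (Suc q)) D (\<lambda>s. sg f q s i)" for i
    using *[of i] continuous_map_inv[OF *[of i]] by (cases "even i") auto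
  then show "continuous_map (P (Suc q)) D (coboundary G A q f)"
    unfolding coboundary_def by (intro continuous_map_restrict_D continuous_map_finprod) auto
next
  fix g s assume g: "g \<in> carrier G" and s: "s \<in> tuples G (Suc q)"
  let ?t = "\<lambda>i\<in>{..Suc q}. g \<otimes>\<^bsub>G\<^esub> s i"
  have t: "?t \<in> tuples G (Suc q)" by (rule translate[OF g s])
  have "sg f q ?t i = act g (sg f q s i)" if "i \<le> Suc q" for i
    using f g face_tuples[OF s that] cochain_closed[OF f face_tuples[OF s that]]
    by (simp add: face_translate[OF that] cochain_iff act_inv)
  then have "finprod A (sg f q ?t) {..Suc q} = finprod A (\<lambda>i. act g (sg f q s i)) {..Suc q}"
    using g sg_closed[OF f s] act_closed by (intro ab.finprod_cong') (auto simp del: if_split)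
  also have "\<dots> = act g (finprod A (sg f q s) {..Suc q})"
    using sg_closed[OF f s]
    by (intro hom_finprod'[symmetric] ab.comm_group_axioms act_hom g) auto
  finally show "coboundary G A q f ?t = act g (coboundary G A q f s)"
    using s t unfolding coboundary_def by simp
qed

lemma coboundary_hom: "coboundary G A q \<in> hom (C q) (C (Suc q))"
proof (rule homI)
  fix f h assume f: "f \<in> carrier (C q)" and h: "h \<in> carrier (C q)"
  have "sg (f \<otimes>\<^bsub>C q\<^esub> h) q s i = sg f q s i \<otimes>\<^bsub>A\<^esub> sg h q s i"
    if s: "s \<in> tuples G (Suc q)" and i: "i \<le> Suc q" for s i
    using face_tuples[OF s i] cochain_closed[OF f face_tuples[OF s i]]
      cochain_closed[OF h face_tuples[OF s i]]
    by (simp add: C_mult ab.inv_mult)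
  note sg = this
  have "finprod A (sg (f \<otimes>\<^bsub>C q\<^esub> h) q s) {..Suc q} =
      finprod A (sg f q s) {..Suc q} \<otimes>\<^bsub>A\<^esub> finprod A (sg h q s) {..Suc q}"
    if s: "s \<in> tuples G (Suc q)" for s
  proof -
    have "finprod A (sg (f \<otimes>\<^bsub>C q\<^esub> h) q s) {..Suc q} =
        finprod A (\<lambda>i. sg f q s i \<otimes>\<^bsub>A\<^esub> sg h q s i) {..Suc q}"
      using sg_closed[OF f s] sg_closed[OF h s] sg[OF s]
      by (intro ab.finprod_cong' refl) (auto simp only: Pi_iff atMost_iff ab.m_closed)
    also have "\<dots> = finprod A (sg f q s) {..Suc q} \<otimes>\<^bsub>A\<^esub> finprod A (sg h q s) {..Suc q}"
      using sg_closed[OF f s] sg_closed[OF h s]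
      by (intro ab.finprod_multf) (auto simp only: Pi_iff atMost_iff)
    finally show ?thesis .
  qed
  then have "(\<lambda>s\<in>tuples G (Suc q). finprod A (sg (f \<otimes>\<^bsub>C q\<^esub> h) q s) {..Suc q}) = (\<lambda>s\<in>tuples G (Suc q).
      finprod A (sg f q s) {..Suc q} \<otimes>\<^bsub>A\<^esub> finprod A (sg h q s) {..Suc q})"
    by (intro restrict_ext)
  then show "coboundary G A q (f \<otimes>\<^bsub>C q\<^esub> h) = coboundary G A q f \<otimes>\<^bsub>C (Suc q)\<^esub> coboundary G A q h"
    unfolding coboundary_def C_mult[where q = "Suc q"] by (simp add: fun_eq_iff)
qed (rule coboundary_closed)

abbreviation "B q \<equiv> coboundaries G T A act q"
abbreviation "Z q \<equiv> cocycles G T A act q"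

lemma B_subgroup: "subgroup (B (Suc q)) (C (Suc q))"
proof -
  interpret cb: group_hom "C q" "C (Suc q)" "coboundary G A q"
    using C_comm_group coboundary_hom
    by (simp add: group_hom_def group_hom_axioms_def comm_group.axioms)
  show ?thesis using cb.img_is_subgroup by simp
qed

lemma one_Z: "\<one>\<^bsub>C q\<^esub> \<in> Z q"
proof -
  interpret cb: group_hom "C q" "C (Suc q)" "coboundary G A q"
    using C_comm_group coboundary_hom
    by (simp add: group_hom_def group_hom_axioms_def comm_group.axioms)
  show ?thesis using cb.hom_one group.is_monoid monoid.one_closed cb.G.one_closed by (simp add: cocycles_def kernel_def)
qed

lemma primary_trivial_iff:
  "primary_component p (cohomology_group G T A act (Suc q)) = {\<one>\<^bsub>cohomology_group G T A act (Suc q)\<^esub>}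
   \<longleftrightarrow> (\<forall>f\<in>Z (Suc q). \<forall>k::nat. f [^]\<^bsub>C (Suc q)\<^esub> (p ^ k) \<in> B (Suc q) \<longrightarrow> f \<in> B (Suc q))"
proof -
  let ?C = "C (Suc q)" and ?B = "B (Suc q)" and ?Z = "Z (Suc q)"
  let ?H = "cohomology_group G T A act (Suc q)"
  interpret Cg: comm_group ?C by (rule C_comm_group)
  interpret Bn: normal ?B ?C using B_subgroup Cg.subgroup_imp_normal by blast
  have one: "\<one>\<^bsub>?H\<^esub> = ?B" by (simp add: cohomology_group_def)
  have mult: "monoid.mult ?H = monoid.mult (?C Mod ?B)"
    by (simp add: cohomology_group_def set_mult_def fun_eq_iff)
  have pow: "(?B #>\<^bsub>?C\<^esub> f) [^]\<^bsub>?H\<^esub> n = ?B #>\<^bsub>?C\<^esub> (f [^]\<^bsub>?C\<^esub> n)"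
    if "f \<in> carrier ?C" for f and n :: nat
    using Bn.FactGroup_pow[OF that, of n] one mult by (simp add: nat_pow_def)
  have car: "carrier ?H = (\<lambda>f. ?B #>\<^bsub>?C\<^esub> f) ` ?Z"
    by (simp add: cohomology_group_def carrier_FactGroup r_coset_def)
  have Z: "?Z \<subseteq> carrier ?C" by (auto simp: cocycles_def kernel_def)
  have join: "?B #>\<^bsub>?C\<^esub> f = ?B \<longleftrightarrow> f \<in> ?B" if "f \<in> carrier ?C" for f
    using that Cg.coset_join1 Cg.coset_join2 B_subgroup subgroup.subset by metis
  have "?B \<in> primary_component p ?H"
  proof -
    have "?B = ?B #>\<^bsub>?C\<^esub> \<one>\<^bsub>?C\<^esub>" using join[of "\<one>\<^bsub>?C\<^esub>"] subgroup.one_closed[OF B_subgroup]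
      by (metis Cg.one_closed)
    then have "?B \<in> carrier ?H" using one_Z car by blast
    moreover have "?B [^]\<^bsub>?H\<^esub> (p ^ 0) = ?B"
      using pow[of "\<one>\<^bsub>?C\<^esub>" 1] \<open>?B = ?B #>\<^bsub>?C\<^esub> \<one>\<^bsub>?C\<^esub>\<close> by simp
    ultimately show ?thesis unfolding primary_component_def one by blast
  qed
  then have "primary_component p ?H = {?B} \<longleftrightarrow>
      (\<forall>x\<in>carrier ?H. \<forall>k::nat. x [^]\<^bsub>?H\<^esub> (p ^ k) = ?B \<longrightarrow> x = ?B)"
    unfolding primary_component_def one by blast
  also have "\<dots> \<longleftrightarrow> (\<forall>f\<in>?Z. \<forall>k::nat. f [^]\<^bsub>?C\<^esub> (p ^ k) \<in> ?B \<longrightarrow> f \<in> ?B)"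
  proof -
    have "(?B #>\<^bsub>?C\<^esub> f) [^]\<^bsub>?H\<^esub> (p ^ k) = ?B \<longleftrightarrow> f [^]\<^bsub>?C\<^esub> (p ^ k) \<in> ?B"
      and "?B #>\<^bsub>?C\<^esub> f = ?B \<longleftrightarrow> f \<in> ?B" if "f \<in> ?Z" for f and k :: nat
      using that Z pow[of f] join[of f] join[of "f [^]\<^bsub>?C\<^esub> (p ^ k)"] Cg.nat_pow_closed[of f]
      by (auto simp del: coboundaries.simps)
    then show ?thesis
      unfolding car by (simp del: coboundaries.simps cong: ball_cong)
  qed
  finally show ?thesis unfolding one .
qed

end


locale module_embedding =
  src: cohomology_setup G T A' act' + tgt: cohomology_setup G T A act
  for G :: "'g monoid" and T and A' :: "'n monoid" and act' and A :: "'m monoid" and act +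
  fixes emb :: "'n \<Rightarrow> 'm"
  assumes emb_hom: "emb \<in> hom A' A" and emb_inj: "inj_on emb (carrier A')"
    and emb_act: "\<And>g a. g \<in> carrier G \<Longrightarrow> a \<in> carrier A' \<Longrightarrow> emb (act' g a) = act g (emb a)"
begin

sublocale emb: group_hom A' A emb
  using emb_hom by unfold_locales

definition "push q f = (\<lambda>s\<in>tuples G q. emb (f s))"

lemma push_closed: "f \<in> carrier (src.C q) \<Longrightarrow> push q f \<in> carrier (tgt.C q)"
proof -
  assume f: "f \<in> carrier (src.C q)"
  have "continuous_map (tgt.P q) tgt.D (\<lambda>s. emb (f s))"
    using f continuous_map_compose[of "tgt.P q" src.D f tgt.D emb]
    by (simp add: src.cochain_iff o_def)
  then show ?thesis
    using f src.cochain_closed[OF f]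
    by (auto simp: push_def tgt.cochain_iff src.cochain_iff tgt.translate emb_act
        intro!: tgt.continuous_map_restrict_D)
qed

lemma push_hom: "push q \<in> hom (src.C q) (tgt.C q)"
  using push_closed
  by (intro homI) (auto simp: push_def src.C_mult tgt.C_mult src.cochain_closed fun_eq_iff)

lemma push_inj: "inj_on (push q) (carrier (src.C q))"
proof (rule inj_onI)
  fix f h assume f: "f \<in> carrier (src.C q)" and h: "h \<in> carrier (src.C q)" and eq: "push q f = push q h"
  show "f = h"
  proof (rule extensionalityI[of _ "tuples G q"])
    fix s assume s: "s \<in> tuples G q"
    then have "emb (f s) = emb (h s)" using fun_cong[OF eq, of s] by (simp add: push_def)
    then show "f s = h s"
      using emb_inj s f h src.cochain_closed by (meson inj_onD)
  qed (use f h in \<open>auto simp: src.cochain_iff\<close>)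
qed

lemma push_coboundary:
  assumes f: "f \<in> carrier (src.C q)"
  shows "push (Suc q) (coboundary G A' q f) = coboundary G A q (push q f)"
proof -
  have "emb (finprod A' (src.sg f q s) {..Suc q}) = finprod A (tgt.sg (push q f) q s) {..Suc q}"
    if s: "s \<in> tuples G (Suc q)" for s
  proof -
    have "emb (finprod A' (src.sg f q s) {..Suc q}) = finprod A (\<lambda>i. emb (src.sg f q s i)) {..Suc q}"
      using src.sg_closed[OF f s]
      by (intro hom_finprod' src.ab.comm_group_axioms tgt.ab.comm_group_axioms emb_hom)
         (auto simp only: Pi_iff atMost_iff finite_atMost)
    also have "\<dots> = finprod A (tgt.sg (push q f) q s) {..Suc q}"
    proof (rule tgt.ab.finprod_cong'[OF refl])
      show "tgt.sg (push q f) q s \<in> {..Suc q} \<rightarrow> carrier A"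
        using tgt.sg_closed[OF push_closed[OF f] s] by (auto simp only: Pi_iff atMost_iff)
      show "emb (src.sg f q s i) = tgt.sg (push q f) q s i" if "i \<in> {..Suc q}" for i
        using that face_tuples[OF s, of i] src.cochain_closed[OF f face_tuples[OF s, of i]]
        by (simp add: push_def)
    qed
    finally show ?thesis .
  qed
  then show ?thesis
    unfolding push_def[of "Suc q"] coboundary_def by (intro restrict_ext) simp
qed

lemma pull:
  assumes f: "f \<in> carrier (tgt.C q)" and im: "f ` tuples G q \<subseteq> emb ` carrier A'"
  obtains f' where "f' \<in> carrier (src.C q)" "push q f' = f"
proof
  let ?d = "inv_into (carrier A') emb"
  let ?f = "\<lambda>s\<in>tuples G q. ?d (f s)"
  have d: "emb (?d a) = a" "?d a \<in> carrier A'" if "a \<in> emb ` carrier A'" for a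
    using that by (auto simp: f_inv_into_f inv_into_into)
  show "push q ?f = f"
  proof (rule extensionalityI[of _ "tuples G q"])
    show "f \<in> extensional (tuples G q)" using f by (simp add: tgt.cochain_iff)
  qed (use im d in \<open>auto simp: push_def\<close>)
  have "continuous_map (src.P q) (subtopology tgt.D (emb ` carrier A')) f"
    using f im unfolding tgt.cochain_iff continuous_map_in_subtopology src.topspace_P image_subset_iff_funcset
    by blast
  moreover have "carrier A \<inter> emb ` carrier A' = emb ` carrier A'" by auto
  ultimately have "continuous_map (src.P q) (discrete_topology (emb ` carrier A')) f"
    by (simp only: subtopology_discrete_topology)
  then have "continuous_map (src.P q) src.D (\<lambda>s. ?d (f s))"
    using continuous_map_compose[of "src.P q" "discrete_topology (emb ` carrier A')" f src.D ?d] d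
    by (simp add: o_def)
  moreover have "?d (act g (f s)) = act' g (?d (f s))" if "g \<in> carrier G" "s \<in> tuples G q" for g s
  proof -
    have "f s \<in> emb ` carrier A'" using im that by blast
    then have "act g (f s) = emb (act' g (?d (f s)))"
      using d[of "f s"] that by (simp add: emb_act)
    then show ?thesis
      using emb_inj src.act_closed d(2) im that by (simp add: image_subset_iff)
  qed
  ultimately show "?f \<in> carrier (src.C q)"
    using f by (auto simp: src.cochain_iff tgt.cochain_iff src.translate
        intro!: src.continuous_map_restrict_D)
qed

lemma transfer_vanishing:
  assumes van: "primary_component p (cohomology_group G T A' act' (Suc r)) =
      {\<one>\<^bsub>cohomology_group G T A' act' (Suc r)\<^esub>}"
    and f: "f \<in> tgt.Z (Suc r)" and b: "b \<in> carrier (tgt.C r)"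
    and eq: "f [^]\<^bsub>tgt.C (Suc r)\<^esub> (p ^ k :: nat) = coboundary G A r b"
    and imf: "f ` tuples G (Suc r) \<subseteq> emb ` carrier A'" and imb: "b ` tuples G r \<subseteq> emb ` carrier A'"
  shows "f \<in> tgt.B (Suc r)"
proof -
  have fC: "f \<in> carrier (tgt.C (Suc r))" and f1: "coboundary G A (Suc r) f = \<one>\<^bsub>tgt.C (Suc (Suc r))\<^esub>"
    using f by (auto simp: cocycles_def kernel_def)
  obtain f' where f': "f' \<in> carrier (src.C (Suc r))" "push (Suc r) f' = f"
    using pull[OF fC imf] .
  obtain b' where b': "b' \<in> carrier (src.C r)" "push r b' = b"
    using pull[OF b imb] .
  interpret ph: group_hom "src.C q" "tgt.C q" "push q" for q
    using src.C_comm_group tgt.C_comm_group push_hom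
    by (simp add: group_hom_def group_hom_axioms_def comm_group.axioms)
  have "push (Suc (Suc r)) (coboundary G A' (Suc r) f') = push (Suc (Suc r)) \<one>\<^bsub>src.C (Suc (Suc r))\<^esub>"
    using push_coboundary[OF f'(1)] f'(2) f1 ph.hom_one by simp
  then have "coboundary G A' (Suc r) f' = \<one>\<^bsub>src.C (Suc (Suc r))\<^esub>"
    using inj_onD[OF push_inj] src.coboundary_closed[OF f'(1)] ph.G.one_closed by blast
  then have Z: "f' \<in> src.Z (Suc r)"
    using f' by (simp add: cocycles_def kernel_def)
  have "push (Suc r) (f' [^]\<^bsub>src.C (Suc r)\<^esub> (p ^ k)) = push (Suc r) (coboundary G A' r b')"
    using ph.hom_nat_pow[OF f'(1)] f'(2) eq push_coboundary[OF b'(1)] b'(2) by simp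
  then have "f' [^]\<^bsub>src.C (Suc r)\<^esub> (p ^ k) = coboundary G A' r b'"
    using inj_onD[OF push_inj] src.coboundary_closed[OF b'(1)] ph.G.nat_pow_closed[OF f'(1)] by blast
  then have "f' [^]\<^bsub>src.C (Suc r)\<^esub> (p ^ k) \<in> src.B (Suc r)"
    using b'(1) by auto
  then have "f' \<in> src.B (Suc r)"
    using van Z unfolding src.primary_trivial_iff by blast
  then obtain c where c: "c \<in> carrier (src.C r)" "f' = coboundary G A' r c"
    by auto
  then have "f = coboundary G A r (push r c)"
    using push_coboundary[OF c(1)] f'(2) by simp
  then show ?thesis
    using push_closed[OF c(1)] by auto
qed

end

context cohomology_setup
begin

text \<open>A torsion module generated, as an abelian group, by the values \<open>w l\<close> for \<open>l\<close> in a \<open>G\<close>-stable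
  family can be transported to the type of lists of such \<open>l\<close>.\<close>

lemma small_submodule:
  fixes w :: "'i \<Rightarrow> 'm" and tr :: "'g \<Rightarrow> 'i \<Rightarrow> 'i" and L :: "'i set"
  assumes tors: "torsion_group A"
    and w: "\<And>l. l \<in> L \<Longrightarrow> w l \<in> carrier A"
    and tr: "\<And>g l. g \<in> carrier G \<Longrightarrow> l \<in> L \<Longrightarrow> tr g l \<in> L \<and> act g (w l) = w (tr g l)"
  obtains A' :: "'i list monoid" and act' emb
  where "module_embedding G T A' act' A act emb" "torsion_group A'" "w ` L \<subseteq> emb ` carrier A'"
proof -
  define v where "v = (\<lambda>ls. foldr (\<lambda>l a. w l \<otimes>\<^bsub>A\<^esub> a) ls \<one>\<^bsub>A\<^esub>)"
  have v_simps: "v [] = \<one>\<^bsub>A\<^esub>" "v (l # ls) = w l \<otimes>\<^bsub>A\<^esub> v ls" for l ls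
    by (simp_all add: v_def)
  have v_closed: "v ls \<in> carrier A" if "ls \<in> lists L" for ls
    using that by (induction ls) (auto simp: v_simps w)
  have v_append: "v (ls @ ls') = v ls \<otimes>\<^bsub>A\<^esub> v ls'" if "ls \<in> lists L" "ls' \<in> lists L" for ls ls'
    using that by (induction ls) (auto simp: v_simps w v_closed ab.m_assoc)
  have v_act: "act g (v ls) = v (map (tr g) ls)" if "g \<in> carrier G" "ls \<in> lists L" for g ls
    using that(2)
    by (induction ls)
       (use that(1) in \<open>auto simp: v_simps w v_closed tr hom_mult[OF act_hom] hom_one[OF act_hom ab.is_group ab.is_group]\<close>)
  define M where "M = v ` lists L"
  have M_sub: "M \<subseteq> carrier A" using v_closed by (auto simp: M_def)
  have M_one: "\<one>\<^bsub>A\<^esub> \<in> M" unfolding M_def using v_simps(1) by (metis image_eqI lists.Nil)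
  have M_mult: "x \<otimes>\<^bsub>A\<^esub> y \<in> M" if "x \<in> M" "y \<in> M" for x y
  proof -
    obtain ls ls' where "ls \<in> lists L" "x = v ls" "ls' \<in> lists L" "y = v ls'"
      using \<open>x \<in> M\<close> \<open>y \<in> M\<close> unfolding M_def by blast
    then show ?thesis
      unfolding M_def using v_append by (intro image_eqI[of _ _ "ls @ ls'"]) auto
  qed
  have M_act: "act g x \<in> M" if g: "g \<in> carrier G" and x: "x \<in> M" for g x
  proof -
    obtain ls where ls: "ls \<in> lists L" "x = v ls" using x by (auto simp: M_def)
    moreover have "map (tr g) ls \<in> lists L" using ls(1) tr g by auto
    ultimately show ?thesis using v_act[OF g] by (auto simp: M_def)
  qed
  have M_pow: "x [^]\<^bsub>A\<^esub> (n::nat) \<in> M" if "x \<in> M" for x n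
    by (induction n) (use that in \<open>auto simp: M_one M_mult\<close>)
  have M_inv: "\<exists>y\<in>M. y \<otimes>\<^bsub>A\<^esub> x = \<one>\<^bsub>A\<^esub>" if x: "x \<in> M" for x
  proof -
    obtain n :: nat where n: "0 < n" "x [^]\<^bsub>A\<^esub> n = \<one>\<^bsub>A\<^esub>"
      using tors x M_sub by (auto simp: torsion_group_def)
    then obtain m where "n = Suc m" by (cases n) auto
    with n x show ?thesis by (intro bexI[of _ "x [^]\<^bsub>A\<^esub> m"]) (auto simp: M_pow)
  qed
  define e where "e = inv_into (lists L) v"
  have ve: "v (e x) = x" if "x \<in> M" for x
    using that by (simp add: e_def M_def f_inv_into_f)
  define A' where "A' = \<lparr>carrier = e ` M, mult = (\<lambda>x y. e (v x \<otimes>\<^bsub>A\<^esub> v y)), one = e \<one>\<^bsub>A\<^esub>\<rparr>"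
  have A'_simps: "carrier A' = e ` M" "x \<otimes>\<^bsub>A'\<^esub> y = e (v x \<otimes>\<^bsub>A\<^esub> v y)" "\<one>\<^bsub>A'\<^esub> = e \<one>\<^bsub>A\<^esub>" for x y
    by (simp_all add: A'_def)
  note [simp] = A'_simps
  have [simp]: "x \<in> M \<Longrightarrow> x \<in> carrier A" for x using M_sub by auto
  have A': "comm_group A'"
  proof (rule comm_groupI)
    fix x assume "x \<in> carrier A'"
    then obtain a where a: "a \<in> M" "x = e a" by auto
    with M_inv obtain b where "b \<in> M" "b \<otimes>\<^bsub>A\<^esub> a = \<one>\<^bsub>A\<^esub>" by blast
    then show "\<exists>y\<in>carrier A'. y \<otimes>\<^bsub>A'\<^esub> x = \<one>\<^bsub>A'\<^esub>"
      using a by (intro bexI[of _ "e b"]) (auto simp: ve)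
  qed (auto simp: ve M_mult M_one ab.m_ac)
  define act' where "act' = (\<lambda>g. \<lambda>x\<in>carrier A'. e (act g (v x)))"
  have act'_e: "act' g (e a) = e (act g a)" if "a \<in> M" for g a
    using that by (auto simp: act'_def ve)
  have act'_comp: "compose (carrier A') (act' g) (act' h) = act' (g \<otimes>\<^bsub>G\<^esub> h)"
    if "g \<in> carrier G" "h \<in> carrier G" for g h
  proof
    fix x
    show "compose (carrier A') (act' g) (act' h) x = act' (g \<otimes>\<^bsub>G\<^esub> h) x"
      using that by (auto simp: compose_def act'_e act_mult M_act) (auto simp: act'_def)
  qed
  have act'_1: "act' \<one>\<^bsub>G\<^esub> = (\<lambda>x\<in>carrier A'. x)"
    by (auto simp: act'_def fun_eq_iff ve act_one)
  have act'_in: "act' g \<in> carrier A' \<rightarrow> carrier A'" if "g \<in> carrier G" for g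
    using that by (auto simp: act'_e M_act)
  have act'_Bij: "act' g \<in> Bij (carrier A')" if g: "g \<in> carrier G" for g
  proof -
    have inv: "act' g (act' h x) = x"
      if "g \<in> carrier G" "h \<in> carrier G" "g \<otimes>\<^bsub>G\<^esub> h = \<one>\<^bsub>G\<^esub>" "x \<in> carrier A'" for g h x
      using fun_cong[OF act'_comp[OF that(1,2)], of x] that act'_1 by (simp add: compose_eq)
    have "bij_betw (act' g) (carrier A') (carrier A')"
    proof (rule bij_betwI[where g = "act' (inv\<^bsub>G\<^esub> g)"])
      show "act' g \<in> carrier A' \<rightarrow> carrier A'" by (rule act'_in[OF g])
      show "act' (inv\<^bsub>G\<^esub> g) \<in> carrier A' \<rightarrow> carrier A'" using g by (intro act'_in) simp
      show "act' (inv\<^bsub>G\<^esub> g) (act' g x) = x" if "x \<in> carrier A'" for x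
        using g that by (intro inv) auto
      show "act' g (act' (inv\<^bsub>G\<^esub> g) x) = x" if "x \<in> carrier A'" for x
        using g that by (intro inv) auto
    qed
    then show ?thesis by (simp add: Bij_def act'_def)
  qed
  have act'_hom: "act' g \<in> hom A' A'" if g: "g \<in> carrier G" for g
  proof (rule homI)
    show "act' g x \<in> carrier A'" if "x \<in> carrier A'" for x
      using act'_in[OF g] that by blast
    show "act' g (x \<otimes>\<^bsub>A'\<^esub> y) = act' g x \<otimes>\<^bsub>A'\<^esub> act' g y"
      if xy: "x \<in> carrier A'" "y \<in> carrier A'" for x y
    proof -
      obtain a b where "a \<in> M" "x = e a" "b \<in> M" "y = e b" using xy by auto
      then show ?thesis
        using g by (simp add: ve act'_e M_mult M_act hom_mult[OF act_hom])
    qed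
  qed
  have "act' \<in> hom G (AutoGroup A')"
    using act'_Bij act'_hom act'_comp
    by (intro homI) (simp_all add: AutoGroup_def auto_def BijGroup_def del: A'_simps)
  moreover have "continuous_map (prod_topology T (discrete_topology (carrier A')))
       (discrete_topology (carrier A')) (\<lambda>(g, a). act' g a)"
  proof -
    let ?Y = "prod_topology T (discrete_topology (carrier A'))"
    have "continuous_map ?Y (discrete_topology (carrier A')) snd"
      by (rule continuous_map_snd)
    then have "continuous_map ?Y D (v \<circ> snd)"
      by (rule continuous_map_compose) (auto simp: ve)
    then have "continuous_map ?Y (prod_topology T D) (\<lambda>x. (fst x, v (snd x)))"
      by (intro continuous_map_pairedI continuous_map_fst) (simp add: o_def)
    moreover have "continuous_map (prod_topology T D) D (\<lambda>(g, a). act g a)"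
      using module by (simp add: discrete_module_def)
    ultimately have "continuous_map ?Y D (\<lambda>x. act (fst x) (v (snd x)))"
      using continuous_map_compose[of ?Y "prod_topology T D" "\<lambda>x. (fst x, v (snd x))" D "\<lambda>(g, a). act g a"]
      by (simp add: o_def)
    moreover have "(\<lambda>x. act (fst x) (v (snd x))) \<in> topspace ?Y \<rightarrow> M"
      by (auto simp: top ve M_act)
    ultimately have "continuous_map ?Y (subtopology D M) (\<lambda>x. act (fst x) (v (snd x)))"
      unfolding continuous_map_in_subtopology by blast
    moreover have "carrier A \<inter> M = M" by auto
    ultimately have "continuous_map ?Y (discrete_topology M) (\<lambda>x. act (fst x) (v (snd x)))"
      by (simp only: subtopology_discrete_topology)
    then have "continuous_map ?Y (discrete_topology (carrier A')) (\<lambda>x. e (act (fst x) (v (snd x))))"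
      using continuous_map_compose[of ?Y "discrete_topology M" "\<lambda>x. act (fst x) (v (snd x))"
          "discrete_topology (carrier A')" e]
      by (simp add: o_def)
    then show ?thesis
      by (rule continuous_map_eq) (auto simp: act'_def)
  qed
  ultimately have mod: "discrete_module G T A' act'"
    using A' by (simp add: discrete_module_def)
  have v_hom: "v \<in> hom A' A"
    by (intro homI) (auto simp: ve M_mult)
  have v_inj: "inj_on v (carrier A')"
    by (rule inj_on_inverseI[of _ e]) (auto simp: ve)
  have "v (act' g a) = act g (v a)" if "g \<in> carrier G" "a \<in> carrier A'" for g a
    using that by (auto simp: act'_e ve M_act)
  then have me: "module_embedding G T A' act' A act v"
    using grp top mod v_hom v_inj cohomology_setup_axioms
    unfolding module_embedding_def module_embedding_axioms_def cohomology_setup_def by blast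
  have tA: "torsion_group A'"
    unfolding torsion_group_def
  proof
    fix x assume x: "x \<in> carrier A'"
    interpret cg: comm_group A' by (rule A')
    interpret vh: group_hom A' A v
      using v_hom by unfold_locales
    obtain n :: nat where n: "0 < n" "v x [^]\<^bsub>A\<^esub> n = \<one>\<^bsub>A\<^esub>"
      using tors vh.hom_closed[OF x] by (auto simp: torsion_group_def)
    then have "v (x [^]\<^bsub>A'\<^esub> n) = v \<one>\<^bsub>A'\<^esub>"
      using vh.hom_nat_pow[OF x] vh.hom_one by simp
    then have "x [^]\<^bsub>A'\<^esub> n = \<one>\<^bsub>A'\<^esub>"
      using inj_onD[OF v_inj] cg.nat_pow_closed[OF x] cg.one_closed by blast
    with n(1) show "\<exists>n::nat. 0 < n \<and> x [^]\<^bsub>A'\<^esub> n = \<one>\<^bsub>A'\<^esub>" by blast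
  qed
  have wL: "w ` L \<subseteq> v ` carrier A'"
  proof
    fix a assume "a \<in> w ` L"
    then obtain l where l: "l \<in> L" "a = w l" by blast
    have "v [l] = a" using l w by (simp add: v_simps)
    moreover have "[l] \<in> lists L" using l by simp
    ultimately have "a \<in> M" unfolding M_def by blast
    then show "a \<in> v ` carrier A'" using ve by (auto intro!: image_eqI[of _ _ "e a"])
  qed
  from me tA wL show ?thesis by (fact that)
qed

end

lemma primary_cohomology_vanishes_all_types:
  fixes G :: "'g monoid"
  assumes "group G" and "topspace T = carrier G"
    and van: "primary_cohomology_vanishes TYPE('g list list) G T p (Suc r)"
  shows "primary_cohomology_vanishes TYPE('m) G T p (Suc r)"
  unfolding primary_cohomology_vanishes_def
proof (intro allI impI, elim conjE)
  fix A :: "'m monoid" and act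
  assume mod: "discrete_module G T A act" and tors: "torsion_group A"
  interpret cohomology_setup G T A act
    by (rule cohomology_setup.intro[OF assms(1,2) mod])
  have "f \<in> B (Suc r)"
    if f: "f \<in> Z (Suc r)" and fb: "f [^]\<^bsub>C (Suc r)\<^esub> (p ^ k) \<in> B (Suc r)" for f and k :: nat
  proof -
    have fC: "f \<in> carrier (C (Suc r))" using f by (auto simp: cocycles_def kernel_def)
    obtain b where b: "b \<in> carrier (C r)" "f [^]\<^bsub>C (Suc r)\<^esub> (p ^ k) = coboundary G A r b"
      using fb by auto
    define tup where "tup = (\<lambda>q (l :: 'g list). \<lambda>j\<in>{..q}. l ! j)"
    define w where "w = (\<lambda>l. if length l = Suc r then b (tup r l) else f (tup (Suc r) l))"
    define L where "L = {l. set l \<subseteq> carrier G \<and> (length l = Suc r \<or> length l = Suc (Suc r))}"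
    have tup: "tup q l \<in> tuples G q" if "set l \<subseteq> carrier G" "length l = Suc q" for q l
      using that by (auto simp: tup_def subset_iff)
    have tup_map: "tup q (map (\<lambda>x. g \<otimes>\<^bsub>G\<^esub> x) l) = (\<lambda>j\<in>{..q}. g \<otimes>\<^bsub>G\<^esub> tup q l j)"
      if "length l = Suc q" for g q l
      using that by (auto simp: tup_def fun_eq_iff)
    have tup_surj: "\<exists>l. set l \<subseteq> carrier G \<and> length l = Suc q \<and> tup q l = s" if "s \<in> tuples G q" for q s
      using that
      by (intro exI[of _ "map s [0..<Suc q]"])
         (auto simp: tup_def fun_eq_iff PiE_iff extensional_def nth_append simp del: upt_Suc)
    have wL: "w l \<in> carrier A" if "l \<in> L" for l
      using that cochain_closed[OF fC tup] cochain_closed[OF b(1) tup] by (auto simp: w_def L_def)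
    have trL: "map (\<lambda>x. g \<otimes>\<^bsub>G\<^esub> x) l \<in> L \<and> act g (w l) = w (map (\<lambda>x. g \<otimes>\<^bsub>G\<^esub> x) l)"
      if "g \<in> carrier G" "l \<in> L" for g l
    proof -
      have "map (\<lambda>x. g \<otimes>\<^bsub>G\<^esub> x) l \<in> L" using that by (auto simp: L_def)
      moreover have "act g (w l) = w (map (\<lambda>x. g \<otimes>\<^bsub>G\<^esub> x) l)"
        using that fC b(1) tup by (auto simp: w_def L_def tup_map cochain_iff)
      ultimately show ?thesis by blast
    qed
    obtain A' :: "'g list list monoid" and act' emb
      where emb: "module_embedding G T A' act' A act emb" and tors': "torsion_group A'"
        and im: "w ` L \<subseteq> emb ` carrier A'"
      by (rule small_submodule[of L w "\<lambda>g. map (\<lambda>x. g \<otimes>\<^bsub>G\<^esub> x)", OF tors wL trL])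
    interpret E: module_embedding G T A' act' A act emb by (rule emb)
    have "f ` tuples G (Suc r) \<subseteq> w ` L"
    proof
      fix a assume "a \<in> f ` tuples G (Suc r)"
      then obtain l where "set l \<subseteq> carrier G" "length l = Suc (Suc r)" "a = f (tup (Suc r) l)"
        using tup_surj by blast
      then show "a \<in> w ` L" by (intro image_eqI[of _ _ l]) (auto simp: w_def L_def)
    qed
    moreover have "b ` tuples G r \<subseteq> w ` L"
    proof
      fix a assume "a \<in> b ` tuples G r"
      then obtain l where "set l \<subseteq> carrier G" "length l = Suc r" "a = b (tup r l)"
        using tup_surj by blast
      then show "a \<in> w ` L" by (intro image_eqI[of _ _ l]) (auto simp: w_def L_def)
    qed
    moreover have "primary_component p (cohomology_group G T A' act' (Suc r)) =
        {\<one>\<^bsub>cohomology_group G T A' act' (Suc r)\<^esub>}"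
      using van[unfolded primary_cohomology_vanishes_def, rule_format, of A' act'] E.src.module tors'
      by simp
    ultimately show ?thesis
      using E.transfer_vanishing[OF _ f b] im by (meson order_trans)
  qed
  then show "primary_component p (cohomology_group G T A act (Suc r)) =
      {\<one>\<^bsub>cohomology_group G T A act (Suc r)\<^esub>}"
    unfolding primary_trivial_iff by blast
qed

subsection \<open>Cohomological dimension\<close>

text \<open>The modules range over a type that depends only on \<open>G\<close>; by
  \<open>primary_cohomology_vanishes_all_types\<close> this covers modules over every type.
  The infimum of the empty set is \<open>\<infinity>\<close>.\<close>

definition p_cohomological_dimension :: "'g monoid \<Rightarrow> 'g topology \<Rightarrow> nat \<Rightarrow> enat" where
  "p_cohomological_dimension G T p =
     Inf {enat n | n. \<forall>q>n. primary_cohomology_vanishes TYPE('g list list) G T p q}"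

definition cohomological_dimension :: "'k::field itself \<Rightarrow> enat" where
  "cohomological_dimension _ =
     (SUP p\<in>{p. Factorial_Ring.prime p}. p_cohomological_dimension
        (absolute_galois_group :: ('k alg_closure \<Rightarrow> 'k alg_closure) monoid) krull_topology p)"

end

theory Submission
  imports Defs
begin

text \<open>
  A hyperplane \<open>H\<close> of the Grassmannian of planes is the zero set of an alternating trilinear form
  \<open>\<phi>\<close> (Shult). Its upper radical is the set of the \<open>2\<close>-spaces \<open>\<langle>u, v\<rangle>\<close> with
  \<open>\<phi>(u, v, -) = 0\<close>, so it has to be shown that such a \<open>2\<close>-space exists.

  For the existence of \<open>\<phi>\<close> the scalars have to be chosen consistently. With \<open>e\<close> outside the radical,
  the residue of \<open>e\<close> carries an alternating bilinear form \<open>\<psi>\<close>, unique up to a scalar, and the form of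
  the residue of any \<open>y\<close> outside the radical of \<open>\<psi>\<close> is normalised by prescribing that it takes the
  value \<open>- \<psi>(y, z)\<close> at \<open>(e, z)\<close>. The normalised forms are skew in their first two arguments
  (\<open>trilinear_form_of_ternary_relation\<close>), and skewness transports linearity from the later arguments
  to the first one (\<open>skew_extension\<close>). The forms of the residues come from the same construction one
  dimension lower (\<open>bilinear_form_of_perpendicularity\<close>).

  Assume now that no \<open>2\<close>-space is annihilated. Take a plane \<open>P = \<langle>x, y, z\<rangle>\<close> with
  \<open>\<phi>(x, y, z) = 0\<close>. The functionals \<open>\<phi>(y, z, -)\<close>, \<open>\<phi>(z, x, -)\<close>, \<open>\<phi>(x, y, -)\<close> are linearly
  independent; let \<open>w1, w2, w3\<close> be dual to them. As the dimension is \<open>7\<close>, their common kernel contains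
  a vector \<open>u\<close> outside \<open>P\<close>. Consider the ternary quadratic form
  \<open>Q(a, b, c) = \<phi>(a x + b y + c z, u, a w1 + b w2 + c w3)\<close>. For a zero \<open>(a, b, c)\<close> of \<open>Q\<close>, the vector
  \<open>x' = a x + b y + c z\<close> and the alternating form \<open>\<phi>(x', -, -)\<close>, the \<open>5\<close>-space spanned by \<open>P\<close>, \<open>u\<close> and
  \<open>a w1 + b w2 + c w3\<close> is totally isotropic. Modulo \<open>x'\<close> it has dimension \<open>4\<close> in a space of dimension
  \<open>6\<close>, too much for a nondegenerate form, so some \<open>\<langle>x', t\<rangle>\<close> is annihilated after all
  (\<open>degenerate_vector\<close>). It remains to find a nontrivial zero of \<open>Q\<close>.

  Over a perfect field of characteristic \<open>2\<close> every element is a square and a zero can be written down.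
  In other characteristics, completing squares reduces the problem to the equation
  \<open>u\<^sup>2 = x v\<^sup>2 + 4 y\<close>, that is, to showing that \<open>4 y\<close> is a norm from the field obtained by
  adjoining a square root of \<open>x\<close>. This is where the cohomological dimension enters: the cup product of
  the two quadratic characters given by \<open>x\<close> and \<open>y\<close> vanishes in the second cohomology with
  coefficients of order \<open>2\<close> (\<open>cup_product_splits\<close>), and from a cochain that bounds it, a Hilbert 90
  argument produces an element with the required norm (\<open>norm_equation\<close>). The argument needs that the
  elements fixed by all automorphisms of the algebraic closure of a perfect field lie in the field
  (\<open>galois_moves\<close>), and this rests on the extension of embeddings to the algebraic closure
  (\<open>total_extension_exists\<close>).
\<close>

section \<open>Linear functionals and their kernels\<close>

text \<open>The locale \<open>vector_space\<close> is globally interpreted by the scalar multiplication of the real vector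
  spaces, and a name defined inside it stands for its real instance. The definitions below are kept
  generic by making them in an extension.\<close>

locale linear_space = vector_space scale
  for scale :: "'a::field \<Rightarrow> 'b::ab_group_add \<Rightarrow> 'b" (infixr \<open>*\<^sub>K\<close> 75)
begin

definition functional :: "('b \<Rightarrow> 'a) \<Rightarrow> bool" where
  "functional f \<longleftrightarrow> (\<forall>x y. f (x + y) = f x + f y) \<and> (\<forall>c x. f (c *\<^sub>K x) = c * f x)"

lemma functional_add: "functional f \<Longrightarrow> f (x + y) = f x + f y"
  by (auto simp: functional_def)

lemma functional_scale: "functional f \<Longrightarrow> f (c *\<^sub>K x) = c * f x"
  by (auto simp: functional_def)

lemma functional_0: "functional f \<Longrightarrow> f 0 = 0"
  using functional_scale[of f 0 0] by simp

lemma functional_minus: "functional f \<Longrightarrow> f (- x) = - f x"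
  using functional_scale[of f "-1" x] by simp

lemma functional_diff: "functional f \<Longrightarrow> f (x - y) = f x - f y"
  using functional_add[of f x "- y"] functional_minus[of f y] by simp

lemmas functional_simps = functional_add functional_scale functional_0 functional_minus functional_diff

text \<open>A subspace is the whole space or a hyperplane if any two vectors have a nontrivial combination in
  it. In this form the condition can be read off from the lines of a geometry without computing a
  dimension.\<close>

definition codim_le_1 :: "'b set \<Rightarrow> bool" where
  "codim_le_1 U \<longleftrightarrow> subspace U \<and> (\<forall>v w. v \<notin> U \<longrightarrow> (\<exists>c. w - c *\<^sub>K v \<in> U))"

lemma codim_le_1_kernel:
  assumes "functional f" shows "codim_le_1 {v. f v = 0}"
  unfolding codim_le_1_def
proof (intro conjI allI impI)
  show "subspace {v. f v = 0}"
    using assms by (auto simp: subspace_def functional_simps)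
  fix v w assume "v \<notin> {v. f v = 0}"
  then have "f (w - (f w / f v) *\<^sub>K v) = 0" using assms by (simp add: functional_simps)
  then show "\<exists>c. w - c *\<^sub>K v \<in> {v. f v = 0}" by blast
qed

text \<open>Every \<open>v\<close> is congruent modulo \<open>U\<close> to a unique multiple of \<open>e\<close>, and the coefficient depends linearly
  on \<open>v\<close>.\<close>

lemma functional_with_kernel:
  assumes U: "codim_le_1 U" and e: "e \<notin> U" and r: "r \<noteq> 0"
  shows "\<exists>f. functional f \<and> (\<forall>v. f v = 0 \<longleftrightarrow> v \<in> U) \<and> f e = r"
proof -
  have sub: "subspace U" using U by (simp add: codim_le_1_def)
  have ex: "\<exists>c. v - c *\<^sub>K e \<in> U" for v using U e by (simp add: codim_le_1_def)
  then obtain p where p: "\<And>v. v - p v *\<^sub>K e \<in> U" by metis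
  have uniq: "p v = c" if "v - c *\<^sub>K e \<in> U" for v c
  proof (rule ccontr)
    assume "p v \<noteq> c"
    have "(v - c *\<^sub>K e) - (v - p v *\<^sub>K e) \<in> U" using subspace_diff[OF sub that p] .
    then have "(p v - c) *\<^sub>K e \<in> U" by (simp add: scale_left_diff_distrib)
    then have "inverse (p v - c) *\<^sub>K ((p v - c) *\<^sub>K e) \<in> U" by (rule subspace_scale[OF sub])
    then show False using e \<open>p v \<noteq> c\<close> by simp
  qed
  have "p (x + y) = p x + p y" for x y
    using subspace_add[OF sub p[of x] p[of y]] by (intro uniq) (simp add: algebra_simps)
  moreover have "p (c *\<^sub>K x) = c * p x" for c x
    using subspace_scale[OF sub p[of x], of c] by (intro uniq) (simp add: scale_right_diff_distrib)
  moreover have "p v = 0 \<longleftrightarrow> v \<in> U" for v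
    using p[of v] uniq[of v 0] by auto
  moreover have "p e = 1" using subspace_0[OF sub] by (intro uniq) simp
  ultimately show ?thesis
    using r by (intro exI[of _ "\<lambda>v. r * p v"]) (simp add: functional_def algebra_simps)
qed

lemma functional_proportional:
  assumes f: "functional f" and g: "functional g" and ker: "\<And>v. f v = 0 \<longleftrightarrow> g v = 0" and e: "f e \<noteq> 0"
  shows "g v = g e / f e * f v"
proof -
  have "f (v - (f v / f e) *\<^sub>K e) = 0" using f e by (simp add: functional_simps)
  then have "g (v - (f v / f e) *\<^sub>K e) = 0" by (simp add: ker)
  then show ?thesis using g e by (simp add: functional_simps field_simps)
qed

text \<open>A subspace that is not contained in \<open>S\<close> is spanned by its vectors outside \<open>S\<close>. If \<open>U\<close> lies in \<open>S\<close>,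
  then so does \<open>W\<close>, and both are equal to \<open>S\<close> because no proper subspace of \<open>S\<close> can have codimension
  at most \<open>1\<close>.\<close>

lemma codim_le_1_eqI_off_subspace:
  assumes "codim_le_1 U" "codim_le_1 W" and S: "subspace S" "S \<noteq> UNIV"
    and agree: "\<And>v. v \<notin> S \<Longrightarrow> v \<in> U \<longleftrightarrow> v \<in> W"
  shows "U = W"
proof -
  have incl: "U \<subseteq> W" if U: "codim_le_1 U" and W: "codim_le_1 W"
    and agree: "\<And>v. v \<notin> S \<Longrightarrow> v \<in> U \<longleftrightarrow> v \<in> W" for U W
  proof
    fix u assume u: "u \<in> U"
    have sU: "subspace U" and sW: "subspace W" using U W by (simp_all add: codim_le_1_def)
    show "u \<in> W"
    proof (cases "u \<in> S")
      case True
      show ?thesis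
      proof (cases "U \<subseteq> S")
        case False
        then obtain u0 where u0: "u0 \<in> U" "u0 \<notin> S" by blast
        have "u + u0 \<notin> S" using subspace_diff[OF S(1), of "u + u0" u] True u0 by auto
        then have "u + u0 \<in> W" "u0 \<in> W" using agree u u0 subspace_add[OF sU] by blast+
        then show ?thesis using subspace_diff[OF sW, of "u + u0" u0] by simp
      next
        case US: True
        obtain v where v: "v \<notin> S" using S(2) by blast
        then have "v \<notin> W" using US agree by blast
        then obtain c where c: "u - c *\<^sub>K v \<in> W" using W by (auto simp: codim_le_1_def)
        have "c = 0"
        proof (rule ccontr)
          assume "c \<noteq> 0"
          have "W \<subseteq> S" using US agree by blast
          then have "u - (u - c *\<^sub>K v) \<in> S" using subspace_diff[OF S(1)] c True by blast
          then have "c *\<^sub>K v \<in> S" by simp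
          then have "inverse c *\<^sub>K (c *\<^sub>K v) \<in> S" by (rule subspace_scale[OF S(1)])
          then show False using v \<open>c \<noteq> 0\<close> by simp
        qed
        then show ?thesis using c by simp
      qed
    qed (use agree u in blast)
  qed
  show ?thesis using incl[of U W] incl[of W U] assms by blast
qed

lemma functional_eqI_off_subspace:
  assumes f: "functional f" and g: "functional g" and S: "subspace S" "S \<noteq> UNIV"
    and agree: "\<And>v. v \<notin> S \<Longrightarrow> f v = g v"
  shows "f v = g v"
proof (cases "v \<in> S")
  case True
  obtain e where e: "e \<notin> S" using S(2) by blast
  have "v + e \<notin> S" using subspace_diff[OF S(1), of "v + e" v] True e by auto
  then show ?thesis using agree[of "v + e"] agree[OF e] f g by (simp add: functional_simps)
qed (rule agree)

lemma functional_lincomb: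
  "functional f \<Longrightarrow> functional (\<lambda>v. c * f v)"
  "functional f \<Longrightarrow> functional g \<Longrightarrow> functional (\<lambda>v. f v + g v)"
  "functional f \<Longrightarrow> functional g \<Longrightarrow> functional (\<lambda>v. f v - g v)"
  "functional f \<Longrightarrow> functional (\<lambda>v. - f v)"
  by (auto simp: functional_def algebra_simps)

text \<open>The family \<open>g\<close> is linear in its second argument only. Skewness makes \<open>- g z x\<close> a description of
  \<open>g x z\<close> that is linear in \<open>x\<close> and makes sense for every \<open>x\<close>. As a functional is determined by its
  values outside \<open>S\<close>, it extends \<open>g\<close> to a bilinear form.\<close>

lemma skew_extension:
  assumes S: "subspace S" "S \<noteq> UNIV"
    and g: "\<And>y. y \<notin> S \<Longrightarrow> functional (g y)"
    and skew: "\<And>y z. y \<notin> S \<Longrightarrow> z \<notin> S \<Longrightarrow> g y z = - g z y"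
  shows "\<exists>\<beta>. (\<forall>x. functional (\<beta> x)) \<and> (\<forall>z. functional (\<lambda>x. \<beta> x z)) \<and>
    (\<forall>x z. x \<notin> S \<longrightarrow> \<beta> x z = g x z) \<and> (\<forall>x z. z \<notin> S \<longrightarrow> \<beta> x z = - g z x)"
proof -
  obtain e where e: "e \<notin> S" using S(2) by blast
  have "\<exists>f. functional f \<and> (\<forall>z. z \<notin> S \<longrightarrow> f z = - g z x)" for x
  proof (cases "x \<in> S")
    case False
    then show ?thesis using g skew by blast
  next
    case True
    have "x + e \<notin> S" using subspace_diff[OF S(1), of "x + e" x] True e by auto
    then have "functional (\<lambda>z. g (x + e) z - g e z)" using g e functional_lincomb(3) by blast
    moreover have "g (x + e) z - g e z = - g z x" if "z \<notin> S" for z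
      using skew[OF \<open>x + e \<notin> S\<close> that] skew[OF e that] g[OF that] by (simp add: functional_simps)
    ultimately show ?thesis by blast
  qed
  then obtain \<beta> where \<beta>: "\<And>x. functional (\<beta> x)" and off: "\<And>x z. z \<notin> S \<Longrightarrow> \<beta> x z = - g z x" by metis
  have add: "\<beta> (x + y) z = \<beta> x z + \<beta> y z" for x y z
    using functional_eqI_off_subspace[OF \<beta> functional_lincomb(2)[OF \<beta> \<beta>] S, of "x + y" x y]
    by (simp add: off functional_simps[OF g])
  have scale: "\<beta> (c *\<^sub>K x) z = c * \<beta> x z" for c x z
    using functional_eqI_off_subspace[OF \<beta> functional_lincomb(1)[OF \<beta>] S, of "c *\<^sub>K x" c x]
    by (simp add: off functional_simps[OF g])
  have "\<beta> x z = g x z" if "x \<notin> S" for x z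
    by (rule functional_eqI_off_subspace[OF \<beta> g[OF that] S]) (simp add: off skew[OF that])
  moreover have "functional (\<lambda>x. \<beta> x z)" for z unfolding functional_def using add scale by blast
  ultimately show ?thesis by (intro exI[of _ \<beta>] conjI allI impI \<beta> off)
qed

section \<open>Forms from perpendicularity relations\<close>

text \<open>Fix \<open>e\<close> outside the radical. The functionals with kernel \<open>e\<^sup>\<bottom>\<close> and \<open>y\<^sup>\<bottom>\<close>, for \<open>y\<close> not
  perpendicular to \<open>e\<close>, are unique up to scalars, and the scalar for \<open>y\<close> is fixed by skewness against
  \<open>e\<close>. Skewness between two such vectors \<open>y\<close> and \<open>z\<close> follows because the span of \<open>e\<close>, \<open>y\<close>, \<open>z\<close>
  contains a vector perpendicular to all three, so that the relation on this span has only one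
  possible form.\<close>

lemma bilinear_form_of_perpendicularity:
  assumes sym: "\<And>x y. R x y \<Longrightarrow> R y x" and refl: "\<And>x. R x x" and perp: "\<And>x. codim_le_1 {y. R x y}"
  obtains \<beta> where "\<And>x. functional (\<beta> x)" "\<And>z. functional (\<lambda>x. \<beta> x z)" "\<And>x z. \<beta> x z = 0 \<longleftrightarrow> R x z"
proof (cases "\<forall>x y. R x y")
  case True
  then show ?thesis by (intro that[of "\<lambda>_ _. 0"]) (auto simp: functional_def)
next
  case False
  then obtain e u where eu: "\<not> R e u" by blast
  define S where "S = {y. R e y}"
  have S: "subspace S" "S \<noteq> UNIV" using perp[of e] eu by (auto simp: S_def codim_le_1_def)
  have "codim_le_1 S" "u \<notin> S" using perp eu by (simp_all add: S_def)
  from functional_with_kernel[OF this one_neq_zero]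
  obtain \<psi> where \<psi>: "functional \<psi>" "\<And>v. \<psi> v = 0 \<longleftrightarrow> v \<in> S" by blast
  have "\<exists>f. functional f \<and> (\<forall>v. f v = 0 \<longleftrightarrow> R y v) \<and> f e = - \<psi> y" if "y \<notin> S" for y
  proof -
    have "e \<notin> {v. R y v}" "- \<psi> y \<noteq> 0" using that sym \<psi>(2) by (auto simp: S_def)
    from functional_with_kernel[OF perp this] show ?thesis by simp
  qed
  then obtain g where g: "\<And>y. y \<notin> S \<Longrightarrow> functional (g y)"
    and gR: "\<And>y v. y \<notin> S \<Longrightarrow> g y v = 0 \<longleftrightarrow> R y v" and ge: "\<And>y. y \<notin> S \<Longrightarrow> g y e = - \<psi> y" by metis
  have skew: "g y z = - g z y" if y: "y \<notin> S" and z: "z \<notin> S" for y z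
  proof -
    define c where "c = \<psi> y / \<psi> z"
    have \<psi>yz: "\<psi> y \<noteq> 0" "\<psi> z \<noteq> 0" using \<psi>(2) y z by auto
    then have c: "c \<noteq> 0" "\<psi> y = c * \<psi> z" by (simp_all add: c_def)
    \<comment> \<open>The constants \<open>c\<close> and \<open>d\<close> make \<open>r\<close> perpendicular to \<open>e\<close> and to \<open>y\<close>. Then \<open>r\<close> is also perpendicular
    to \<open>z\<close>, which is a combination of \<open>r\<close>, \<open>y\<close> and \<open>e\<close>.\<close>
    define d where "d = g y (y - c *\<^sub>K z) / g y e"
    define r where "r = y - c *\<^sub>K z - d *\<^sub>K e"
    have sub: "subspace {v. R r v}" using perp by (simp add: codim_le_1_def)
    have "g y e \<noteq> 0" using ge[OF y] \<psi>yz by simp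
    then have "g y r = 0" unfolding r_def d_def using functional_simps[OF g[OF y]] by simp
    then have "R r y" using gR[OF y] sym by blast
    have "\<psi> e = 0" using \<psi>(2) refl by (simp add: S_def)
    then have "\<psi> r = 0" using \<psi>(1) c by (simp add: r_def functional_simps)
    then have "R r e" using \<psi>(2) sym by (simp add: S_def)
    have "c *\<^sub>K z = y - d *\<^sub>K e - r" by (simp add: r_def)
    then have "R r (c *\<^sub>K z)"
      using subspace_diff[OF sub subspace_diff[OF sub _ subspace_scale[OF sub]], of y e r d]
        \<open>R r y\<close> \<open>R r e\<close> refl by simp
    then have "R r (inverse c *\<^sub>K (c *\<^sub>K z))" using subspace_scale[OF sub, of "c *\<^sub>K z" "inverse c"] by simp
    then have "R r z" using c(1) by simp
    then have "g z r = 0" using gR[OF z] sym by blast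
    moreover have "g y y = 0" "g z z = 0" using gR y z refl by blast+
    moreover have "g y r = g y y - c * g y z - d * g y e"
      "g z r = g z y - c * g z z - d * g z e" using g y z by (simp_all add: r_def functional_simps)
    ultimately have "c * g y z = d * \<psi> y" "g z y = - (d * \<psi> z)"
      using \<open>g y r = 0\<close> ge[OF y] ge[OF z] by (simp_all add: algebra_simps eq_neg_iff_add_eq_0)
    then have "c * g y z = c * (- g z y)" using c(2) by simp
    then show ?thesis using c(1) unfolding mult_cancel_left by blast
  qed
  obtain \<beta> where \<beta>: "\<And>x. functional (\<beta> x)" "\<And>z. functional (\<lambda>x. \<beta> x z)"
    and off: "\<And>x z. z \<notin> S \<Longrightarrow> \<beta> x z = - g z x"
    using skew_extension[OF S, of g] g skew by metis
  have "{z. \<beta> x z = 0} = {z. R x z}" for x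
  proof (rule codim_le_1_eqI_off_subspace[OF codim_le_1_kernel[OF \<beta>(1)] perp S])
    fix v assume v: "v \<notin> S"
    have "R v x \<longleftrightarrow> R x v" using sym by blast
    then show "v \<in> {z. \<beta> x z = 0} \<longleftrightarrow> v \<in> {z. R x z}" using off[OF v] gR[OF v] by simp
  qed
  then have "\<beta> x z = 0 \<longleftrightarrow> R x z" for x z by (simp add: set_eq_iff)
  with that[of \<beta>] \<beta> show ?thesis by simp
qed

lemma avoid_two_kernels:
  assumes f: "functional f" "f u \<noteq> 0" and g: "functional g" "g v \<noteq> 0"
  obtains w where "f w \<noteq> 0" "g w \<noteq> 0"
proof (cases "g u = 0")
  case gu: True
  show ?thesis
  proof (cases "f v = 0")
    case True
    then show ?thesis using gu that[of "u + v"] assms by (simp add: functional_simps)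
  qed (use that g in blast)
qed (use that f in blast)

text \<open>A vector space over a field with at least three elements is not the union of three proper
  subspaces; the element \<open>k\<close> witnesses the size of the field.\<close>

lemma avoid_three_kernels:
  assumes f: "functional f" "f u \<noteq> 0" and g: "functional g" "g v \<noteq> 0" and h: "functional h" "h w \<noteq> 0"
    and K: "(k :: 'a) \<noteq> 0" "k \<noteq> 1"
  obtains z where "f z \<noteq> 0" "g z \<noteq> 0" "h z \<noteq> 0"
proof -
  obtain a where a: "f a \<noteq> 0" "g a \<noteq> 0" using avoid_two_kernels[OF f g] .
  show ?thesis
  proof (cases "h a = 0")
    case True
    have val: "f (w + t *\<^sub>K a) = f w + t * f a" "g (w + t *\<^sub>K a) = g w + t * g a" "h (w + t *\<^sub>K a) = h w" for t
      using f g h True by (simp_all add: functional_simps)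
    have "\<exists>t. t \<noteq> - f w / f a \<and> t \<noteq> - g w / g a" using K by (metis zero_neq_one)
    then obtain t where "t \<noteq> - f w / f a" "t \<noteq> - g w / g a" by blast
    then have "f (w + t *\<^sub>K a) \<noteq> 0" "g (w + t *\<^sub>K a) \<noteq> 0" "h (w + t *\<^sub>K a) \<noteq> 0"
      using a h(2) val by (auto simp: field_simps add_eq_0_iff)
    then show ?thesis using that by blast
  qed (use that a in blast)
qed

text \<open>The relations \<open>T y\<close> have bilinear forms \<open>B y\<close>, and only the scalars have to be adjusted. For \<open>y\<close>
  outside the radical \<open>S\<close> of \<open>\<psi> = B e\<close>, the form \<open>g y\<close> is the multiple of \<open>B y\<close> with
  \<open>g y e = - \<psi> y\<close>. The functionals \<open>g y z\<close> and \<open>g z y\<close> have the same kernel, hence are proportional;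
  evaluation at \<open>e\<close> shows that the factor is \<open>-1\<close> if \<open>\<psi> y z\<close> does not vanish.\<close>

theorem trilinear_form_of_ternary_relation:
  assumes sym: "\<And>x y z. T x y z \<Longrightarrow> T y x z" "\<And>x y z. T x y z \<Longrightarrow> T x z y"
    and refl: "\<And>x z. T x x z" and hyp: "\<And>x y. codim_le_1 {z. T x y z}"
  obtains \<phi> where "\<And>x y. functional (\<phi> x y)" "\<And>x z. functional (\<lambda>y. \<phi> x y z)"
    "\<And>y z. functional (\<lambda>x. \<phi> x y z)" "\<And>x y z. \<phi> x y z = 0 \<longleftrightarrow> T x y z"
proof (cases "\<forall>x y z. T x y z")
  case True
  then show ?thesis by (intro that[of "\<lambda>_ _ _. 0"]) (auto simp: functional_def)
next
  case False
  then obtain e u v where euv: "\<not> T e u v" by blast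
  have "\<exists>\<beta>. (\<forall>y. functional (\<beta> y)) \<and> (\<forall>z. functional (\<lambda>y. \<beta> y z)) \<and> (\<forall>y z. \<beta> y z = 0 \<longleftrightarrow> T x y z)" for x
  proof -
    have "T x y y" for y using refl[of y x] sym by blast
    then show ?thesis using bilinear_form_of_perpendicularity[of "T x"] sym(2) hyp by metis
  qed
  then obtain B where B: "\<And>x y. functional (B x y)" "\<And>x z. functional (\<lambda>y. B x y z)"
    and BT: "\<And>x y z. B x y z = 0 \<longleftrightarrow> T x y z" by metis
  have T_swap: "T y z w \<longleftrightarrow> T z y w" for y z w using sym(1) by blast
  have alt: "B x y z = - B x z y" for x y z
  proof -
    have 0: "B x w w = 0" for w using BT refl[of w x] sym by blast
    have "B x (y + z) (y + z) = B x y y + B x y z + (B x z y + B x z z)"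
      using functional_add[OF B(2)[of x "y + z"], of y z] B(1) by (simp add: functional_simps)
    then show ?thesis using 0 by (simp add: eq_neg_iff_add_eq_0)
  qed
  define \<psi> where "\<psi> = B e"
  define S where "S = {y. \<forall>z. \<psi> y z = 0}"
  have "subspace S"
    unfolding subspace_def S_def \<psi>_def by (simp add: functional_simps[OF B(2)])
  moreover have "u \<notin> S" using euv BT by (auto simp: S_def \<psi>_def)
  ultimately have S: "subspace S" "S \<noteq> UNIV" by auto
  have scaled: "\<exists>c. c \<noteq> 0 \<and> (\<forall>z. c * B y e z = - \<psi> y z)" if y: "y \<notin> S" for y
  proof -
    obtain z0 where z0: "\<psi> y z0 \<noteq> 0" using y unfolding S_def by blast
    have ker: "\<psi> y z = 0 \<longleftrightarrow> B y e z = 0" for z unfolding \<psi>_def BT using sym by blast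
    have B0: "B y e z0 \<noteq> 0" using ker z0 by simp
    define c where "c = - (\<psi> y z0 / B y e z0)"
    have "c * B y e z = - \<psi> y z" for z
      using functional_proportional[of "B y e" "\<psi> y" z0 z] B(1) ker B0 by (simp add: \<psi>_def c_def)
    moreover have "c \<noteq> 0" using z0 B0 by (simp add: c_def)
    ultimately show ?thesis by blast
  qed
  then have "\<forall>y. \<exists>c. y \<notin> S \<longrightarrow> c \<noteq> 0 \<and> (\<forall>z. c * B y e z = - \<psi> y z)" by blast
  from choice[OF this] obtain c where
    c: "\<And>y. y \<notin> S \<Longrightarrow> c y \<noteq> 0" "\<And>y z. y \<notin> S \<Longrightarrow> c y * B y e z = - \<psi> y z" by blast
  define g where "g = (\<lambda>y z w. c y * B y z w)"
  have g: "functional (g y z)" "functional (\<lambda>z. g y z w)" for y z w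
    unfolding g_def by (rule functional_lincomb(1), rule B)+
  have g_alt: "g y z w = - g y w z" for y z w using alt[of y z w] by (simp add: g_def)
  have gT: "g y z w = 0 \<longleftrightarrow> T y z w" if "y \<notin> S" for y z w using c(1)[OF that] BT by (simp add: g_def)
  have ge: "g y z e = \<psi> y z" if "y \<notin> S" for y z
    using c(2)[OF that, of z] g_alt[of y z e] by (simp add: g_def)
  have \<psi>_alt: "\<psi> y z = - \<psi> z y" for y z unfolding \<psi>_def by (rule alt)
  have ratio: "g z y w = g z y w0 / g y z w0 * g y z w" if "y \<notin> S" "z \<notin> S" "g y z w0 \<noteq> 0" for y z w w0
    by (rule functional_proportional[OF g(1) g(1) _ that(3)]) (simp add: gT that T_swap[of y z])
  have skew_adj: "g y z w = - g z y w" if "y \<notin> S" "z \<notin> S" "\<psi> y z \<noteq> 0" for y z w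
    using ratio[OF that(1,2), of e w] that(3) ge[OF that(1), of z] ge[OF that(2), of y] \<psi>_alt[of z y] by simp
  \<comment> \<open>The factor is computed along a path \<open>y, p, z\<close>, where \<open>g y z p \<noteq> 0\<close> and \<open>\<psi>\<close> vanishes neither on
  \<open>(y, p)\<close> nor on \<open>(p, z)\<close>. Such a \<open>p\<close> need not exist over the field with two elements, but there the
  only nonzero factor is \<open>1 = -1\<close>.\<close>
  have skew: "g y z w = - g z y w" if y: "y \<notin> S" and z: "z \<notin> S" for y z w
  proof (cases "\<exists>k :: 'a. k \<noteq> 0 \<and> k \<noteq> 1")
    case False
    have "g y z w = 0 \<longleftrightarrow> g z y w = 0" by (simp add: gT y z T_swap[of y z])
    then have "g y z w = g z y w" using False by metis
    moreover have "(-1 :: 'a) = 1" using False by (metis neg_equal_0_iff_equal zero_neq_one)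
    ultimately show ?thesis using False by (metis mult_minus1 mult_1)
  next
    case True
    then obtain k :: 'a where k: "k \<noteq> 0" "k \<noteq> 1" by blast
    show ?thesis
    proof (cases "\<forall>w. g y z w = 0")
      case True
      then show ?thesis using gT[OF y, of z w] gT[OF z, of y w] T_swap[of y z w] by simp
    next
      case False
      then obtain w1 where w1: "g y z w1 \<noteq> 0" by blast
      obtain y1 z1 where "\<psi> y y1 \<noteq> 0" "\<psi> z z1 \<noteq> 0" using y z by (auto simp: S_def)
      then obtain p where p: "\<psi> y p \<noteq> 0" "\<psi> z p \<noteq> 0" "g y z p \<noteq> 0"
        using avoid_three_kernels[of "\<psi> y" y1 "\<psi> z" z1 "g y z" w1 k] B(1) g(1) w1 k by (auto simp: \<psi>_def)
      have p': "\<psi> p z \<noteq> 0" using p \<psi>_alt[of p z] by simp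
      then have pS: "p \<notin> S" unfolding S_def by blast
      have "g y z p = - g y p z" by (rule g_alt)
      also have "\<dots> = g p y z" using skew_adj[OF y pS p(1)] by simp
      also have "\<dots> = - g p z y" by (rule g_alt)
      also have "\<dots> = g z p y" using skew_adj[OF pS z p'] by simp
      also have "\<dots> = - g z y p" by (rule g_alt)
      finally have "g z y p = - g y z p" by simp
      then show ?thesis using ratio[OF y z p(3), of w] p(3) by simp
    qed
  qed
  have "\<exists>\<beta>. (\<forall>x. functional (\<beta> x)) \<and> (\<forall>z. functional (\<lambda>x. \<beta> x z)) \<and>
      (\<forall>x z. x \<notin> S \<longrightarrow> \<beta> x z = g x z w) \<and> (\<forall>x z. z \<notin> S \<longrightarrow> \<beta> x z = - g z x w)" for w
    by (rule skew_extension[OF S, of "\<lambda>y z. g y z w"]) (rule g(2), rule skew)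
  then obtain \<phi>' where \<phi>': "\<And>w x. functional (\<phi>' w x)" "\<And>w z. functional (\<lambda>x. \<phi>' w x z)"
    "\<And>w x z. x \<notin> S \<Longrightarrow> \<phi>' w x z = g x z w" "\<And>w x z. z \<notin> S \<Longrightarrow> \<phi>' w x z = - g z x w" by metis
  define \<phi> where "\<phi> = (\<lambda>x z w. \<phi>' w x z)"
  have \<phi>1: "functional (\<lambda>x. \<phi> x z w)" and \<phi>2: "functional (\<lambda>z. \<phi> x z w)"
    and off1: "x \<notin> S \<Longrightarrow> \<phi> x z w = g x z w" and off2: "z \<notin> S \<Longrightarrow> \<phi> x z w = - g z x w" for x z w
    using \<phi>' by (simp_all add: \<phi>_def)
  obtain e' where e': "e' \<notin> S" using S(2) by blast
  have shift: "x + e' \<notin> S" if "x \<in> S" for x using subspace_diff[OF S(1), of "x + e'" x] that e' by auto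
  have diff: "\<phi> x z w = g (x + e') z w - g e' z w" if "x \<in> S" for x z w
    using functional_add[OF \<phi>1, of x e' z w] off1[OF shift[OF that]] off1[OF e'] by simp
  have \<phi>3: "functional (\<phi> x z)" for x z
  proof (cases "x \<in> S")
    case True
    then show ?thesis using diff functional_lincomb(3)[OF g(1) g(1)] by (simp add: functional_def)
  next
    case False
    then show ?thesis using off1 g(1) by (simp add: functional_def)
  qed
  have \<phi>_alt: "\<phi> x z w = - \<phi> x w z" for x z w
  proof (cases "x \<in> S")
    case True
    show ?thesis unfolding diff[OF True] using g_alt[of "x + e'" z w] g_alt[of e' z w] by simp
  next
    case False
    show ?thesis unfolding off1[OF False] by (rule g_alt)
  qed
  have "{w. \<phi> x z w = 0} = {w. T x z w}" for x z
  proof (rule codim_le_1_eqI_off_subspace[OF codim_le_1_kernel[OF \<phi>3] hyp S])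
    fix w assume "w \<notin> S"
    then have "\<phi> x z w = g w x z" using \<phi>_alt[of x z w] off2 by simp
    moreover have "T w x z \<longleftrightarrow> T x z w" using sym by blast
    ultimately show "w \<in> {w. \<phi> x z w = 0} \<longleftrightarrow> w \<in> {w. T x z w}" using gT[OF \<open>w \<notin> S\<close>] by simp
  qed
  then have "\<phi> x z w = 0 \<longleftrightarrow> T x z w" for x z w unfolding set_eq_iff mem_Collect_eq by (rule spec)
  then show ?thesis by (rule that[OF \<phi>3 \<phi>2 \<phi>1])
qed

end

section \<open>Alternating trilinear forms in dimension seven\<close>

lemma two_equations_three_unknowns:
  fixes p q r p' q' r' :: "'a::field"
  obtains a b c where "(a, b, c) \<noteq> (0, 0, 0)" "a * p + b * q + c * r = 0" "a * p' + b * q' + c * r' = 0"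
proof (cases "(q * r' - r * q', r * p' - p * r', p * q' - q * p') = (0, 0, 0)")
  case False
  show ?thesis by (rule that[OF False]) (simp_all add: algebra_simps)
next
  case True
  then have eq: "q * r' = r * q'" "r * p' = p * r'" "p * q' = q * p'" by simp_all
  consider "p \<noteq> 0 \<or> q \<noteq> 0" | "p = 0" "q = 0" "r \<noteq> 0" | "p = 0" "q = 0" "r = 0" "p' \<noteq> 0 \<or> q' \<noteq> 0"
    | "p = 0" "q = 0" "r = 0" "p' = 0" "q' = 0" by blast
  then show ?thesis
  proof cases
    case 1
    then show ?thesis using eq by (intro that[of q "-p" 0]) (auto simp: algebra_simps)
  next
    case 2
    then have "p' = 0" using eq(2) by simp
    then show ?thesis using 2 by (intro that[of 1 0 0]) auto
  next
    case 3
    then show ?thesis by (intro that[of q' "-p'" 0]) (auto simp: algebra_simps)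
  next
    case 4
    then show ?thesis by (intro that[of 1 0 0]) auto
  qed
qed

context linear_space begin

definition independent3 :: "'b \<Rightarrow> 'b \<Rightarrow> 'b \<Rightarrow> bool" where
  "independent3 x y z \<longleftrightarrow>
     (\<forall>a b c. a *\<^sub>K x + b *\<^sub>K y + c *\<^sub>K z = 0 \<longrightarrow> a = 0 \<and> b = 0 \<and> c = 0)"

lemma independent3_rotate: "independent3 x y z \<Longrightarrow> independent3 y z x"
  unfolding independent3_def by (metis add.assoc add.commute)

lemma functional_multiple:
  assumes f: "functional f" and h: "functional h" and ker: "\<And>v. f v = 0 \<Longrightarrow> h v = 0"
  obtains \<beta> where "\<And>v. h v = \<beta> * f v"
proof (cases "\<exists>e. f e \<noteq> 0")
  case True
  then obtain e where e: "f e \<noteq> 0" by blast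
  have "h v = h e / f e * f v" for v
  proof -
    have "f (v - (f v / f e) *\<^sub>K e) = 0" using f e by (simp add: functional_simps)
    then have "h (v - (f v / f e) *\<^sub>K e) = 0" by (rule ker)
    then show ?thesis using h e by (simp add: functional_simps field_simps)
  qed
  then show ?thesis by (rule that)
next
  case False
  then show ?thesis using ker by (intro that[of 0]) simp
qed

text \<open>Subtracting multiples of \<open>f\<close> from \<open>g\<close> and \<open>h\<close> such that both vanish at a vector \<open>e\<close> with
  \<open>f e \<noteq> 0\<close> reduces the claim to a single functional.\<close>

lemma functional_combination:
  assumes f: "functional f" and g: "functional g" and h: "functional h"
    and ker: "\<And>v. f v = 0 \<Longrightarrow> g v = 0 \<Longrightarrow> h v = 0"
  obtains \<beta> \<gamma> where "\<And>v. h v = \<beta> * f v + \<gamma> * g v"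
proof (cases "\<exists>e. f e \<noteq> 0")
  case True
  then obtain e where e: "f e \<noteq> 0" by blast
  define g' h' where "g' = (\<lambda>v. g v - g e / f e * f v)" and "h' = (\<lambda>v. h v - h e / f e * f v)"
  have fun': "functional g'" "functional h'"
    unfolding g'_def h'_def by (intro functional_lincomb f g h)+
  have "h' v = 0" if "g' v = 0" for v
  proof -
    let ?v = "v - (f v / f e) *\<^sub>K e"
    have "f ?v = 0" using f e by (simp add: functional_simps)
    moreover have "g ?v = 0" using that g by (simp add: functional_simps g'_def mult.commute)
    ultimately have "h ?v = 0" by (rule ker)
    then show ?thesis using h by (simp add: functional_simps h'_def mult.commute)
  qed
  then obtain \<gamma> where \<gamma>: "\<And>v. h' v = \<gamma> * g' v" using functional_multiple[OF fun'] by blast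
  have "h v = (h e / f e - \<gamma> * (g e / f e)) * f v + \<gamma> * g v" for v
    using \<gamma>[of v] by (simp add: g'_def h'_def algebra_simps)
  then show ?thesis by (rule that)
next
  case False
  then have "h v = 0" if "g v = 0" for v using ker that by blast
  from functional_multiple[OF g h this] obtain \<gamma> where "\<And>v. h v = \<gamma> * g v" by blast
  then show ?thesis by (intro that[of 0 \<gamma>]) simp
qed

lemma kernel_contains_span:
  assumes "functional f" "\<And>s. s \<in> S \<Longrightarrow> f s = 0" "v \<in> span S"
  shows "f v = 0"
proof -
  have "span S \<subseteq> {v. f v = 0}"
    using assms codim_le_1_kernel[OF assms(1)] by (intro span_minimal) (auto simp: codim_le_1_def)
  then show ?thesis using assms(3) by blast
qed

lemma notin_span_if_functional:
  assumes "functional f" "f v \<noteq> 0" "\<forall>s\<in>S. f s = 0"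
  shows "v \<notin> span S"
  using kernel_contains_span[OF assms(1), of S v] assms(2,3) by blast

text \<open>One step of a proof of linear independence, with the vectors treated one at a time.\<close>

lemma relation_coefficient_zero:
  assumes "a *\<^sub>K x + v = 0" "v \<in> span S" "x \<notin> span S"
  shows "a = 0"
proof (rule ccontr)
  assume "a \<noteq> 0"
  have "a *\<^sub>K x = - v" using assms(1) by (simp add: eq_neg_iff_add_eq_0)
  then have "inverse a *\<^sub>K (a *\<^sub>K x) \<in> span S" using assms(2) by (metis span_neg span_scale)
  then show False using assms(3) \<open>a \<noteq> 0\<close> by simp
qed

end

locale alternating_trilinear_form = linear_space +
  fixes \<phi> :: "'b \<Rightarrow> 'b \<Rightarrow> 'b \<Rightarrow> 'a"
  assumes linear1: "functional (\<lambda>x. \<phi> x y z)" and linear2: "functional (\<lambda>y. \<phi> x y z)"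
    and linear3: "functional (\<phi> x y)"
    and alternating1 [simp]: "\<phi> x x z = 0" and alternating2 [simp]: "\<phi> x y y = 0"
begin

lemmas expand = functional_simps[OF linear1] functional_simps[OF linear2] functional_simps[OF linear3]

lemma swap12: "\<phi> y x z = - \<phi> x y z"
proof -
  have "0 = \<phi> (x + y) (x + y) z" by (rule alternating1[symmetric])
  also have "\<dots> = \<phi> y x z + \<phi> x y z" unfolding expand by simp
  finally show ?thesis by (simp add: eq_neg_iff_add_eq_0)
qed

lemma swap23: "\<phi> x z y = - \<phi> x y z"
proof -
  have "0 = \<phi> x (y + z) (y + z)" by (rule alternating2[symmetric])
  also have "\<dots> = \<phi> x z y + \<phi> x y z" unfolding expand by simp
  finally show ?thesis by (simp add: eq_neg_iff_add_eq_0)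
qed

lemma rotate: "\<phi> y z x = \<phi> x y z"
  using swap12[of z y x] swap23[of z x y] swap12[of x z y] swap23[of x y z] swap23[of y x z] swap12[of x y z]
  by simp

lemma alternating3 [simp]: "\<phi> x y x = 0"
  using rotate[of x y x] by simp

text \<open>No \<open>2\<close>-space is annihilated. This is much stronger than having no radical vector: it says that every
  \<open>\<phi> x\<close> with \<open>x \<noteq> 0\<close> has the smallest possible radical, the line of \<open>x\<close>.\<close>

definition nondegenerate :: bool where
  "nondegenerate \<longleftrightarrow> (\<forall>u v. (\<forall>a b. a *\<^sub>K u + b *\<^sub>K v = 0 \<longrightarrow> a = 0 \<and> b = 0) \<longrightarrow> (\<exists>w. \<phi> u v w \<noteq> 0))"

text \<open>Otherwise \<open>\<phi> y z\<close> is a combination of \<open>\<phi> z x\<close> and \<open>\<phi> x y\<close>. But every combination of these three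
  functionals has the form \<open>\<phi> u v\<close> with \<open>u, v\<close> in the span of \<open>x\<close>, \<open>y\<close>, \<open>z\<close>, and it is not zero.\<close>

lemma dual_vector:
  assumes nd: nondegenerate and ind: "independent3 x y z"
  obtains w where "\<phi> y z w = 1" "\<phi> z x w = 0" "\<phi> x y w = 0"
proof (cases "\<exists>w. \<phi> z x w = 0 \<and> \<phi> x y w = 0 \<and> \<phi> y z w \<noteq> 0")
  case True
  then obtain w where "\<phi> z x w = 0" "\<phi> x y w = 0" "\<phi> y z w \<noteq> 0" by blast
  then show ?thesis by (intro that[of "inverse (\<phi> y z w) *\<^sub>K w"]) (simp_all add: expand)
next
  case False
  then obtain \<beta> \<gamma> where eq: "\<And>w. \<phi> y z w = \<beta> * \<phi> z x w + \<gamma> * \<phi> x y w"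
    using functional_combination[OF linear3 linear3 linear3, of z x x y y z] by blast
  have "\<phi> (y + \<beta> *\<^sub>K x) (z + \<gamma> *\<^sub>K x) w = 0" for w
  proof -
    have "\<phi> (y + \<beta> *\<^sub>K x) (z + \<gamma> *\<^sub>K x) w = \<phi> y z w + \<gamma> * \<phi> y x w + \<beta> * \<phi> x z w"
      by (simp add: expand algebra_simps)
    then show ?thesis using eq[of w] swap12[of x y w] swap12[of z x w] by simp
  qed
  moreover have "a = 0 \<and> b = 0" if "a *\<^sub>K (y + \<beta> *\<^sub>K x) + b *\<^sub>K (z + \<gamma> *\<^sub>K x) = 0" for a b
  proof -
    have "(a * \<beta> + b * \<gamma>) *\<^sub>K x + a *\<^sub>K y + b *\<^sub>K z = 0" using that by (simp add: algebra_simps)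
    then show ?thesis using ind unfolding independent3_def by blast
  qed
  ultimately show ?thesis using nd unfolding nondegenerate_def by blast
qed

text \<open>The span \<open>T\<close> of \<open>x\<close>, \<open>y\<close>, \<open>z\<close>, \<open>u\<close> and \<open>w'\<close> is totally isotropic for \<open>\<phi> x'\<close>. As \<open>T\<close>, \<open>w2\<close> and \<open>w3\<close>
  span the whole space when \<open>a \<noteq> 0\<close>, a vector \<open>t\<close> of \<open>T\<close> satisfies \<open>\<phi> x' t = 0\<close> as soon as it satisfies two
  linear equations. These have a nontrivial solution among the combinations of \<open>y\<close>, \<open>z\<close> and \<open>u\<close>,
  which are independent of \<open>x'\<close>, again because \<open>a \<noteq> 0\<close>.\<close>

lemma degenerate_vector:
  assumes nd: nondegenerate
    and xyz: "\<phi> x y z = 0"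
    and w1: "\<phi> y z w1 = 1" "\<phi> z x w1 = 0" "\<phi> x y w1 = 0"
    and w2: "\<phi> y z w2 = 0" "\<phi> z x w2 = 1" "\<phi> x y w2 = 0"
    and w3: "\<phi> y z w3 = 0" "\<phi> z x w3 = 0" "\<phi> x y w3 = 1"
    and u: "\<phi> y z u = 0" "\<phi> z x u = 0" "\<phi> x y u = 0"
    and ind: "\<And>a b c d. a *\<^sub>K x + b *\<^sub>K y + c *\<^sub>K z + d *\<^sub>K u = 0 \<Longrightarrow> a = 0 \<and> b = 0 \<and> c = 0 \<and> d = 0"
    and spn: "span {x, y, z, w1, w2, w3, u} = UNIV"
    and Q: "\<phi> (a *\<^sub>K x + b *\<^sub>K y + c *\<^sub>K z) u (a *\<^sub>K w1 + b *\<^sub>K w2 + c *\<^sub>K w3) = 0" and a: "a \<noteq> 0"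
  shows False
proof -
  define x' w' where "x' = a *\<^sub>K x + b *\<^sub>K y + c *\<^sub>K z" and "w' = a *\<^sub>K w1 + b *\<^sub>K w2 + c *\<^sub>K w3"
  obtain \<alpha> \<beta> \<gamma> where nz: "(\<alpha>, \<beta>, \<gamma>) \<noteq> (0, 0, 0)"
    and eq2: "\<alpha> * \<phi> x' y w2 + \<beta> * \<phi> x' z w2 + \<gamma> * \<phi> x' u w2 = 0"
    and eq3: "\<alpha> * \<phi> x' y w3 + \<beta> * \<phi> x' z w3 + \<gamma> * \<phi> x' u w3 = 0"
    by (rule two_equations_three_unknowns[of "\<phi> x' y w2" "\<phi> x' z w2" "\<phi> x' u w2"
          "\<phi> x' y w3" "\<phi> x' z w3" "\<phi> x' u w3"])
  define t where "t = \<alpha> *\<^sub>K y + \<beta> *\<^sub>K z + \<gamma> *\<^sub>K u"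
  have perm: "\<phi> x z y = 0" "\<phi> y x z = 0" "\<phi> y z x = 0" "\<phi> z x y = 0" "\<phi> z y x = 0"
    using xyz rotate[of x y z] rotate[of y z x] swap23[of x z y] swap12[of x y z] swap12[of y z x] by simp_all
  have pu: "\<phi> y x p = - \<phi> x y p" "\<phi> x z p = - \<phi> z x p" "\<phi> z y p = - \<phi> y z p" for p
    by (rule swap12)+
  have pu': "\<phi> x u y = 0" "\<phi> x u z = 0" "\<phi> y u x = 0" "\<phi> y u z = 0" "\<phi> z u x = 0" "\<phi> z u y = 0"
    using u swap23[of x u y] swap23[of x u z] swap23[of y u x] swap23[of y u z] swap23[of z u x] swap23[of z u y]
    by (simp_all add: pu)
  have tw2: "\<phi> x' t w2 = 0" and tw3: "\<phi> x' t w3 = 0"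
    using eq2 eq3 by (simp_all add: t_def functional_simps[OF linear2])
  have tx: "\<phi> x' t x = 0" "\<phi> x' t y = 0" "\<phi> x' t z = 0" "\<phi> x' t u = 0"
    unfolding x'_def t_def using perm xyz u by (simp_all add: expand pu pu')
  have "\<phi> x' y w' = 0" "\<phi> x' z w' = 0"
    unfolding x'_def w'_def using w1 w2 w3 by (simp_all add: expand pu algebra_simps)
  moreover have "\<phi> x' u w' = 0" using Q by (simp add: x'_def w'_def)
  ultimately have "\<phi> x' t w' = 0" by (simp add: t_def functional_simps[OF linear2])
  then have "a * \<phi> x' t w1 = 0" using tw2 tw3 by (simp add: w'_def functional_simps[OF linear3])
  then have tw1: "\<phi> x' t w1 = 0" using a by simp
  have "\<phi> x' t v = 0" for v
    by (rule kernel_contains_span[OF linear3, of "{x, y, z, w1, w2, w3, u}"]) (use tx tw1 tw2 tw3 spn in auto)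
  moreover have "r = 0 \<and> s = 0" if "r *\<^sub>K x' + s *\<^sub>K t = 0" for r s
  proof -
    have "(r * a) *\<^sub>K x + (r * b + s * \<alpha>) *\<^sub>K y + (r * c + s * \<beta>) *\<^sub>K z + (s * \<gamma>) *\<^sub>K u = 0"
      using that by (simp add: x'_def t_def algebra_simps)
    from ind[OF this] show ?thesis using a nz by auto
  qed
  ultimately show False using nd unfolding nondegenerate_def by blast
qed

theorem no_nondegenerate_form:
  assumes dim: "dim (UNIV :: 'b set) = 7"
    and ternary: "\<And>p q r l m n :: 'a. \<exists>a b c. (a, b, c) \<noteq> (0, 0, 0) \<and>
      p * a\<^sup>2 + q * b\<^sup>2 + r * c\<^sup>2 + l * b * c + m * c * a + n * a * b = 0"
  shows "\<not> nondegenerate"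
proof
  assume nd: nondegenerate
  have outside: "\<exists>v. v \<notin> span S" if "finite S" "card S < 7" for S :: "'b set"
    using dim_le_card[of UNIV S] that dim by force
  have outside6: "\<exists>v. v \<notin> span {a, b, c, d, e, f}" for a b c d e f :: 'b
    by (rule outside) (simp_all add: card_insert_if)
  obtain x where x: "x \<notin> span {}" using outside[of "{}"] by auto
  obtain y where y: "y \<notin> span {x}" using outside6[of x x x x x x] by auto
  obtain v1 where v1: "v1 \<notin> span {x, y}" using outside6[of x x x x x y] by auto
  obtain v2 where v2: "v2 \<notin> span {v1, x, y}" using outside6[of v1 v1 v1 v1 x y] by auto
  \<comment> \<open>Two vectors that are independent modulo \<open>x\<close> and \<open>y\<close> have a nontrivial combination in the kernel of
  \<open>\<phi> x y\<close>.\<close>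
  obtain z where z: "z \<notin> span {x, y}" and xyz: "\<phi> x y z = 0"
  proof (cases "\<phi> x y v1 = 0")
    case False
    let ?z = "v2 - (\<phi> x y v2 / \<phi> x y v1) *\<^sub>K v1"
    have "?z \<notin> span {x, y}" using v2 span_breakdown_eq[of v2 v1 "{x, y}"] by blast
    moreover have "\<phi> x y ?z = 0" using False by (simp add: expand)
    ultimately show ?thesis using that by blast
  qed (use v1 that in blast)
  have z': "z \<notin> span {y, x}" using z by (simp add: insert_commute)
  have ind3: "a = 0 \<and> b = 0 \<and> c = 0" if "a *\<^sub>K x + b *\<^sub>K y + c *\<^sub>K z = 0" for a b c
  proof -
    have "c *\<^sub>K z + (a *\<^sub>K x + b *\<^sub>K y) = 0" using that by (simp add: add.commute)
    moreover have "a *\<^sub>K x + b *\<^sub>K y \<in> span {x, y}" by (intro span_add span_scale span_base) simp_all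
    ultimately have "c = 0" by (rule relation_coefficient_zero[OF _ _ z])
    then have "b *\<^sub>K y + a *\<^sub>K x = 0" using that by (simp add: add.commute)
    moreover have "a *\<^sub>K x \<in> span {x}" by (intro span_scale span_base) simp
    ultimately have "b = 0" by (rule relation_coefficient_zero[OF _ _ y])
    with \<open>c = 0\<close> show ?thesis using that x by simp
  qed
  then have i1: "independent3 x y z" unfolding independent3_def by blast
  obtain w1 where w1: "\<phi> y z w1 = 1" "\<phi> z x w1 = 0" "\<phi> x y w1 = 0"
    by (rule dual_vector[OF nd i1])
  obtain w2 where w2: "\<phi> z x w2 = 1" "\<phi> x y w2 = 0" "\<phi> y z w2 = 0"
    by (rule dual_vector[OF nd independent3_rotate[OF i1]])
  obtain w3 where w3: "\<phi> x y w3 = 1" "\<phi> y z w3 = 0" "\<phi> z x w3 = 0"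
    by (rule dual_vector[OF nd independent3_rotate[OF independent3_rotate[OF i1]]])
  obtain u0 where u0: "u0 \<notin> span {w3, w2, w1, z, y, x}" using outside6 by blast
  define u where "u = u0 - (\<phi> y z u0 *\<^sub>K w1 + \<phi> z x u0 *\<^sub>K w2 + \<phi> x y u0 *\<^sub>K w3)"
  have u: "\<phi> y z u = 0" "\<phi> z x u = 0" "\<phi> x y u = 0"
    using w1 w2 w3 by (simp_all add: u_def functional_simps[OF linear3])
  have u_notin: "u \<notin> span {w3, w2, w1, z, y, x}"
  proof
    assume "u \<in> span {w3, w2, w1, z, y, x}"
    moreover have "\<phi> y z u0 *\<^sub>K w1 + \<phi> z x u0 *\<^sub>K w2 + \<phi> x y u0 *\<^sub>K w3 \<in> span {w3, w2, w1, z, y, x}"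
      by (intro span_add span_scale span_base) auto
    ultimately have "u + (\<phi> y z u0 *\<^sub>K w1 + \<phi> z x u0 *\<^sub>K w2 + \<phi> x y u0 *\<^sub>K w3) \<in> span {w3, w2, w1, z, y, x}"
      by (rule span_add)
    then show False using u0 by (simp add: u_def)
  qed
  have yzx: "\<phi> y z x = 0" "\<phi> z x y = 0" using rotate[of x y z] rotate[of y z x] xyz by simp_all
  have n1: "w1 \<notin> span {z, y, x}"
    by (rule notin_span_if_functional[OF linear3, of y z]) (simp_all add: yzx w1)
  have n2: "w2 \<notin> span {w1, z, y, x}"
    by (rule notin_span_if_functional[OF linear3, of z x]) (simp_all add: yzx w1 w2)
  have n3: "w3 \<notin> span {w2, w1, z, y, x}"
    by (rule notin_span_if_functional[OF linear3, of x y]) (simp_all add: xyz w1 w2 w3)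
  have indB: "independent {u, w3, w2, w1, z, y, x}"
    using u_notin n1 n2 n3 z' y x independent_empty by (intro independent_insertI) auto
  have notin: "a \<notin> S" if "a \<notin> span S" for a S using span_base[of a S] that by blast
  have card7: "card {u, w3, w2, w1, z, y, x} = 7"
    using notin[OF u_notin] notin[OF n1] notin[OF n2] notin[OF n3] notin[OF z'] notin[OF y] by simp
  obtain B where B: "{u, w3, w2, w1, z, y, x} \<subseteq> B" "independent B" "UNIV \<subseteq> span B"
    using maximal_independent_subset_extend[OF subset_UNIV indB] by metis
  from B(3) have spnB: "span B = UNIV" by (rule top.extremum_uniqueI)
  have cB: "card B = 7" using dim_eq_card[of B UNIV] B(2) spnB dim by simp
  then have "finite B" by (intro card_ge_0_finite) simp
  then have "{u, w3, w2, w1, z, y, x} = B"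
    by (intro card_subset_eq B(1)) (simp_all only: cB card7)
  then have spn0: "span {u, w3, w2, w1, z, y, x} = UNIV" using spnB by simp
  have spn: "span {x, y, z, w1, w2, w3, u} = UNIV" "span {y, z, x, w2, w3, w1, u} = UNIV"
    "span {z, x, y, w3, w1, w2, u} = UNIV"
    by (rule trans[OF _ spn0], rule arg_cong[where f = span], blast)+
  have u_notin': "u \<notin> span {x, y, z}"
  proof -
    have "{x, y, z} \<subseteq> {w3, w2, w1, z, y, x}" by blast
    then show ?thesis using u_notin span_mono by blast
  qed
  have ind4: "a = 0 \<and> b = 0 \<and> c = 0 \<and> d = 0" if "a *\<^sub>K x + b *\<^sub>K y + c *\<^sub>K z + d *\<^sub>K u = 0" for a b c d
  proof -
    have "d *\<^sub>K u + (a *\<^sub>K x + b *\<^sub>K y + c *\<^sub>K z) = 0" using that by (simp add: add.commute)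
    moreover have "a *\<^sub>K x + b *\<^sub>K y + c *\<^sub>K z \<in> span {x, y, z}"
      by (intro span_add span_scale span_base) simp_all
    ultimately have "d = 0" by (rule relation_coefficient_zero[OF _ _ u_notin'])
    then show ?thesis using that ind3 by simp
  qed
  obtain a b c where abc: "(a, b, c) \<noteq> (0, 0, 0)" and "\<phi> x u w1 * a\<^sup>2 + \<phi> y u w2 * b\<^sup>2 + \<phi> z u w3 * c\<^sup>2 +
      (\<phi> y u w3 + \<phi> z u w2) * b * c + (\<phi> z u w1 + \<phi> x u w3) * c * a + (\<phi> x u w2 + \<phi> y u w1) * a * b = 0"
    using ternary by metis
  then have Q: "\<phi> (a *\<^sub>K x + b *\<^sub>K y + c *\<^sub>K z) u (a *\<^sub>K w1 + b *\<^sub>K w2 + c *\<^sub>K w3) = 0"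
    by (simp add: expand algebra_simps power2_eq_square)
  \<comment> \<open>The configuration is invariant under the cyclic permutation of \<open>x, y, z\<close> together with
  \<open>w1, w2, w3\<close> and \<open>a, b, c\<close>, so each of the coefficients may play the role of the first one.\<close>
  consider "a \<noteq> 0" | "b \<noteq> 0" | "c \<noteq> 0" using abc by blast
  then show False
  proof cases
    case 1
    show ?thesis
      by (rule degenerate_vector[OF nd xyz w1 w2(3,1,2) w3(2,3,1) u ind4 spn(1) Q 1])
  next
    case 2
    have "\<phi> (b *\<^sub>K y + c *\<^sub>K z + a *\<^sub>K x) u (b *\<^sub>K w2 + c *\<^sub>K w3 + a *\<^sub>K w1) = 0" using Q by (simp add: ac_simps)
    moreover have "p = 0 \<and> q = 0 \<and> r = 0 \<and> s = 0" if "p *\<^sub>K y + q *\<^sub>K z + r *\<^sub>K x + s *\<^sub>K u = 0" for p q r s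
      using ind4[of r p q s] that by (simp add: ac_simps)
    ultimately show ?thesis
      using degenerate_vector[OF nd yzx(1) w2 w3(3,1,2) w1(2,3,1) u(2,3,1) _ spn(2) _ 2] by blast
  next
    case 3
    have "\<phi> (c *\<^sub>K z + a *\<^sub>K x + b *\<^sub>K y) u (c *\<^sub>K w3 + a *\<^sub>K w1 + b *\<^sub>K w2) = 0" using Q by (simp add: ac_simps)
    moreover have "p = 0 \<and> q = 0 \<and> r = 0 \<and> s = 0" if "p *\<^sub>K z + q *\<^sub>K x + r *\<^sub>K y + s *\<^sub>K u = 0" for p q r s
      using ind4[of q r p s] that by (simp add: ac_simps)
    ultimately show ?thesis
      using degenerate_vector[OF nd yzx(2) w3 w1(3,1,2) w2(2,3,1) u(3,1,2) _ spn(3) _ 3] by blast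
  qed
qed

end

section \<open>Hyperplanes of the Grassmannian of planes\<close>

locale fin_dim_linear_space = finite_dimensional_vector_space scale Basis
  for scale :: "'a::field \<Rightarrow> 'b::ab_group_add \<Rightarrow> 'b" (infixr \<open>*\<^sub>K\<close> 75) and Basis
begin

sublocale linear_space scale ..

text \<open>Dependent triples are included: a trilinear form that is alternating vanishes on them.\<close>

definition coplanar :: "'b set set \<Rightarrow> 'b \<Rightarrow> 'b \<Rightarrow> 'b \<Rightarrow> bool" where
  "coplanar H x y z \<longleftrightarrow> dim {x, y, z} < 3 \<or> span {x, y, z} \<in> H"

lemma plane_eq_span:
  assumes P: "subspace P" "dim P = 3" and xy: "dim {x, y} = 2" "span {x, y} \<subseteq> P"
    and u: "u \<in> P" "u \<notin> span {x, y}"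
  shows "P = span {x, y, u}"
proof -
  have "{u, x, y} \<subseteq> P" using xy(2) u(1) span_base[of x "{x, y}"] span_base[of y "{x, y}"] by blast
  then have "span {u, x, y} \<subseteq> P" by (rule span_minimal[OF _ P(1)])
  moreover have "dim (span {u, x, y}) = 3" using u(2) xy(1) by (simp add: dim_insert[of u])
  ultimately have "span {u, x, y} = P" using subspace_dim_equal[OF subspace_span P(1)] P(2) by simp
  then show ?thesis by (simp add: insert_commute)
qed

text \<open>With \<open>x\<close> and \<open>y\<close> fixed, the relation is described by the members of \<open>H\<close> through the span of \<open>x\<close> and
  \<open>y\<close>. In this description the closure properties of \<open>H\<close> can be applied.\<close>

lemma coplanar_iff:
  assumes H: "H \<subseteq> grassmann_points scale 3" and xy: "dim {x, y} = 2"
  shows "coplanar H x y u \<longleftrightarrow> u \<in> span {x, y} \<or> (\<exists>P\<in>H. span {x, y} \<subseteq> P \<and> u \<in> P)"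
proof (cases "u \<in> span {x, y}")
  case True
  then have "dim {u, x, y} = 2" using xy by (simp add: dim_insert[of u])
  then show ?thesis using True by (simp add: coplanar_def insert_commute)
next
  case False
  then have "dim {u, x, y} = 3" using xy by (simp add: dim_insert[of u])
  then have "coplanar H x y u \<longleftrightarrow> span {x, y, u} \<in> H" by (simp add: coplanar_def insert_commute)
  moreover have "span {x, y} \<subseteq> span {x, y, u}" by (intro span_mono) blast
  moreover have "u \<in> span {x, y, u}" by (intro span_base) blast
  moreover have "P = span {x, y, u}" if "P \<in> H" "span {x, y} \<subseteq> P" "u \<in> P" for P
    using plane_eq_span[OF _ _ xy that(2,3) False] H that(1) by (auto simp: grassmann_points_def)
  ultimately show ?thesis using False by blast
qed

lemma pencil_is_line:
  assumes "dim {x, y} = 2" "dim {v, w, x, y} = 4"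
  shows "{P \<in> grassmann_points scale 3. span {x, y} \<subseteq> P \<and> P \<subseteq> span {v, w, x, y}} \<in> grassmann_lines scale 3"
proof -
  have "span {x, y} \<subseteq> span {v, w, x, y}" by (intro span_mono) blast
  then show ?thesis
    unfolding grassmann_lines_def mem_Collect_eq
    by (intro exI[of _ "span {x, y}"] exI[of _ "span {v, w, x, y}"]) (simp add: assms)
qed

text \<open>The lines of the Grassmannian with lower space \<open>\<langle>x, y\<rangle>\<close> are the lines of the projective space of the
  planes through \<open>\<langle>x, y\<rangle>\<close>. There, a set closed under lines is a projective subspace, and it has
  codimension at most one if it meets every line.\<close>

lemma coplanar_codim_le_1:
  assumes hyp: "grassmann_hyperplane scale 3 H"
  shows "codim_le_1 {u. coplanar H x y u}"
proof (cases "dim {x, y} = 2")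
  case False
  have "dim {x, y} \<le> 2" using dim_le_card'[of "{x, y}"] by (simp add: card_insert_if split: if_splits)
  then have "dim {x, y} \<le> 1" using False by simp
  then have "dim {u, x, y} < 3" for u by (simp add: dim_insert[of u])
  then have "coplanar H x y u" for u by (simp add: coplanar_def insert_commute)
  then show ?thesis by (simp add: codim_le_1_def)
next
  case xy: True
  have H: "H \<subseteq> grassmann_points scale 3"
    and closed: "\<And>l P Q. l \<in> grassmann_lines scale 3 \<Longrightarrow> P \<in> l \<Longrightarrow> P \<in> H \<Longrightarrow> Q \<in> l \<Longrightarrow> Q \<in> H \<Longrightarrow> P \<noteq> Q \<Longrightarrow> l \<subseteq> H"
    and meets: "\<And>l. l \<in> grassmann_lines scale 3 \<Longrightarrow> \<exists>P\<in>l. P \<in> H"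
    using hyp unfolding grassmann_hyperplane_def grassmann_subspace_def by blast+
  have HP: "subspace P" "dim P = 3" if "P \<in> H" for P using H that by (auto simp: grassmann_points_def)
  let ?Y = "span {x, y}"
  define U where "U = {u. u \<in> ?Y \<or> (\<exists>P\<in>H. ?Y \<subseteq> P \<and> u \<in> P)}"
  have add: "v + w \<in> U" if "v \<in> U" "w \<in> U" for v w
  proof -
    consider "v \<in> ?Y" "w \<in> ?Y" | P where "P \<in> H" "?Y \<subseteq> P" "v \<in> P" "w \<in> P"
      | P Q where "P \<in> H" "?Y \<subseteq> P" "v \<in> P" "w \<notin> P" "v \<notin> Q" "Q \<in> H" "?Y \<subseteq> Q" "w \<in> Q"
      using \<open>v \<in> U\<close> \<open>w \<in> U\<close> unfolding U_def by blast
    then show ?thesis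
    proof cases
      case 1
      then show ?thesis unfolding U_def by (simp add: span_add)
    next
      case 2
      then have "v + w \<in> P" using HP subspace_add by blast
      then show ?thesis unfolding U_def using 2 by blast
    next
      case 3
      have vY: "v \<notin> ?Y" and wY: "w \<notin> ?Y" using 3 by blast+
      have Peq: "P = span {x, y, v}" using plane_eq_span[OF HP[OF 3(1)] xy 3(2,3) vY] .
      have Qeq: "Q = span {x, y, w}" using plane_eq_span[OF HP[OF 3(6)] xy 3(7,8) wY] .
      have "dim {w, x, y} = 3" using wY xy by (simp add: dim_insert[of w])
      moreover have "v \<notin> span {w, x, y}" using 3(5) Qeq by (simp add: insert_commute)
      ultimately have d4: "dim {v, w, x, y} = 4" by (simp add: dim_insert[of v])
      let ?l = "{P \<in> grassmann_points scale 3. ?Y \<subseteq> P \<and> P \<subseteq> span {v, w, x, y}}"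
      have "P \<subseteq> span {v, w, x, y}" "Q \<subseteq> span {v, w, x, y}"
        unfolding Peq Qeq by (intro span_mono; blast)+
      then have "?l \<subseteq> H"
        using 3 H closed[OF pencil_is_line[OF xy d4], of P Q] by blast
      show ?thesis
      proof (cases "v + w \<in> ?Y")
        case False
        have "dim (span {v + w, x, y}) = 3" using False xy by (simp add: dim_insert[of "v + w"])
        moreover have "span {v + w, x, y} \<subseteq> span {v, w, x, y}"
          by (rule span_minimal) (auto intro: span_add span_base)
        moreover have "?Y \<subseteq> span {v + w, x, y}" by (intro span_mono) blast
        ultimately have "span {v + w, x, y} \<in> H"
          using \<open>?l \<subseteq> H\<close> by (auto simp: grassmann_points_def)
        moreover have "v + w \<in> span {v + w, x, y}" by (intro span_base) blast
        ultimately show ?thesis unfolding U_def using \<open>?Y \<subseteq> span {v + w, x, y}\<close> by blast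
      qed (simp add: U_def)
    qed
  qed
  have "subspace U"
    unfolding subspace_def
  proof (intro conjI ballI allI)
    show "0 \<in> U" by (simp add: U_def span_zero)
    show "v + w \<in> U" if "v \<in> U" "w \<in> U" for v w using add that .
    show "c *\<^sub>K v \<in> U" if "v \<in> U" for c v
      using that HP(1) subspace_scale span_scale unfolding U_def by blast
  qed
  moreover have "\<exists>c. w - c *\<^sub>K v \<in> U" if v: "v \<notin> U" for v w
  proof -
    have vY: "v \<notin> ?Y" using v by (simp add: U_def)
    show ?thesis
    proof (cases "w \<in> span {v, x, y}")
      case True
      then obtain c where "w - c *\<^sub>K v \<in> ?Y" using span_breakdown_eq[of w v "{x, y}"] by blast
      then show ?thesis unfolding U_def by blast
    next
      case False
      have "dim {v, x, y} = 3" using vY xy by (simp add: dim_insert[of v])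
      then have "dim {w, v, x, y} = 4" using False by (simp add: dim_insert[of w])
      from meets[OF pencil_is_line[OF xy this]] obtain P where P: "P \<in> H" "?Y \<subseteq> P" "P \<subseteq> span {w, v, x, y}"
        by blast
      have "\<not> P \<subseteq> ?Y" using dim_subset[of P ?Y] HP[OF P(1)] xy by auto
      then obtain p where p: "p \<in> P" "p \<notin> ?Y" by blast
      then obtain a where "p - a *\<^sub>K w \<in> span {v, x, y}"
        using P(3) span_breakdown_eq[of p w "{v, x, y}"] by blast
      then obtain b where b: "p - a *\<^sub>K w - b *\<^sub>K v \<in> ?Y"
        using span_breakdown_eq[of "p - a *\<^sub>K w" v "{x, y}"] by blast
      then have "p - (p - a *\<^sub>K w - b *\<^sub>K v) \<in> P"
        using subspace_diff[OF HP(1)[OF P(1)] p(1)] P(2) by blast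
      then have abP: "a *\<^sub>K w + b *\<^sub>K v \<in> P" by (simp add: algebra_simps)
      have "a \<noteq> 0"
      proof
        assume "a = 0"
        then have "b \<noteq> 0" using b p(2) by auto
        have "inverse b *\<^sub>K (b *\<^sub>K v) \<in> P"
          using subspace_scale[OF HP(1)[OF P(1)], of "b *\<^sub>K v" "inverse b"] abP \<open>a = 0\<close> by simp
        then have "v \<in> P" using \<open>b \<noteq> 0\<close> by simp
        then show False using v P unfolding U_def by blast
      qed
      have "inverse a *\<^sub>K (a *\<^sub>K w + b *\<^sub>K v) \<in> P"
        by (rule subspace_scale[OF HP(1)[OF P(1)] abP])
      then have "w - (- (inverse a * b)) *\<^sub>K v \<in> P" using \<open>a \<noteq> 0\<close> by (simp add: scale_right_distrib)
      then show ?thesis unfolding U_def using P by blast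
    qed
  qed
  ultimately have "codim_le_1 U" by (simp add: codim_le_1_def)
  then show ?thesis unfolding U_def coplanar_iff[OF H xy] .
qed

theorem hyperplane_trilinear_form:
  assumes hyp: "grassmann_hyperplane scale 3 H"
  shows "\<exists>\<phi>. alternating_trilinear_form scale \<phi> \<and> (\<forall>x y z. \<phi> x y z = 0 \<longleftrightarrow> coplanar H x y z)"
proof -
  have refl: "coplanar H x x z" for x z
  proof -
    have "card {x, z} \<le> 2" by (simp add: card_insert_if)
    then have "dim {x, z} < 3" using dim_le_card'[of "{x, z}"] by simp
    then show ?thesis by (simp add: coplanar_def)
  qed
  have sym: "coplanar H x y z \<Longrightarrow> coplanar H y x z" "coplanar H x y z \<Longrightarrow> coplanar H x z y" for x y z
    by (simp_all add: coplanar_def insert_commute)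
  note tri = trilinear_form_of_ternary_relation[of "coplanar H", OF sym refl coplanar_codim_le_1[OF hyp]]
  obtain \<phi> where lin: "\<And>x y. functional (\<phi> x y)" "\<And>x z. functional (\<lambda>y. \<phi> x y z)"
    "\<And>y z. functional (\<lambda>x. \<phi> x y z)" and \<phi>: "\<And>x y z. \<phi> x y z = 0 \<longleftrightarrow> coplanar H x y z"
    using tri by metis
  have "coplanar H x y y" for x y using sym refl by metis
  then have "alternating_trilinear_form scale \<phi>"
    by unfold_locales (simp_all add: lin \<phi> refl)
  then show ?thesis using \<phi> by (intro exI[of _ \<phi>]) simp
qed

lemma no_upper_radical_nondegenerate:
  assumes form: "alternating_trilinear_form scale \<phi>" and \<phi>: "\<And>x y z. \<phi> x y z = 0 \<longleftrightarrow> coplanar H x y z"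
    and H: "H \<subseteq> grassmann_points scale 3" and empty: "upper_radical scale H = {}"
  shows "alternating_trilinear_form.nondegenerate scale \<phi>"
  unfolding alternating_trilinear_form.nondegenerate_def[OF form]
proof (intro allI impI)
  fix u v assume uv: "\<forall>a b. a *\<^sub>K u + b *\<^sub>K v = 0 \<longrightarrow> a = 0 \<and> b = 0"
  have "v \<noteq> 0" using spec[OF spec[OF uv, of 0], of 1] by simp
  moreover have "u \<notin> span {v}"
  proof
    assume "u \<in> span {v}"
    then obtain k where "u = k *\<^sub>K v" by (auto simp: span_singleton)
    then show False using spec[OF spec[OF uv, of 1], of "-k"] by simp
  qed
  ultimately have d: "dim {u, v} = 2" by (simp add: dim_insert[of u])
  then have "span {u, v} \<in> grassmann_points scale 2" by (simp add: grassmann_points_def)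
  then obtain P where P: "P \<in> grassmann_points scale 3" "span {u, v} \<subseteq> P" "P \<notin> H"
    using empty unfolding upper_radical_def by blast
  then have P': "subspace P" "dim P = 3" by (auto simp: grassmann_points_def)
  have "\<not> P \<subseteq> span {u, v}" using dim_subset[of P "span {u, v}"] P'(2) d by auto
  then obtain w where w: "w \<in> P" "w \<notin> span {u, v}" by blast
  then have "P = span {u, v, w}" by (rule plane_eq_span[OF P' d P(2)])
  moreover have "dim {u, v, w} = 3" using calculation P'(2) by simp
  ultimately have "\<not> coplanar H u v w" using P(3) by (simp add: coplanar_def)
  then show "\<exists>w. \<phi> u v w \<noteq> 0" using \<phi> by blast
qed

end

section \<open>Isotropic ternary quadratic forms\<close>

text \<open>Completing the square twice turns the form, up to a factor, into
  \<open>u\<^sup>2 - 4 D v\<^sup>2 - (E\<^sup>2 - 4 D F) c\<^sup>2\<close>. A zero with \<open>c = 2\<close> is asked for because the norm computation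
  gives twice an element of the quadratic extension in coordinates.\<close>

lemma ternary_isotropic_char_not_2:
  fixes p q r l m n :: "'a::field"
  assumes two: "(2 :: 'a) \<noteq> 0"
    and conic: "\<And>x y :: 'a. x \<noteq> 0 \<Longrightarrow> \<exists>u v. u\<^sup>2 = x * v\<^sup>2 + y * 2\<^sup>2"
  shows "\<exists>a b c. (a, b, c) \<noteq> (0, 0, 0) \<and>
    p * a\<^sup>2 + q * b\<^sup>2 + r * c\<^sup>2 + l * b * c + m * c * a + n * a * b = 0"
proof (cases "p = 0")
  case True
  then show ?thesis by (intro exI[of _ 1] exI[of _ 0]) simp
next
  case p: False
  define D E F where "D = n\<^sup>2 - 4 * p * q" and "E = 2 * n * m - 4 * p * l" and "F = m\<^sup>2 - 4 * p * r"
  have four: "(4 :: 'a) \<noteq> 0" using two by (metis mult_eq_0_iff mult_2 numeral_Bit0 one_add_one)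
  have complete1: "4 * p * (p * a\<^sup>2 + q * b\<^sup>2 + r * c\<^sup>2 + l * b * c + m * c * a + n * a * b) =
      (2 * p * a + n * b + m * c)\<^sup>2 - (D * b\<^sup>2 + E * b * c + F * c\<^sup>2)" for a b c
    by (simp add: D_def E_def F_def power2_eq_square algebra_simps)
  have reduce: ?thesis if w: "w\<^sup>2 = D * b\<^sup>2 + E * b * c + F * c\<^sup>2" "(w, b, c) \<noteq> (0, 0, 0)" for w b c
  proof -
    define a where "a = (w - n * b - m * c) / (2 * p)"
    have "2 * p * a + n * b + m * c = w" using p two by (simp add: a_def)
    then have "4 * p * (p * a\<^sup>2 + q * b\<^sup>2 + r * c\<^sup>2 + l * b * c + m * c * a + n * a * b) = 0"
      unfolding complete1 using w(1) by simp
    moreover have "(a, b, c) \<noteq> (0, 0, 0)" using w(2) p two by (auto simp: a_def)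
    ultimately show ?thesis using p four by (intro exI[of _ a] exI[of _ b] exI[of _ c]) simp
  qed
  show ?thesis
  proof (cases "D = 0")
    case True
    then show ?thesis by (intro reduce[of 0 1 0]) simp_all
  next
    case D: False
    have "4 * D \<noteq> 0" using D four by simp
    obtain u v where uv: "u\<^sup>2 = (4 * D) * v\<^sup>2 + (E\<^sup>2 - 4 * D * F) * 2\<^sup>2"
      using conic[OF \<open>4 * D \<noteq> 0\<close>] by blast
    define b where "b = (u - 2 * E) / (2 * D)"
    have u: "u = 2 * D * b + 2 * E" using D two by (simp add: b_def)
    have "4 * D * v\<^sup>2 = 4 * D * (D * b\<^sup>2 + E * b * 2 + F * 2\<^sup>2)"
      using uv unfolding u by (simp add: power2_eq_square algebra_simps)
    then have "v\<^sup>2 = D * b\<^sup>2 + E * b * 2 + F * 2\<^sup>2" using D four by simp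
    then show ?thesis using two by (intro reduce[of v b 2]) simp_all
  qed
qed

text \<open>The polar form is alternating on a space of odd dimension and has \<open>(l, m, n)\<close> in its radical. On the
  span of \<open>(l, m, n)\<close> and another vector the quadratic form is therefore additive, and as
  all scalars are squares, it has a zero there. If \<open>(l, m, n) = 0\<close>, the whole form is additive.\<close>

lemma ternary_isotropic_char_2:
  fixes p q r l m n :: "'a::field"
  assumes two: "(2 :: 'a) = 0" and root: "\<And>x :: 'a. \<exists>y. y\<^sup>2 = x"
  shows "\<exists>a b c. (a, b, c) \<noteq> (0, 0, 0) \<and>
    p * a\<^sup>2 + q * b\<^sup>2 + r * c\<^sup>2 + l * b * c + m * c * a + n * a * b = 0"
proof -
  have double: "x + x = 0" for x :: 'a using two by (metis mult_2 mult_zero_left)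
  define Q where "Q = (\<lambda>a b c. p * a\<^sup>2 + q * b\<^sup>2 + r * c\<^sup>2 + l * b * c + m * c * a + n * a * b)"
  have Q_add: "Q (l * s + a) (m * s + b) (n * s + c) = s\<^sup>2 * Q l m n + Q a b c" for s a b c
  proof -
    have "Q (l * s + a) (m * s + b) (n * s + c) = s\<^sup>2 * Q l m n + Q a b c +
        2 * (p * l * s * a + q * m * s * b + r * n * s * c + s * l * m * c + s * l * n * b + s * m * n * a)"
      by (simp add: Q_def power2_eq_square algebra_simps)
    then show ?thesis by (simp add: two)
  qed
  have "\<exists>a b c. (a, b, c) \<noteq> (0, 0, 0) \<and> Q a b c = 0"
  proof (cases "(l, m, n) = (0, 0, 0)")
    case True
    obtain x y where xy: "x\<^sup>2 = q" "y\<^sup>2 = p" using root by metis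
    show ?thesis
    proof (cases "(x, y) = (0, 0)")
      case True
      then show ?thesis using \<open>(l, m, n) = (0, 0, 0)\<close> xy by (intro exI[of _ 1] exI[of _ 0]) (simp add: Q_def)
    next
      case False
      have "Q x y 0 = 0" using \<open>(l, m, n) = (0, 0, 0)\<close> xy double[of "p * q"] by (simp add: Q_def mult.commute)
      then show ?thesis using False by blast
    qed
  next
    case False
    show ?thesis
    proof (cases "Q l m n = 0")
      case True
      then show ?thesis using False by blast
    next
      case nz: False
      obtain a b c where indep: "\<And>s. (l * s + a, m * s + b, n * s + c) \<noteq> (0, 0, 0)"
      proof (cases "l = 0")
        case True
        show ?thesis using that[of 1 0 0] True by simp
      next
        case False
        have "(l * s + 0, m * s + 1, n * s + 0) \<noteq> (0, 0, 0)" for s using False by auto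
        then show ?thesis using that by blast
      qed
      obtain s where s: "s\<^sup>2 = Q a b c / Q l m n" using root by blast
      have "Q (l * s + a) (m * s + b) (n * s + c) = 0"
        unfolding Q_add s using nz double[of "Q a b c"] by simp
      then show ?thesis using indep[of s] by blast
    qed
  qed
  then show ?thesis unfolding Q_def .
qed

section \<open>Automorphisms of the algebraic closure\<close>

text \<open>The graph of a ring homomorphism over the ground field, defined on some subring of the algebraic
  closure. Graphs are ordered by inclusion, and being single-valued amounts to a condition on the
  pairs with first component \<open>0\<close>.\<close>

definition partial_embedding :: "('k::field alg_closure \<times> 'k alg_closure) set \<Rightarrow> bool" where
  "partial_embedding M \<longleftrightarrow>
     (\<forall>a. (to_ac a, to_ac a) \<in> M) \<and>
     (\<forall>x x' y y'. (x, x') \<in> M \<longrightarrow> (y, y') \<in> M \<longrightarrow> (x + y, x' + y') \<in> M \<and> (x * y, x' * y') \<in> M) \<and>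
     (\<forall>x'. (0, x') \<in> M \<longrightarrow> x' = 0)"

lemma partial_embedding_const: "partial_embedding M \<Longrightarrow> (to_ac a, to_ac a) \<in> M"
  by (simp add: partial_embedding_def)

lemma partial_embedding_add: "partial_embedding M \<Longrightarrow> (x, x') \<in> M \<Longrightarrow> (y, y') \<in> M \<Longrightarrow> (x + y, x' + y') \<in> M"
  by (simp add: partial_embedding_def)

lemma partial_embedding_mult: "partial_embedding M \<Longrightarrow> (x, x') \<in> M \<Longrightarrow> (y, y') \<in> M \<Longrightarrow> (x * y, x' * y') \<in> M"
  by (simp add: partial_embedding_def)

lemma partial_embedding_0: "partial_embedding M \<Longrightarrow> (0, x') \<in> M \<Longrightarrow> x' = 0"
  by (simp add: partial_embedding_def)

lemma partial_embedding_diff: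
  assumes "partial_embedding M" "(x, x') \<in> M" "(y, y') \<in> M"
  shows "(x - y, x' - y') \<in> M"
proof -
  have "(to_ac (-1), to_ac (-1)) \<in> M" using assms by (intro partial_embedding_const)
  from partial_embedding_add[OF assms(1,2) partial_embedding_mult[OF assms(1) this assms(3)]]
  show ?thesis by (simp del: to_ac_numeral)
qed

lemma partial_embedding_functional:
  assumes "partial_embedding M" "(x, x') \<in> M" "(x, x'') \<in> M"
  shows "x' = x''"
proof -
  have "(0, x' - x'') \<in> M" using partial_embedding_diff[OF assms] by simp
  then have "x' - x'' = 0" by (rule partial_embedding_0[OF assms(1)])
  then show ?thesis by simp
qed

lemma partial_embedding_sum:
  assumes "partial_embedding M" "\<And>i. i \<in> I \<Longrightarrow> (f i, f' i) \<in> M"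
  shows "(sum f I, sum f' I) \<in> M"
  using assms(2)
proof (induction I rule: infinite_finite_induct)
  case (insert i I)
  have "(f i + sum f I, f' i + sum f' I) \<in> M"
    by (rule partial_embedding_add[OF assms(1)]) (simp_all add: insert.prems insert.IH)
  then show ?case using insert.hyps by simp
qed (use partial_embedding_const[OF assms(1), of 0] in auto)

lemma partial_embedding_power:
  assumes "partial_embedding M" "(x, x') \<in> M"
  shows "(x ^ n, x' ^ n) \<in> M"
  using partial_embedding_const[OF assms(1), of 1]
  by (induction n) (auto intro: partial_embedding_mult assms)

lemma partial_embedding_poly:
  assumes "partial_embedding M" "(x, x') \<in> M"
  shows "(poly (map_poly to_ac p) x, poly (map_poly to_ac p) x') \<in> M"
  unfolding poly_altdef
  by (intro partial_embedding_sum partial_embedding_mult partial_embedding_power assms)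
     (auto simp: coeff_map_poly intro: partial_embedding_const assms)

text \<open>The second polynomial is the image of the first one under the homomorphism with graph \<open>M\<close>, acting on
  coefficients.\<close>

definition related_polys ::
    "('k::field alg_closure \<times> 'k alg_closure) set \<Rightarrow> 'k alg_closure poly \<Rightarrow> 'k alg_closure poly \<Rightarrow> bool" where
  "related_polys M p p' \<longleftrightarrow> (\<forall>i. (Polynomial.coeff p i, Polynomial.coeff p' i) \<in> M)"

lemma minimal_annihilator:
  fixes x :: "'k::field alg_closure"
  obtains p :: "'k poly" where "p \<noteq> 0" "poly (map_poly to_ac p) x = 0"
    "\<And>q :: 'k poly. q \<noteq> 0 \<Longrightarrow> poly (map_poly to_ac q) x = 0 \<Longrightarrow> Polynomial.degree p \<le> Polynomial.degree q"
proof -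
  let ?P = "\<lambda>p :: 'k poly. p \<noteq> 0 \<and> poly (map_poly to_ac p) x = 0"
  obtain p0 where "?P p0" using alg_closure_algebraic[of x] by blast
  then have *: "?P (arg_min Polynomial.degree ?P) \<and> (\<forall>q. ?P q \<longrightarrow> Polynomial.degree (arg_min Polynomial.degree ?P) \<le> Polynomial.degree q)"
    by (rule arg_min_nat_lemma)
  define p where "p = arg_min Polynomial.degree ?P"
  from * have "?P p" "\<forall>q. ?P q \<longrightarrow> Polynomial.degree p \<le> Polynomial.degree q" unfolding p_def by blast+
  then show ?thesis using that[of p] by blast
qed

text \<open>A nonzero \<open>x\<close> is a root of a polynomial over the ground field with nonzero constant term \<open>c\<close>. If \<open>x\<close>
  were mapped to \<open>0\<close>, so would be \<open>-c\<close>.\<close>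

lemma partial_embedding_injective:
  assumes M: "partial_embedding M" and x: "(x, 0) \<in> M"
  shows "x = 0"
proof (rule ccontr)
  assume "x \<noteq> 0"
  obtain p where p: "p \<noteq> 0" "poly (map_poly to_ac p) x = 0"
    "\<And>q. q \<noteq> 0 \<Longrightarrow> poly (map_poly to_ac q) x = 0 \<Longrightarrow> Polynomial.degree p \<le> Polynomial.degree q"
    using minimal_annihilator[of x] by blast
  obtain c q where cq: "p = pCons c q" by (cases p)
  have "c \<noteq> 0"
  proof
    assume "c = 0"
    then have "q \<noteq> 0" "poly (map_poly to_ac q) x = 0"
      using p cq \<open>x \<noteq> 0\<close> by (auto simp: map_poly_pCons)
    then show False using p(3)[of q] cq by simp
  qed
  moreover have "(0, to_ac c) \<in> M"
    using partial_embedding_poly[OF M x, of p] p(2) cq by (simp add: map_poly_pCons)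
  ultimately show False using partial_embedding_0[OF M] by force
qed

lemma related_polys_add:
  "partial_embedding M \<Longrightarrow> related_polys M p p' \<Longrightarrow> related_polys M q q' \<Longrightarrow> related_polys M (p + q) (p' + q')"
  unfolding related_polys_def by (auto intro: partial_embedding_add)

lemma related_polys_mult:
  assumes "partial_embedding M" "related_polys M p p'" "related_polys M q q'"
  shows "related_polys M (p * q) (p' * q')"
  using assms unfolding related_polys_def coeff_mult
  by (auto intro!: partial_embedding_sum partial_embedding_mult)

lemma related_polys_diff:
  "partial_embedding M \<Longrightarrow> related_polys M p p' \<Longrightarrow> related_polys M q q' \<Longrightarrow> related_polys M (p - q) (p' - q')"
  unfolding related_polys_def by (auto intro: partial_embedding_diff)

lemma related_polys_monom:
  assumes "partial_embedding M" "(c, c') \<in> M"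
  shows "related_polys M (Polynomial.monom c n) (Polynomial.monom c' n)"
  using assms partial_embedding_const[OF assms(1), of 0] unfolding related_polys_def by auto

definition adjoin :: "('k::field alg_closure \<times> 'k alg_closure) set \<Rightarrow> 'k alg_closure \<Rightarrow> 'k alg_closure \<Rightarrow>
    ('k alg_closure \<times> 'k alg_closure) set" where
  "adjoin M y y' = {(poly p y, poly p' y') | p p'. related_polys M p p'}"

text \<open>The homomorphism extends by \<open>y \<mapsto> y'\<close> if \<open>y'\<close> is a root of the image of a polynomial of least degree
  annihilating \<open>y\<close>. The domain of \<open>M\<close> is only known to be a ring, so the division with remainder
  by \<open>m\<close> is replaced by a cancellation of leading terms.\<close>

lemma adjoin_embedding:
  assumes M: "partial_embedding M"
    and m: "related_polys M m m'" "m \<noteq> 0" "poly m y = 0" "poly m' y' = 0"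
    and min: "\<And>q q'. related_polys M q q' \<Longrightarrow> q \<noteq> 0 \<Longrightarrow> poly q y = 0 \<Longrightarrow> Polynomial.degree m \<le> Polynomial.degree q"
  shows "partial_embedding (adjoin M y y')" "M \<subseteq> adjoin M y y'" "(y, y') \<in> adjoin M y y'"
proof -
  show sub: "M \<subseteq> adjoin M y y'"
  proof clarify
    fix x x' assume "(x, x') \<in> M"
    from related_polys_monom[OF M this, of 0] show "(x, x') \<in> adjoin M y y'"
      unfolding adjoin_def by (force simp: poly_monom)
  qed
  have "(1, 1) \<in> M" using partial_embedding_const[OF M, of 1] by simp
  from related_polys_monom[OF M this, of 1] show "(y, y') \<in> adjoin M y y'"
    unfolding adjoin_def by (force simp: poly_monom)
  have van: "poly p' y' = 0" if "related_polys M p p'" "poly p y = 0" for p p'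
    using that
  proof (induction "Polynomial.degree p" arbitrary: p p' rule: less_induct)
    case less
    show ?case
    proof (cases "p = 0")
      case True
      then have "Polynomial.coeff p' i = 0" for i
        using less.prems partial_embedding_0[OF M] unfolding related_polys_def by auto
      then have "p' = 0" by (simp add: poly_eq_iff)
      then show ?thesis by simp
    next
      case False
      then have deg: "Polynomial.degree m \<le> Polynomial.degree p" using min less.prems by blast
      define k where "k = Polynomial.degree p - Polynomial.degree m"
      define lm lp where "lm = Polynomial.lead_coeff m" and "lp = Polynomial.lead_coeff p"
      define lm' lp' where "lm' = Polynomial.coeff m' (Polynomial.degree m)" and "lp' = Polynomial.coeff p' (Polynomial.degree p)"
      define r r' where "r = Polynomial.monom lm 0 * p - Polynomial.monom lp k * m" and "r' = Polynomial.monom lm' 0 * p' - Polynomial.monom lp' k * m'"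
      have l: "(lm, lm') \<in> M" "(lp, lp') \<in> M"
        using m less.prems unfolding related_polys_def lm_def lp_def lm'_def lp'_def by auto
      have rel: "related_polys M r r'"
        unfolding r_def r'_def
        by (intro related_polys_diff related_polys_mult related_polys_monom M l m(1) less.prems(1))
      have r0: "poly r y = 0" using m less.prems by (simp add: r_def)
      have "poly r' y' = 0"
      proof (cases "r = 0")
        case True
        then have "Polynomial.coeff r' i = 0" for i
          using rel partial_embedding_0[OF M] unfolding related_polys_def by auto
        then have "r' = 0" by (simp add: poly_eq_iff)
        then show ?thesis by simp
      next
        case False
        have "lm \<noteq> 0" using m(2) by (simp add: lm_def)
        have d1: "Polynomial.degree (Polynomial.monom lm 0 * p) = Polynomial.degree p"
          using \<open>lm \<noteq> 0\<close> \<open>p \<noteq> 0\<close> by (simp add: monom_0)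
        have "lp \<noteq> 0" using \<open>p \<noteq> 0\<close> by (simp add: lp_def)
        have d2: "Polynomial.degree (Polynomial.monom lp k * m) = Polynomial.degree p"
          using \<open>lp \<noteq> 0\<close> m(2) deg by (simp add: degree_mult_eq degree_monom_eq k_def)
        have "Polynomial.coeff r (Polynomial.degree p) = lm * lp - lp * lm"
          using deg unfolding r_def by (simp add: coeff_monom_mult k_def lm_def lp_def)
        then have "Polynomial.coeff r (Polynomial.degree p) = 0" by simp
        moreover have "Polynomial.degree r \<le> Polynomial.degree p"
          unfolding r_def using degree_diff_le[of "Polynomial.monom lm 0 * p" "Polynomial.degree p" "Polynomial.monom lp k * m"] d1 d2 by simp
        ultimately have "Polynomial.degree r < Polynomial.degree p"
          using False by (metis le_neq_implies_less leading_coeff_0_iff)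
        then show ?thesis using less.hyps[of r r'] rel r0 by blast
      qed
      then have "lm' * poly p' y' = 0" using m by (simp add: r'_def poly_monom)
      moreover have "lm' \<noteq> 0"
        using partial_embedding_injective[OF M, of lm] l(1) m(2) by (auto simp: lm_def)
      ultimately show ?thesis by simp
    qed
  qed
  show "partial_embedding (adjoin M y y')"
    unfolding partial_embedding_def
  proof (intro conjI allI impI)
    fix a show "(to_ac a, to_ac a) \<in> adjoin M y y'" using sub partial_embedding_const[OF M] by blast
  next
    fix u u' v v' assume "(u, u') \<in> adjoin M y y'" "(v, v') \<in> adjoin M y y'"
    then obtain p p' q q' where *: "related_polys M p p'" "related_polys M q q'"
      "u = poly p y" "u' = poly p' y'" "v = poly q y" "v' = poly q' y'" unfolding adjoin_def by blast
    have "u + v = poly (p + q) y" "u' + v' = poly (p' + q') y'"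
      "u * v = poly (p * q) y" "u' * v' = poly (p' * q') y'" using * by simp_all
    then show "(u + v, u' + v') \<in> adjoin M y y'" "(u * v, u' * v') \<in> adjoin M y y'"
      unfolding adjoin_def using related_polys_add[OF M *(1,2)] related_polys_mult[OF M *(1,2)] by blast+
  next
    fix v assume "(0, v) \<in> adjoin M y y'"
    then show "v = 0" unfolding adjoin_def using van by force
  qed
qed

text \<open>In a graph that is maximal by Zorn's lemma every \<open>y\<close> has an image, since the image of a polynomial of
  least degree annihilating \<open>y\<close> is not constant and has a root in the algebraic closure.\<close>

lemma total_extension_exists:
  fixes M0 :: "('k::field alg_closure \<times> 'k alg_closure) set"
  assumes "partial_embedding M0"
  obtains M where "partial_embedding M" "M0 \<subseteq> M" "\<And>x. \<exists>x'. (x, x') \<in> M"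
proof -
  define A where "A = {M. partial_embedding M \<and> M0 \<subseteq> M}"
  have "\<exists>M\<in>A. (\<forall>N\<in>A. M \<subseteq> N \<longrightarrow> N = M)"
  proof (rule subset_Zorn_nonempty)
    show "A \<noteq> {}" using assms by (auto simp: A_def)
    fix C assume C: "C \<noteq> {}" "subset.chain A C"
    have emb: "\<And>M. M \<in> C \<Longrightarrow> partial_embedding M \<and> M0 \<subseteq> M"
      using C(2) by (auto simp: subset_chain_def A_def)
    have two: "\<exists>M\<in>C. U \<subseteq> M \<and> W \<subseteq> M" if "U \<in> C" "W \<in> C" for U W
      proof -
      have "U \<subseteq> W \<or> W \<subseteq> U" using C(2) that unfolding subset_chain_def by blast
      then show ?thesis using that by blast
    qed
    have "partial_embedding (\<Union>C)"
      unfolding partial_embedding_def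
    proof (intro conjI allI impI)
      fix a show "(to_ac a, to_ac a) \<in> \<Union>C" using C(1) emb partial_embedding_const by blast
    next
      fix u u' v v' assume "(u, u') \<in> \<Union>C" "(v, v') \<in> \<Union>C"
      then obtain M where "M \<in> C" "(u, u') \<in> M" "(v, v') \<in> M" using two by blast
      then show "(u + v, u' + v') \<in> \<Union>C" "(u * v, u' * v') \<in> \<Union>C"
        using emb partial_embedding_add partial_embedding_mult by blast+
    next
      fix v assume "(0, v) \<in> \<Union>C" then show "v = 0" using emb partial_embedding_0 by blast
    qed
    then show "\<Union>C \<in> A" using C(1) emb by (auto simp: A_def)
  qed
  then obtain M where "M \<in> A" and max': "\<forall>N\<in>A. M \<subseteq> N \<longrightarrow> N = M" by (rule bexE)
  then have M: "partial_embedding M" "M0 \<subseteq> M" by (simp_all add: A_def)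
  have max: "N = M" if "partial_embedding N" "M \<subseteq> N" for N
  proof -
    have "N \<in> A" using that M(2) by (simp add: A_def)
    then show ?thesis using max' that(2) by simp
  qed
  have "\<exists>y'. (y, y') \<in> M" for y
  proof -
    let ?P = "\<lambda>q. q \<noteq> 0 \<and> poly q y = 0 \<and> (\<exists>q'. related_polys M q q')"
    obtain p where p: "p \<noteq> 0" "poly (map_poly to_ac p) y = 0" using alg_closure_algebraic[of y] by blast
    have "related_polys M (map_poly to_ac p) (map_poly to_ac p)"
      unfolding related_polys_def using partial_embedding_const[OF M(1)] by (simp add: coeff_map_poly)
    moreover have "map_poly to_ac p \<noteq> 0" using p(1) by (metis map_poly_eq_0_iff to_ac_0 to_ac_eq_0_iff)
    ultimately have "?P (map_poly to_ac p)" using p(2) by blast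
    then have *: "?P (arg_min Polynomial.degree ?P) \<and> (\<forall>q. ?P q \<longrightarrow> Polynomial.degree (arg_min Polynomial.degree ?P) \<le> Polynomial.degree q)"
      by (rule arg_min_nat_lemma)
    define m where "m = arg_min Polynomial.degree ?P"
    from * have m0: "m \<noteq> 0" "poly m y = 0" "\<exists>m'. related_polys M m m'"
      and min': "\<forall>q. ?P q \<longrightarrow> Polynomial.degree m \<le> Polynomial.degree q" unfolding m_def by blast+
    from m0(3) obtain m' where "related_polys M m m'" ..
    with m0 have m: "related_polys M m m'" "m \<noteq> 0" "poly m y = 0" by simp_all
    have min: "Polynomial.degree m \<le> Polynomial.degree q" if "related_polys M q q'" "q \<noteq> 0" "poly q y = 0" for q q'
      using min' that by blast
    have "0 < Polynomial.degree m"
    proof (rule ccontr)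
      assume "\<not> 0 < Polynomial.degree m"
      then obtain c where "m = [:c:]" by (metis degree_0_id neq0_conv)
      then show False using m(2,3) by simp
    qed
    moreover have "Polynomial.coeff m' (Polynomial.degree m) \<noteq> 0"
      using m partial_embedding_injective[OF M(1), of "Polynomial.lead_coeff m"] unfolding related_polys_def
      by (metis leading_coeff_0_iff)
    ultimately have "0 < Polynomial.degree m'" using le_degree[of m' "Polynomial.degree m"] by simp
    then obtain y' where "poly m' y' = 0" using alg_closed_imp_poly_has_root by blast
    note adj = adjoin_embedding[OF M(1) m this]
    have "partial_embedding (adjoin M y y')" by (rule adj(1)) (rule min)
    moreover have "M \<subseteq> adjoin M y y'" by (rule adj(2)) (rule min)
    moreover have "(y, y') \<in> adjoin M y y'" by (rule adj(3)) (rule min)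
    ultimately show ?thesis using max by auto
  qed
  then show ?thesis using that M by simp
qed

text \<open>Surjectivity holds because the homomorphism maps the finite set of roots of any polynomial over the
  ground field injectively into itself.\<close>

lemma total_embedding_is_automorphism:
  assumes M: "partial_embedding M" and total: "\<And>x. \<exists>x'. (x, x') \<in> M"
  obtains \<sigma> where "bij \<sigma>" "\<And>x y. \<sigma> (x + y) = \<sigma> x + \<sigma> y" "\<And>x y. \<sigma> (x * y) = \<sigma> x * \<sigma> y"
    "\<And>a. \<sigma> (to_ac a) = to_ac a" "\<And>x. (x, \<sigma> x) \<in> M"
proof -
  obtain \<sigma> where \<sigma>: "\<And>x. (x, \<sigma> x) \<in> M" using total by metis
  have eq: "\<sigma> x = x'" if "(x, x') \<in> M" for x x'
    using partial_embedding_functional[OF M \<sigma> that] .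
  have inj: "inj \<sigma>"
  proof (rule injI)
    fix x y assume "\<sigma> x = \<sigma> y"
    then show "x = y"
      using partial_embedding_injective[OF M, of "x - y"] partial_embedding_diff[OF M \<sigma>[of x] \<sigma>[of y]] by simp
  qed
  have ring: "\<sigma> (x + y) = \<sigma> x + \<sigma> y" "\<sigma> (x * y) = \<sigma> x * \<sigma> y" "\<sigma> (to_ac a) = to_ac a" for x y a
    by (auto intro!: eq partial_embedding_add partial_embedding_mult partial_embedding_const M \<sigma>)
  have "surj \<sigma>"
  proof -
    have "y \<in> range \<sigma>" for y
    proof -
      obtain p where p: "p \<noteq> 0" "poly (map_poly to_ac p) y = 0" using alg_closure_algebraic[of y] by blast
      let ?R = "{x. poly (map_poly to_ac p) x = 0}"
      have "map_poly to_ac p \<noteq> 0" using p(1) by (metis map_poly_eq_0_iff to_ac_0 to_ac_eq_0_iff)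
      then have fin: "finite ?R" by (rule poly_roots_finite)
      have "poly (map_poly to_ac p) (\<sigma> x) = 0" if "poly (map_poly to_ac p) x = 0" for x
        using partial_embedding_poly[OF M \<sigma>[of x], of p] that by (auto intro: partial_embedding_0[OF M])
      then have "\<sigma> ` ?R \<subseteq> ?R" by blast
      then have "\<sigma> ` ?R = ?R" using endo_inj_surj[OF fin] inj by (meson inj_on_subset subset_UNIV)
      then show ?thesis using p(2) by blast
    qed
    then show ?thesis by blast
  qed
  with inj have "bij \<sigma>" by (simp add: bij_def)
  from that[OF this ring \<sigma>] show ?thesis .
qed

text \<open>As \<open>p\<close> has a nonzero derivative, which does not vanish at \<open>x\<close> by minimality of \<open>p\<close>, there is a root
  \<open>x' \<noteq> x\<close>. The embedding with \<open>x \<mapsto> x'\<close> extends to the algebraic closure.\<close>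

lemma automorphism_moving:
  fixes x :: "'k::field alg_closure"
  assumes p: "p \<noteq> 0" "poly (map_poly to_ac p) x = 0"
    and min: "\<And>q :: 'k poly. q \<noteq> 0 \<Longrightarrow> poly (map_poly to_ac q) x = 0 \<Longrightarrow> Polynomial.degree p \<le> Polynomial.degree q"
    and sep: "pderiv p \<noteq> 0" and x: "x \<notin> range to_ac"
  obtains \<sigma> where "bij \<sigma>" "\<And>x y. \<sigma> (x + y) = \<sigma> x + \<sigma> y" "\<And>x y. \<sigma> (x * y) = \<sigma> x * \<sigma> y"
    "\<And>a. \<sigma> (to_ac a) = to_ac a" "\<sigma> x \<noteq> x"
proof -
  define P where "P = map_poly to_ac p"
  have Pp: "Polynomial.coeff P i = to_ac (Polynomial.coeff p i)" for i by (simp add: P_def coeff_map_poly)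
  have "P \<noteq> 0" using p(1) Pp by (metis leading_coeff_0_iff coeff_0 to_ac_eq_0_iff)
  have "poly P x = 0" using p(2) by (simp add: P_def)
  then obtain Q where Q: "P = [:-x, 1:] * Q" by (metis poly_eq_0_iff_dvd dvdE)
  have "Q \<noteq> 0" using \<open>P \<noteq> 0\<close> Q by auto
  have "Polynomial.degree Q \<noteq> 0"
  proof
    assume "Polynomial.degree Q = 0"
    then obtain c where c: "Q = [:c:]" by (metis degree_0_id)
    then have P: "P = [:-x * c, c:]" using Q by simp
    then have *: "to_ac (Polynomial.coeff p 0) = -x * c" "to_ac (Polynomial.coeff p 1) = c" using Pp[of 0] Pp[of 1] by simp_all
    have "c \<noteq> 0" using \<open>Q \<noteq> 0\<close> c by simp
    then have "x = to_ac (- (Polynomial.coeff p 0 / Polynomial.coeff p 1))" using * by simp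
    then show False using x by blast
  qed
  then obtain x' where x': "poly Q x' = 0" using alg_closed_imp_poly_has_root[of Q] by blast
  have dmap: "pderiv P = map_poly to_ac (pderiv p)"
    by (rule poly_eqI) (simp add: coeff_pderiv Pp coeff_map_poly del: of_nat_Suc flip: to_ac_of_nat)
  have "x' \<noteq> x"
  proof
    assume "x' = x"
    then have "poly (pderiv P) x = 0" using x' unfolding Q pderiv_mult by (simp del: mult_pCons_left add: pderiv_pCons)
    then have "Polynomial.degree p \<le> Polynomial.degree (pderiv p)" using min sep dmap by simp
    moreover have "Polynomial.degree p \<noteq> 0"
    proof
      assume "Polynomial.degree p = 0"
      then obtain c where "p = [:c:]" by (metis degree_0_id)
      then show False using sep by (simp add: pderiv_pCons)
    qed
    moreover have "Polynomial.degree (pderiv p) \<le> Polynomial.degree p - 1"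
      by (rule degree_le) (auto simp: coeff_pderiv coeff_eq_0)
    ultimately show False by simp
  qed
  define M0 where "M0 = range (\<lambda>a :: 'k. (to_ac a, to_ac a))"
  have M0: "partial_embedding M0"
    unfolding partial_embedding_def M0_def by (auto simp flip: to_ac_add to_ac_mult)
  have rel: "related_polys M0 P P" unfolding related_polys_def M0_def Pp by blast
  have Px': "poly P x' = 0" using x' Q by simp
  have min': "Polynomial.degree P \<le> Polynomial.degree q" if "related_polys M0 q q'" "q \<noteq> 0" "poly q x = 0" for q q'
  proof -
    define r where "r = map_poly of_ac q"
    have "Polynomial.coeff q i = to_ac (of_ac (Polynomial.coeff q i))" for i
      using that(1) unfolding related_polys_def M0_def by (metis (no_types, lifting) Pair_inject imageE of_ac_to_ac)
    then have q: "q = map_poly to_ac r"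
      by (intro poly_eqI) (simp add: coeff_map_poly r_def)
    then have "r \<noteq> 0" using that(2) by auto
    then have "Polynomial.degree p \<le> Polynomial.degree r" by (rule min) (use q that(3) in simp)
    moreover have "Polynomial.degree r \<le> Polynomial.degree q" unfolding r_def by (rule degree_le) (simp add: coeff_map_poly coeff_eq_0)
    moreover have "Polynomial.degree P \<le> Polynomial.degree p" by (rule degree_le) (simp add: Pp coeff_eq_0)
    ultimately show ?thesis by simp
  qed
  have adj: "partial_embedding (adjoin M0 x x')" "(x, x') \<in> adjoin M0 x x'"
    using adjoin_embedding[OF M0 rel \<open>P \<noteq> 0\<close> \<open>poly P x = 0\<close> Px'] min' by blast+
  obtain M where M: "partial_embedding M" "adjoin M0 x x' \<subseteq> M" "\<And>z. \<exists>z'. (z, z') \<in> M"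
    using total_extension_exists[OF adj(1)] by blast
  obtain \<sigma> where \<sigma>: "bij \<sigma>" "\<And>x y. \<sigma> (x + y) = \<sigma> x + \<sigma> y" "\<And>x y. \<sigma> (x * y) = \<sigma> x * \<sigma> y"
    "\<And>a. \<sigma> (to_ac a) = to_ac a" "\<And>x. (x, \<sigma> x) \<in> M"
    using total_embedding_is_automorphism[OF M(1,3)] by blast
  have "\<sigma> x = x'" using partial_embedding_functional[OF M(1) \<sigma>(5)] adj(2) M(2) by blast
  then show ?thesis using that \<sigma> \<open>x' \<noteq> x\<close> by blast
qed

section \<open>The absolute Galois group of a perfect field\<close>

lemma poly_to_ac_mult:
  "poly (map_poly to_ac (p * q)) x = poly (map_poly to_ac p) x * poly (map_poly to_ac q) x"
proof -
  have "map_poly to_ac (p * q) = map_poly to_ac p * map_poly to_ac q"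
    by (rule poly_eqI) (simp add: coeff_map_poly Polynomial.coeff_mult to_ac_sum)
  then show ?thesis by simp
qed

lemma minimal_annihilator_irreducible:
  fixes p :: "'k::field poly"
  assumes p: "p \<noteq> 0" "poly (map_poly to_ac p) x = 0"
    and min: "\<And>q :: 'k poly. q \<noteq> 0 \<Longrightarrow> poly (map_poly to_ac q) x = 0 \<Longrightarrow> Polynomial.degree p \<le> Polynomial.degree q"
  shows "Factorial_Ring.irreducible p"
proof (rule Factorial_Ring.irreducibleI)
  show "p \<noteq> 0" by fact
  show "\<not> p dvd 1"
  proof
    assume "p dvd 1"
    then obtain c where "p = [:c:]" "c dvd 1" by (rule is_unit_polyE)
    then show False using p by (simp add: map_poly_pCons)
  qed
  fix a b assume ab: "p = a * b"
  then have nz: "a \<noteq> 0" "b \<noteq> 0" using p(1) by auto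
  have deg: "Polynomial.degree p = Polynomial.degree a + Polynomial.degree b"
    unfolding ab by (rule Polynomial.degree_mult_eq[OF nz])
  have "poly (map_poly to_ac a) x * poly (map_poly to_ac b) x = 0"
    using p(2) unfolding ab poly_to_ac_mult .
  then consider "poly (map_poly to_ac a) x = 0" | "poly (map_poly to_ac b) x = 0" by auto
  then show "a dvd 1 \<or> b dvd 1"
  proof cases
    case 1
    then have "Polynomial.degree b = 0" using min[OF nz(1)] deg by simp
    then show ?thesis using nz(2) is_unit_iff_degree by blast
  next
    case 2
    then have "Polynomial.degree a = 0" using min[OF nz(2)] deg by simp
    then show ?thesis using nz(1) is_unit_iff_degree by blast
  qed
qed

text \<open>Over a perfect field the separable closure is the whole algebraic closure; these are then the
  elements of the absolute Galois group.\<close>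

definition galois_automorphism :: "('k::field alg_closure \<Rightarrow> 'k alg_closure) \<Rightarrow> bool" where
  "galois_automorphism \<sigma> \<longleftrightarrow> bij \<sigma> \<and> (\<forall>x y. \<sigma> (x + y) = \<sigma> x + \<sigma> y \<and> \<sigma> (x * y) = \<sigma> x * \<sigma> y) \<and>
     (\<forall>a. \<sigma> (to_ac a) = to_ac a)"

lemma galois_add: "galois_automorphism \<sigma> \<Longrightarrow> \<sigma> (x + y) = \<sigma> x + \<sigma> y"
  and galois_mult: "galois_automorphism \<sigma> \<Longrightarrow> \<sigma> (x * y) = \<sigma> x * \<sigma> y"
  and galois_const: "galois_automorphism \<sigma> \<Longrightarrow> \<sigma> (to_ac a) = to_ac a"
  and galois_bij: "galois_automorphism \<sigma> \<Longrightarrow> bij \<sigma>"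
  unfolding galois_automorphism_def by blast+

lemma galois_inj: "galois_automorphism \<sigma> \<Longrightarrow> \<sigma> x = \<sigma> y \<longleftrightarrow> x = y"
  using galois_bij bij_is_inj inj_eq by metis

lemma galois_0: "galois_automorphism \<sigma> \<Longrightarrow> \<sigma> 0 = 0"
  using galois_const[of \<sigma> 0] by simp

lemma galois_1: "galois_automorphism \<sigma> \<Longrightarrow> \<sigma> 1 = 1"
  using galois_const[of \<sigma> 1] by simp

lemma galois_minus: "galois_automorphism \<sigma> \<Longrightarrow> \<sigma> (- x) = - \<sigma> x"
  using galois_add[of \<sigma> x "-x"] galois_0[of \<sigma>] by (simp add: minus_unique)

lemma galois_diff: "galois_automorphism \<sigma> \<Longrightarrow> \<sigma> (x - y) = \<sigma> x - \<sigma> y"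
  using galois_add[of \<sigma> x "-y"] galois_minus[of \<sigma> y] by simp

lemma galois_divide: "galois_automorphism \<sigma> \<Longrightarrow> \<sigma> (x / y) = \<sigma> x / \<sigma> y"
proof (cases "y = 0")
  case False
  assume \<sigma>: "galois_automorphism \<sigma>"
  have "\<sigma> y \<noteq> 0" using False galois_inj[OF \<sigma>, of y 0] galois_0[OF \<sigma>] by simp
  moreover have "\<sigma> (x / y) * \<sigma> y = \<sigma> x" using False galois_mult[OF \<sigma>, of "x / y" y] by simp
  ultimately show ?thesis by (simp add: eq_divide_eq)
qed (simp add: galois_0)

lemma galois_sum: "galois_automorphism \<sigma> \<Longrightarrow> \<sigma> (sum f I) = (\<Sum>i\<in>I. \<sigma> (f i))"
  by (induction I rule: infinite_finite_induct) (simp_all add: galois_0 galois_add)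

lemma galois_poly: "galois_automorphism \<sigma> \<Longrightarrow> poly (map_poly to_ac p) (\<sigma> x) = \<sigma> (poly (map_poly to_ac p) x)"
  by (induction p) (simp_all add: map_poly_pCons galois_0 galois_add galois_mult galois_const)

lemma galois_id: "galois_automorphism id"
  by (simp add: galois_automorphism_def)

lemma galois_comp: "galois_automorphism \<sigma> \<Longrightarrow> galois_automorphism \<tau> \<Longrightarrow> galois_automorphism (\<sigma> \<circ> \<tau>)"
  by (simp add: galois_automorphism_def bij_comp)

lemma galois_inv_apply:
  "galois_automorphism \<sigma> \<Longrightarrow> \<sigma> (inv_into UNIV \<sigma> x) = x" "galois_automorphism \<sigma> \<Longrightarrow> inv_into UNIV \<sigma> (\<sigma> x) = x"
  using galois_bij by (metis bij_inv_eq_iff)+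

lemma galois_inv:
  assumes \<sigma>: "galois_automorphism \<sigma>"
  shows "galois_automorphism (inv_into UNIV \<sigma>)"
proof -
  have "inv_into UNIV \<sigma> (x + y) = inv_into UNIV \<sigma> x + inv_into UNIV \<sigma> y" for x y
    using galois_inj[OF \<sigma>, of "inv_into UNIV \<sigma> (x + y)" "inv_into UNIV \<sigma> x + inv_into UNIV \<sigma> y"]
    by (simp add: galois_inv_apply[OF \<sigma>] galois_add[OF \<sigma>])
  moreover have "inv_into UNIV \<sigma> (x * y) = inv_into UNIV \<sigma> x * inv_into UNIV \<sigma> y" for x y
    using galois_inj[OF \<sigma>, of "inv_into UNIV \<sigma> (x * y)" "inv_into UNIV \<sigma> x * inv_into UNIV \<sigma> y"]
    by (simp add: galois_inv_apply[OF \<sigma>] galois_mult[OF \<sigma>])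
  moreover have "inv_into UNIV \<sigma> (to_ac a) = to_ac a" for a
    using galois_inv_apply(2)[OF \<sigma>, of "to_ac a"] galois_const[OF \<sigma>, of a] by simp
  ultimately show ?thesis using galois_bij[OF \<sigma>] by (simp add: galois_automorphism_def bij_imp_bij_inv)
qed

lemma pderiv_irreducible_perfect:
  fixes p :: "'k::field poly"
  assumes "perfect_field TYPE('k)" "Factorial_Ring.irreducible p"
  shows "pderiv p \<noteq> 0"
proof
  assume "pderiv p = 0"
  then have "coprime p 0" using assms unfolding perfect_field_def separable_poly_def by metis
  then have "p dvd 1" by simp
  then show False using assms(2) by (simp add: Factorial_Ring.irreducible_def)
qed

lemma separable_closure_perfect:
  assumes "perfect_field TYPE('k::field)"
  shows "(separable_closure :: 'k alg_closure set) = UNIV"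
proof -
  have "x \<in> separable_closure" for x :: "'k alg_closure"
  proof -
    obtain p :: "'k poly" where p: "p \<noteq> 0" "poly (map_poly to_ac p) x = 0"
      and min: "\<And>q :: 'k poly. q \<noteq> 0 \<Longrightarrow> poly (map_poly to_ac q) x = 0 \<Longrightarrow> Polynomial.degree p \<le> Polynomial.degree q"
      using minimal_annihilator[of x] by blast
    have "Factorial_Ring.irreducible p" using minimal_annihilator_irreducible[OF p min] .
    moreover from this have "separable_poly p" using assms unfolding perfect_field_def by blast
    ultimately show ?thesis unfolding separable_closure_def using p(2) by blast
  qed
  then show ?thesis by blast
qed

text \<open>This is the part of infinite Galois theory that is needed: the fixed field is the ground field.\<close>

lemma galois_moves:
  fixes x :: "'k::field alg_closure"
  assumes "perfect_field TYPE('k)" "x \<notin> range to_ac"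
  obtains \<sigma> where "galois_automorphism \<sigma>" "\<sigma> x \<noteq> x"
proof -
  obtain p :: "'k poly" where p: "p \<noteq> 0" "poly (map_poly to_ac p) x = 0"
    and min: "\<And>q :: 'k poly. q \<noteq> 0 \<Longrightarrow> poly (map_poly to_ac q) x = 0 \<Longrightarrow> Polynomial.degree p \<le> Polynomial.degree q"
    using minimal_annihilator[of x] by blast
  have "pderiv p \<noteq> 0"
    using pderiv_irreducible_perfect[OF assms(1) minimal_annihilator_irreducible[OF p min]] .
  from automorphism_moving[OF p min this assms(2)] obtain \<sigma> where "bij \<sigma>"
    "\<And>x y. \<sigma> (x + y) = \<sigma> x + \<sigma> y" "\<And>x y. \<sigma> (x * y) = \<sigma> x * \<sigma> y" "\<And>a. \<sigma> (to_ac a) = to_ac a" "\<sigma> x \<noteq> x"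
    by metis
  then show ?thesis by (intro that[of \<sigma>]) (simp_all add: galois_automorphism_def)
qed

lemma finite_conjugates:
  fixes x :: "'k::field alg_closure"
  shows "finite {\<sigma> x | \<sigma>. galois_automorphism \<sigma>}"
proof -
  obtain p :: "'k poly" where p: "p \<noteq> 0" "poly (map_poly to_ac p) x = 0" using alg_closure_algebraic[of x] by blast
  have "map_poly to_ac p \<noteq> 0" using p(1) by (metis map_poly_eq_0_iff to_ac_0 to_ac_eq_0_iff)
  then have "finite {y. poly (map_poly to_ac p) y = 0}" by (rule poly_roots_finite)
  moreover have "{\<sigma> x | \<sigma>. galois_automorphism \<sigma>} \<subseteq> {y. poly (map_poly to_ac p) y = 0}"
    using p(2) by (auto simp: galois_poly galois_0)
  ultimately show ?thesis by (rule finite_subset[rotated])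
qed

text \<open>Dedekind's lemma on the independence of characters, for functions that are multiplicative and
  distinct on \<open>L\<close> only. Comparing the relation at \<open>m x y\<close> with the multiple by \<open>r0 y\<close> of the relation
  at \<open>x\<close> eliminates the character \<open>r0\<close>.\<close>

lemma dedekind_independence:
  fixes c :: "('a \<Rightarrow> 'f::field) \<Rightarrow> 'f"
  assumes "finite R"
    and one: "e \<in> L" "\<And>r. r \<in> R \<Longrightarrow> r e = 1"
    and mult: "\<And>x y. x \<in> L \<Longrightarrow> y \<in> L \<Longrightarrow> m x y \<in> L"
      "\<And>r x y. r \<in> R \<Longrightarrow> x \<in> L \<Longrightarrow> y \<in> L \<Longrightarrow> r (m x y) = r x * r y"
    and distinct: "\<And>r s. r \<in> R \<Longrightarrow> s \<in> R \<Longrightarrow> r \<noteq> s \<Longrightarrow> \<exists>x\<in>L. r x \<noteq> s x"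
    and sum0: "\<And>x. x \<in> L \<Longrightarrow> (\<Sum>r\<in>R. c r * r x) = 0"
  shows "\<forall>r\<in>R. c r = 0"
  using assms(1) one(2) mult(2) distinct sum0
proof (induction R arbitrary: c rule: finite_induct)
  case (insert r0 R)
  have zero: "c r = 0" if r: "r \<in> R" for r
  proof -
    obtain y where y: "y \<in> L" "r y \<noteq> r0 y" using insert.prems(3)[of r r0] r insert.hyps(2) by auto
    have "\<forall>r\<in>R. c r * (r y - r0 y) = 0"
    proof (rule insert.IH)
      fix x assume x: "x \<in> L"
      have "(\<Sum>r\<in>insert r0 R. c r * r (m x y)) = 0" by (rule insert.prems(4)[OF mult(1)[OF x y(1)]])
      also have "(\<Sum>r\<in>insert r0 R. c r * r (m x y)) = (\<Sum>r\<in>insert r0 R. c r * (r x * r y))"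
        using insert.prems(2) x y(1) by (intro sum.cong) simp_all
      finally have 1: "(\<Sum>r\<in>insert r0 R. c r * (r x * r y)) = 0" .
      have "(\<Sum>r\<in>insert r0 R. c r * r x) * r0 y = 0" using insert.prems(4)[OF x] by simp
      then have 2: "(\<Sum>r\<in>insert r0 R. c r * r x * r0 y) = 0" by (simp only: sum_distrib_right)
      have "(\<Sum>r\<in>insert r0 R. c r * (r y - r0 y) * r x) = 0"
        using 1 2 unfolding right_diff_distrib left_diff_distrib sum_subtractf by (simp only: ac_simps diff_0_right)
      then show "(\<Sum>r\<in>R. c r * (r y - r0 y) * r x) = 0" using insert.hyps by simp
    qed (use insert.prems in auto)
    then show ?thesis using r y(2) by auto
  qed
  moreover have "c r0 = 0"
    using insert.prems(4)[OF one(1)] insert.prems(1)[of r0] zero insert.hyps by simp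
  ultimately show ?case by simp
qed simp

section \<open>Norms from a quadratic extension\<close>

text \<open>For a square root \<open>\<alpha>\<close> of an element of the ground field, \<open>moves \<alpha>\<close> is the quadratic character of the
  Galois group that belongs to \<open>\<alpha>\<close>, with truth values for the elements of the group of order \<open>2\<close>.\<close>

definition moves :: "'a \<Rightarrow> ('a \<Rightarrow> 'a) \<Rightarrow> bool" where
  "moves x \<sigma> \<longleftrightarrow> \<sigma> x \<noteq> x"

lemma galois_square_root:
  assumes "galois_automorphism \<sigma>" "\<alpha> * \<alpha> = to_ac a"
  shows "\<sigma> \<alpha> = (if moves \<alpha> \<sigma> then - \<alpha> else \<alpha>)"
proof -
  have "\<sigma> \<alpha> * \<sigma> \<alpha> = \<alpha> * \<alpha>"
    using assms galois_mult[OF assms(1), of \<alpha> \<alpha>] galois_const[OF assms(1)] by simp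
  then show ?thesis by (auto simp: moves_def square_eq_iff)
qed

lemma moves_comp:
  assumes "galois_automorphism \<sigma>" "galois_automorphism \<tau>" "\<alpha> * \<alpha> = to_ac a"
  shows "moves \<alpha> (\<sigma> \<circ> \<tau>) \<longleftrightarrow> (moves \<alpha> \<sigma> \<noteq> moves \<alpha> \<tau>)"
proof -
  have "\<sigma> (\<tau> \<alpha>) = (if moves \<alpha> \<sigma> \<noteq> moves \<alpha> \<tau> then - \<alpha> else \<alpha>)"
    using galois_square_root[OF assms(1,3)] galois_square_root[OF assms(2,3)] galois_minus[OF assms(1), of \<alpha>]
    by (cases "moves \<alpha> \<sigma>"; cases "moves \<alpha> \<tau>") simp_all
  moreover have "- \<alpha> \<noteq> \<alpha>" if "moves \<alpha> \<sigma> \<or> moves \<alpha> \<tau>"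
    using that galois_square_root[OF assms(1,3)] galois_square_root[OF assms(2,3)] unfolding moves_def by metis
  ultimately show ?thesis unfolding moves_def[of \<alpha> "\<sigma> \<circ> \<tau>"] by auto
qed

text \<open>The function \<open>f\<close> is an inhomogeneous \<open>1\<close>-cochain with values in the group of order \<open>2\<close> whose coboundary
  is the cup product of the characters of \<open>\<beta>\<close> and \<open>\<alpha>\<close>. That it vanishes on the pointwise
  stabiliser of a finite set expresses its continuity.\<close>

locale cup_product_splitting =
  fixes a b :: "'k::field" and \<alpha> \<beta> :: "'k alg_closure" and f :: "('k alg_closure \<Rightarrow> 'k alg_closure) \<Rightarrow> bool"
    and S :: "'k alg_closure set"
  assumes perfect: "perfect_field TYPE('k)" 
    and \<alpha>: "\<alpha> * \<alpha> = to_ac a" and \<beta>: "\<beta> * \<beta> = to_ac b" and nonsquare: "\<alpha> \<notin> range to_ac"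
    and finite_S: "finite S" and \<alpha>_S: "\<alpha> \<in> S"
    and splitting: "\<And>\<sigma> \<tau>. galois_automorphism \<sigma> \<Longrightarrow> galois_automorphism \<tau> \<Longrightarrow>
      f (\<sigma> \<circ> \<tau>) \<longleftrightarrow> ((f \<sigma> \<noteq> f \<tau>) \<noteq> (moves \<beta> \<sigma> \<and> moves \<alpha> \<tau>))"
    and locally_trivial: "\<And>\<sigma>. galois_automorphism \<sigma> \<Longrightarrow> (\<forall>s\<in>S. \<sigma> s = s) \<Longrightarrow> \<not> f \<sigma>"
begin

abbreviation "Gal \<equiv> {\<sigma> :: 'k alg_closure \<Rightarrow> 'k alg_closure. galois_automorphism \<sigma>}"

text \<open>The Galois group over the quadratic extension generated by \<open>\<alpha>\<close>. On it the cup product vanishes and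
  \<open>sign\<close> is a character.\<close>

definition "N = {\<sigma> \<in> Gal. \<not> moves \<alpha> \<sigma>}"

definition sign :: "('k alg_closure \<Rightarrow> 'k alg_closure) \<Rightarrow> 'k alg_closure" where
  "sign \<sigma> = (if f \<sigma> then -1 else 1)"

lemma f_cong:
  assumes "galois_automorphism \<sigma>" "galois_automorphism \<tau>" "\<forall>s\<in>S. \<sigma> s = \<tau> s"
  shows "f \<sigma> = f \<tau>"
proof -
  let ?u = "inv_into UNIV \<tau> \<circ> \<sigma>"
  have u: "galois_automorphism ?u" using assms by (intro galois_comp galois_inv)
  have fix_S: "\<forall>s\<in>S. ?u s = s" using assms by (simp add: galois_inv_apply)
  have "\<tau> \<circ> ?u = \<sigma>" using assms by (auto simp: galois_inv_apply)
  moreover have "\<not> moves \<alpha> ?u" using fix_S \<alpha>_S by (simp add: moves_def)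
  ultimately show ?thesis using splitting[OF assms(2) u] locally_trivial[OF u fix_S] by simp
qed

text \<open>Up to their restrictions to \<open>S\<close> there are only finitely many elements of \<open>N\<close>. The representatives
  replace a finite quotient of \<open>N\<close>, so that sums over it can be formed.\<close>

definition representative :: "('k alg_closure \<Rightarrow> 'k alg_closure) \<Rightarrow> 'k alg_closure \<Rightarrow> 'k alg_closure" where
  "representative \<sigma> = inv_into N (\<lambda>\<tau>. restrict \<tau> S) (restrict \<sigma> S)"

lemma representative: "\<sigma> \<in> N \<Longrightarrow> representative \<sigma> \<in> N"
  "\<sigma> \<in> N \<Longrightarrow> s \<in> S \<Longrightarrow> representative \<sigma> s = \<sigma> s"
proof -
  assume \<sigma>: "\<sigma> \<in> N"
  then have im: "restrict \<sigma> S \<in> (\<lambda>\<tau>. restrict \<tau> S) ` N" by blast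
  then show "representative \<sigma> \<in> N" unfolding representative_def by (rule inv_into_into)
  assume s: "s \<in> S"
  have "restrict (representative \<sigma>) S = restrict \<sigma> S"
    unfolding representative_def using f_inv_into_f[OF im] .
  then have "restrict (representative \<sigma>) S s = restrict \<sigma> S s" by simp
  then show "representative \<sigma> s = \<sigma> s" using s by simp
qed

lemma representative_cong: "\<forall>s\<in>S. \<sigma> s = \<tau> s \<Longrightarrow> representative \<sigma> = representative \<tau>"
  unfolding representative_def by (metis restrict_ext)

definition "R = representative ` N"

lemma R_N: "R \<subseteq> N" using representative(1) by (auto simp: R_def)

lemma finite_R: "finite R"
proof -
  have "(\<lambda>\<tau>. restrict \<tau> S) ` N \<subseteq> PiE S (\<lambda>s. {\<sigma> s | \<sigma>. galois_automorphism \<sigma>})"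
    by (auto simp: N_def)
  moreover have "finite (PiE S (\<lambda>s. {\<sigma> s | \<sigma>. galois_automorphism \<sigma>}))"
    by (intro finite_PiE finite_S finite_conjugates)
  ultimately have "finite ((\<lambda>\<tau>. restrict \<tau> S) ` N)" by (rule finite_subset)
  then have "finite (inv_into N (\<lambda>\<tau>. restrict \<tau> S) ` (\<lambda>\<tau>. restrict \<tau> S) ` N)" by (rule finite_imageI)
  then show ?thesis by (simp add: R_def image_image representative_def)
qed

lemma R_eqI:
  assumes "r \<in> R" "r' \<in> R" "\<forall>s\<in>S. r s = r' s" shows "r = r'"
proof -
  obtain \<sigma> \<sigma>' where \<sigma>: "\<sigma> \<in> N" "\<sigma>' \<in> N" "r = representative \<sigma>" "r' = representative \<sigma>'"
    using assms(1,2) unfolding R_def by blast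
  have "\<forall>s\<in>S. \<sigma> s = \<sigma>' s" using assms(3) \<sigma> representative(2) by simp
  then show ?thesis using \<sigma> representative_cong by simp
qed

text \<open>The intermediate field generated by \<open>S\<close>, given by the automorphisms that fix it.\<close>

definition "L = {c. \<forall>\<sigma>\<in>Gal. (\<forall>s\<in>S. \<sigma> s = s) \<longrightarrow> \<sigma> c = c}"

lemma L_cong:
  assumes "galois_automorphism \<sigma>" "galois_automorphism \<tau>" "\<forall>s\<in>S. \<sigma> s = \<tau> s" "c \<in> L"
  shows "\<sigma> c = \<tau> c"
proof -
  let ?u = "inv_into UNIV \<tau> \<circ> \<sigma>"
  have u: "galois_automorphism ?u" using assms by (intro galois_comp galois_inv)
  have "\<forall>s\<in>S. ?u s = s" using assms by (simp add: galois_inv_apply)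
  then have "?u c = c" using u assms(4) unfolding L_def by blast
  then have "\<tau> (?u c) = \<tau> c" by simp
  then show ?thesis using assms(2) by (simp add: galois_inv_apply)
qed

lemma N_comp: "\<sigma> \<in> N \<Longrightarrow> \<tau> \<in> N \<Longrightarrow> \<sigma> \<circ> \<tau> \<in> N"
  using moves_comp[OF _ _ \<alpha>] galois_comp by (auto simp: N_def)

lemma sign_comp:
  assumes "\<sigma> \<in> Gal" "\<tau> \<in> N" shows "sign (\<sigma> \<circ> \<tau>) = sign \<sigma> * sign \<tau>"
  using assms splitting[of \<sigma> \<tau>] by (auto simp: sign_def N_def)

lemma sign_square: "sign \<sigma> * sign \<sigma> = 1" by (simp add: sign_def)

lemma galois_sign: "galois_automorphism \<sigma> \<Longrightarrow> \<sigma> (sign \<tau>) = sign \<tau>"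
  by (simp add: sign_def galois_1 galois_minus)

text \<open>Hilbert 90 for the character \<open>sign\<close> of \<open>N\<close>: the average of \<open>sign \<tau> * \<tau> c\<close> over the finite
  quotient of \<open>N\<close> has the required behaviour, and by the independence of characters it is nonzero
  for some \<open>c\<close>.\<close>

lemma kummer_element:
  obtains z where "z \<noteq> 0" "\<And>\<rho>. \<rho> \<in> N \<Longrightarrow> \<rho> z = sign \<rho> * z"
proof -
  define Z where "Z = (\<lambda>c. \<Sum>r\<in>R. sign r * r c)"
  have idN: "id \<in> N" by (simp add: N_def galois_id moves_def)
  have gR: "galois_automorphism r" if "r \<in> R" for r using that R_N by (auto simp: N_def)
  have "\<exists>c\<in>L. Z c \<noteq> 0"
  proof (rule ccontr)
    assume "\<not> ?thesis"
    then have Z0: "\<And>c. c \<in> L \<Longrightarrow> (\<Sum>r\<in>R. sign r * r c) = 0" by (auto simp: Z_def)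
    have "\<forall>r\<in>R. sign r = 0"
    proof (rule dedekind_independence[OF finite_R, of 1 L "(*)"])
      show "1 \<in> L" by (simp add: L_def galois_1)
      show "r 1 = 1" if "r \<in> R" for r using gR[OF that] by (rule galois_1)
      show "x * y \<in> L" if "x \<in> L" "y \<in> L" for x y
        using that unfolding L_def by (simp add: galois_mult) metis
      show "r (x * y) = r x * r y" if "r \<in> R" for r x y using gR[OF that] by (rule galois_mult)
      show "\<exists>x\<in>L. r x \<noteq> s x" if rs: "r \<in> R" "s \<in> R" "r \<noteq> s" for r s
      proof -
        obtain x where "x \<in> S" "r x \<noteq> s x" using R_eqI[OF rs(1,2)] rs(3) by blast
        moreover have "S \<subseteq> L" by (auto simp: L_def)
        ultimately show ?thesis by blast
      qed
    qed (rule Z0)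
    moreover have "representative id \<in> R" using idN by (simp add: R_def)
    ultimately show False by (auto simp: sign_def split: if_splits)
  qed
  then obtain c where c: "c \<in> L" "Z c \<noteq> 0" by blast
  have "\<rho> (Z c) = sign \<rho> * Z c" if \<rho>: "\<rho> \<in> N" for \<rho>
  proof -
    have g\<rho>: "galois_automorphism \<rho>" using \<rho> by (simp add: N_def)
    define \<pi> where "\<pi> = (\<lambda>r. representative (\<rho> \<circ> r))"
    have \<rho>r: "\<rho> \<circ> r \<in> N" if "r \<in> R" for r using N_comp \<rho> R_N that by blast
    have \<pi>R: "\<pi> r \<in> R" if "r \<in> R" for r using \<rho>r[OF that] by (simp add: \<pi>_def R_def)
    have \<pi>_agree: "\<forall>s\<in>S. \<pi> r s = (\<rho> \<circ> r) s" if "r \<in> R" for r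
      using representative(2)[OF \<rho>r[OF that]] by (simp add: \<pi>_def)
    have "inj_on \<pi> R"
    proof (rule inj_onI)
      fix r r' assume r: "r \<in> R" "r' \<in> R" "\<pi> r = \<pi> r'"
      have "\<forall>s\<in>S. \<rho> (r s) = \<rho> (r' s)" using \<pi>_agree[OF r(1)] \<pi>_agree[OF r(2)] r(3) by simp
      then show "r = r'" using R_eqI[OF r(1,2)] galois_inj[OF g\<rho>] by simp
    qed
    then have bij: "bij_betw \<pi> R R"
      using \<pi>R endo_inj_surj[OF finite_R, of \<pi>] by (auto simp: bij_betw_def)
    have term_eq: "sign r * \<rho> (r c) = sign \<rho> * (sign (\<pi> r) * \<pi> r c)" if r: "r \<in> R" for r
    proof -
      have "f (\<pi> r) = f (\<rho> \<circ> r)"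
        using f_cong[OF gR[OF \<pi>R[OF r]] galois_comp[OF g\<rho> gR[OF r]] \<pi>_agree[OF r]] .
      then have "sign (\<pi> r) = sign (\<rho> \<circ> r)" by (simp add: sign_def)
      also have "\<dots> = sign \<rho> * sign r" using g\<rho> r R_N by (intro sign_comp) auto
      finally have "sign \<rho> * sign (\<pi> r) = sign r" using sign_square[of \<rho>] by (simp flip: mult.assoc)
      moreover have "\<pi> r c = \<rho> (r c)"
        using L_cong[OF gR[OF \<pi>R[OF r]] galois_comp[OF g\<rho> gR[OF r]] \<pi>_agree[OF r] c(1)] by simp
      ultimately show ?thesis by (simp flip: mult.assoc)
    qed
    have "\<rho> (Z c) = (\<Sum>r\<in>R. sign r * \<rho> (r c))"
      by (simp add: Z_def galois_sum[OF g\<rho>] galois_mult[OF g\<rho>] galois_sign[OF g\<rho>])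
    also have "\<dots> = (\<Sum>r\<in>R. sign \<rho> * (sign (\<pi> r) * \<pi> r c))" by (intro sum.cong refl term_eq)
    also have "\<dots> = (\<Sum>r\<in>R. sign \<rho> * (sign r * r c))"
      by (rule sum.reindex_bij_betw[OF bij])
    finally show ?thesis by (simp add: Z_def sum_distrib_left)
  qed
  then show ?thesis using that c(2) by blast
qed

text \<open>Multiplication of \<open>sign\<close> by a suitable power of \<open>\<beta>\<close> gives a cochain with values in the multiplicative group
  whose coboundary is \<open>b\<close> on pairs of elements outside \<open>N\<close> and \<open>1\<close> otherwise. Dividing by the
  coboundary of \<open>z\<close> makes it trivial on \<open>N\<close>; then its value \<open>w\<close> at \<open>\<sigma>0\<close>, an element outside
  \<open>N\<close>, is fixed by \<open>N\<close> and has norm \<open>w * \<sigma>0 w = b\<close>. The equation is this norm in the coordinates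
  \<open>2 w = u + v \<alpha>\<close>.\<close>

theorem norm_equation: "\<exists>u v. u\<^sup>2 = a * v\<^sup>2 + b * (2 :: 'k)\<^sup>2"
proof -
  obtain z where z: "z \<noteq> 0" "\<And>\<rho>. \<rho> \<in> N \<Longrightarrow> \<rho> z = sign \<rho> * z" using kummer_element by blast
  obtain \<sigma>0 where g0: "galois_automorphism \<sigma>0" and "\<sigma>0 \<alpha> \<noteq> \<alpha>" using galois_moves[OF perfect nonsquare] by blast
  then have m0: "moves \<alpha> \<sigma>0" by (simp add: moves_def)
  have \<sigma>0z: "\<sigma>0 z \<noteq> 0" using z(1) galois_inj[OF g0, of z 0] galois_0[OF g0] by simp
  define w where "w = \<beta> * sign \<sigma>0 * \<sigma>0 z / z"
  have fixed: "\<tau> w = w" if \<tau>: "\<tau> \<in> N" for \<tau>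
  proof -
    have g\<tau>: "galois_automorphism \<tau>" "\<not> moves \<alpha> \<tau>" using \<tau> by (simp_all add: N_def)
    let ?\<rho> = "inv_into UNIV \<sigma>0 \<circ> (\<tau> \<circ> \<sigma>0)"
    have g\<rho>: "galois_automorphism ?\<rho>" by (intro galois_comp galois_inv g0 g\<tau>)
    have eq: "\<sigma>0 \<circ> ?\<rho> = \<tau> \<circ> \<sigma>0" using g0 by (auto simp: galois_inv_apply)
    have "moves \<alpha> (\<sigma>0 \<circ> ?\<rho>) \<longleftrightarrow> moves \<alpha> \<sigma>0"
      unfolding eq using moves_comp[OF g\<tau>(1) g0 \<alpha>] g\<tau>(2) by simp
    then have m\<rho>: "\<not> moves \<alpha> ?\<rho>" using moves_comp[OF g0 g\<rho> \<alpha>] m0 by simp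
    then have \<rho>N: "?\<rho> \<in> N" using g\<rho> by (simp add: N_def)
    have "f (\<sigma>0 \<circ> ?\<rho>) = f (\<tau> \<circ> \<sigma>0)" unfolding eq ..
    then have f: "f ?\<rho> \<longleftrightarrow> (f \<tau> \<noteq> moves \<beta> \<tau>)"
      unfolding splitting[OF g0 g\<rho>] splitting[OF g\<tau>(1) g0] using m0 m\<rho> by auto
    have "\<tau> (\<sigma>0 z) = \<sigma>0 (?\<rho> z)" using fun_cong[OF eq, of z] by simp
    also have "\<dots> = sign ?\<rho> * \<sigma>0 z" using z(2)[OF \<rho>N] by (simp only: galois_mult[OF g0] galois_sign[OF g0])
    finally have "\<tau> w = \<tau> \<beta> * sign \<sigma>0 * (sign ?\<rho> * \<sigma>0 z) / (sign \<tau> * z)"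
      using z(2)[OF \<tau>] by (simp add: w_def galois_divide[OF g\<tau>(1)] galois_mult[OF g\<tau>(1)] galois_sign[OF g\<tau>(1)])
    also have "\<dots> = w"
      using f galois_square_root[OF g\<tau>(1) \<beta>] by (cases "f \<tau>") (auto simp: sign_def w_def)
    finally show ?thesis .
  qed
  have sq: "\<sigma>0 \<circ> \<sigma>0 \<in> N" using moves_comp[OF g0 g0 \<alpha>] galois_comp[OF g0 g0] by (simp add: N_def)
  have norm: "w * \<sigma>0 w = to_ac b"
  proof -
    have "\<sigma>0 (\<sigma>0 z) = sign (\<sigma>0 \<circ> \<sigma>0) * z" using z(2)[OF sq] by simp
    then have "\<sigma>0 w = \<sigma>0 \<beta> * sign \<sigma>0 * (sign (\<sigma>0 \<circ> \<sigma>0) * z) / \<sigma>0 z"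
      by (simp add: w_def galois_divide[OF g0] galois_mult[OF g0] galois_sign[OF g0])
    then have "w * \<sigma>0 w = \<beta> * \<sigma>0 \<beta> * sign (\<sigma>0 \<circ> \<sigma>0)"
      using z(1) \<sigma>0z sign_square[of \<sigma>0] by (simp add: w_def)
    also have "sign (\<sigma>0 \<circ> \<sigma>0) = (if moves \<beta> \<sigma>0 then -1 else 1)"
      using splitting[OF g0 g0] m0 by (simp add: sign_def)
    finally show ?thesis using galois_square_root[OF g0 \<beta>] \<beta> by simp
  qed
  have act_w: "\<sigma> w = (if moves \<alpha> \<sigma> then \<sigma>0 w else w)" if \<sigma>: "galois_automorphism \<sigma>" for \<sigma>
  proof (cases "moves \<alpha> \<sigma>")
    case True
    let ?\<tau> = "inv_into UNIV \<sigma>0 \<circ> \<sigma>"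
    have g: "galois_automorphism ?\<tau>" by (intro galois_comp galois_inv g0 \<sigma>)
    have eq: "\<sigma>0 \<circ> ?\<tau> = \<sigma>" using g0 by (auto simp: galois_inv_apply)
    have "?\<tau> \<in> N" using moves_comp[OF g0 g \<alpha>] m0 True g unfolding eq by (simp add: N_def)
    then have "?\<tau> w = w" by (rule fixed)
    then show ?thesis using fun_cong[OF eq, of w] True by simp
  next
    case False
    then show ?thesis using fixed \<sigma> by (simp add: N_def)
  qed
  have act_w0: "\<sigma> (\<sigma>0 w) = (if moves \<alpha> \<sigma> then w else \<sigma>0 w)" if \<sigma>: "galois_automorphism \<sigma>" for \<sigma>
    using act_w[OF galois_comp[OF \<sigma> g0]] moves_comp[OF \<sigma> g0 \<alpha>] m0 by simp
  have "w + \<sigma>0 w \<in> range to_ac"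
  proof (rule ccontr)
    assume "w + \<sigma>0 w \<notin> range to_ac"
    then obtain \<sigma> where \<sigma>: "galois_automorphism \<sigma>" "\<sigma> (w + \<sigma>0 w) \<noteq> w + \<sigma>0 w"
      by (rule galois_moves[OF perfect])
    then show False using act_w[OF \<sigma>(1)] act_w0[OF \<sigma>(1)] by (simp add: galois_add[OF \<sigma>(1)] add.commute split: if_splits)
  qed
  then obtain u where u: "w + \<sigma>0 w = to_ac u" by blast
  have "(w - \<sigma>0 w) / \<alpha> \<in> range to_ac"
  proof (rule ccontr)
    assume "(w - \<sigma>0 w) / \<alpha> \<notin> range to_ac"
    then obtain \<sigma> where \<sigma>: "galois_automorphism \<sigma>" "\<sigma> ((w - \<sigma>0 w) / \<alpha>) \<noteq> (w - \<sigma>0 w) / \<alpha>"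
      by (rule galois_moves[OF perfect])
    then show False
      using act_w[OF \<sigma>(1)] act_w0[OF \<sigma>(1)] galois_square_root[OF \<sigma>(1) \<alpha>]
      by (simp add: galois_diff[OF \<sigma>(1)] galois_divide[OF \<sigma>(1)] minus_divide_left split: if_splits)
  qed
  then obtain v where v: "(w - \<sigma>0 w) / \<alpha> = to_ac v" by blast
  have "\<alpha> \<noteq> 0" using nonsquare to_ac_0 by (metis rangeI)
  then have v': "w - \<sigma>0 w = to_ac v * \<alpha>" using v by (simp add: divide_eq_eq)
  have "to_ac (u\<^sup>2) = (w + \<sigma>0 w) * (w + \<sigma>0 w)" using u by (simp add: power2_eq_square)
  also have "\<dots> = (w - \<sigma>0 w) * (w - \<sigma>0 w) + 4 * (w * \<sigma>0 w)" by (simp add: algebra_simps)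
  also have "\<dots> = to_ac v * to_ac v * (\<alpha> * \<alpha>) + 4 * to_ac b" unfolding v' norm by (simp add: ac_simps)
  also have "\<dots> = to_ac (a * v\<^sup>2 + b * 2\<^sup>2)" unfolding \<alpha> by (simp add: power2_eq_square ac_simps)
  finally show ?thesis unfolding to_ac_eq_iff by blast
qed

end

section \<open>Vanishing of a cup product\<close>

abbreviation Gal_group :: "('k::field alg_closure \<Rightarrow> 'k alg_closure) monoid" where
  "Gal_group \<equiv> absolute_galois_group"

lemma galois_group_simps:
  assumes "perfect_field TYPE('k::field)"
  shows "carrier (Gal_group :: ('k alg_closure \<Rightarrow> _) monoid) = {\<sigma>. galois_automorphism \<sigma>}"
    and "galois_automorphism \<sigma> \<Longrightarrow> galois_automorphism \<tau> \<Longrightarrow>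
      \<sigma> \<otimes>\<^bsub>(Gal_group :: ('k alg_closure \<Rightarrow> _) monoid)\<^esub> \<tau> = \<sigma> \<circ> \<tau>"
    and "\<one>\<^bsub>(Gal_group :: ('k alg_closure \<Rightarrow> _) monoid)\<^esub> = id"
  using separable_closure_perfect[OF assms]
  by (auto simp: absolute_galois_group_def BijGroup_def Bij_def galois_automorphism_def compose_def fun_eq_iff)

lemma galois_group_group:
  assumes "perfect_field TYPE('k::field)"
  shows "group (Gal_group :: ('k alg_closure \<Rightarrow> _) monoid)"
proof (rule groupI)
  note simps = galois_group_simps[OF assms]
  fix \<sigma> \<tau> \<rho> :: "'k alg_closure \<Rightarrow> 'k alg_closure"
  assume \<sigma>: "\<sigma> \<in> carrier Gal_group"
  show "\<one>\<^bsub>Gal_group\<^esub> \<otimes>\<^bsub>Gal_group\<^esub> \<sigma> = \<sigma>"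
    using \<sigma> simps(2)[OF galois_id] by (simp add: simps(1,3))
  show "\<exists>\<tau>\<in>carrier Gal_group. \<tau> \<otimes>\<^bsub>Gal_group\<^esub> \<sigma> = \<one>\<^bsub>Gal_group\<^esub>"
  proof (intro bexI[of _ "inv_into UNIV \<sigma>"])
    have g: "galois_automorphism \<sigma>" using \<sigma> by (simp add: simps(1))
    then show "inv_into UNIV \<sigma> \<in> carrier Gal_group" by (simp add: simps(1) galois_inv)
    show "inv_into UNIV \<sigma> \<otimes>\<^bsub>Gal_group\<^esub> \<sigma> = \<one>\<^bsub>Gal_group\<^esub>"
      using g by (simp add: simps(2,3) galois_inv fun_eq_iff galois_inv_apply)
  qed
  assume \<tau>: "\<tau> \<in> carrier Gal_group"
  show "\<sigma> \<otimes>\<^bsub>Gal_group\<^esub> \<tau> \<in> carrier Gal_group"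
    using \<sigma> \<tau> by (simp add: simps(1,2) galois_comp)
  assume \<rho>: "\<rho> \<in> carrier Gal_group"
  show "\<sigma> \<otimes>\<^bsub>Gal_group\<^esub> \<tau> \<otimes>\<^bsub>Gal_group\<^esub> \<rho> = \<sigma> \<otimes>\<^bsub>Gal_group\<^esub> (\<tau> \<otimes>\<^bsub>Gal_group\<^esub> \<rho>)"
    using \<sigma> \<tau> \<rho> by (simp add: simps(1,2) galois_comp comp_assoc)
qed (simp add: galois_group_simps[OF assms] galois_id)

lemma topspace_krull:
  assumes "perfect_field TYPE('k::field)"
  shows "topspace (krull_topology :: ('k alg_closure \<Rightarrow> _) topology) = carrier Gal_group"
  using separable_closure_perfect[OF assms] by (simp add: krull_topology_def)

lemma continuous_evaluation:
  assumes "perfect_field TYPE('k::field)"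
  shows "continuous_map (krull_topology :: ('k alg_closure \<Rightarrow> _) topology) (discrete_topology UNIV) (\<lambda>\<sigma>. P (\<sigma> x))"
proof -
  have "continuous_map (krull_topology :: ('k alg_closure \<Rightarrow> _) topology) (discrete_topology UNIV) (\<lambda>\<sigma>. \<sigma> x)"
    unfolding krull_topology_def separable_closure_perfect[OF assms]
    by (intro continuous_map_from_subtopology continuous_map_product_projection) simp
  from continuous_map_compose[OF this, of "discrete_topology UNIV" P] show ?thesis
    by (simp add: o_def continuous_map_from_discrete_topology)
qed

text \<open>In the topology of pointwise convergence a neighbourhood of the identity contains the pointwise
  stabiliser of a finite set.\<close>

lemma krull_neighbourhood:
  assumes perfect: "perfect_field TYPE('k::field)"
    and f: "continuous_map (krull_topology :: ('k alg_closure \<Rightarrow> _) topology) (discrete_topology UNIV) f"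
  obtains S where "finite S" "\<And>\<sigma>. galois_automorphism \<sigma> \<Longrightarrow> (\<forall>s\<in>S. \<sigma> s = s) \<Longrightarrow> f \<sigma> = f id"
proof -
  note simps = galois_group_simps[OF perfect]
  let ?T = "krull_topology :: ('k alg_closure \<Rightarrow> 'k alg_closure) topology"
  have "openin ?T {\<sigma> \<in> topspace ?T. f \<sigma> \<in> {f id}}"
    using f by (rule openin_continuous_map_preimage) simp
  then obtain W where W: "openin (product_topology (\<lambda>_. discrete_topology UNIV) UNIV) W"
      and eq: "{\<sigma> \<in> topspace ?T. f \<sigma> \<in> {f id}} = W \<inter> carrier Gal_group"
    unfolding krull_topology_def separable_closure_perfect[OF perfect] openin_subtopology by blast
  have "id \<in> {\<sigma> \<in> topspace ?T. f \<sigma> \<in> {f id}}" by (simp add: topspace_krull[OF perfect] simps(1) galois_id)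
  then have "id \<in> W" unfolding eq by blast
  then obtain U where fin: "finite {i :: 'k alg_closure. U i \<noteq> UNIV}" and U: "id \<in> PiE UNIV U" "PiE UNIV U \<subseteq> W"
    using W unfolding openin_product_topology_alt by auto
  have "f \<sigma> = f id" if \<sigma>: "galois_automorphism \<sigma>" "\<forall>s\<in>{i. U i \<noteq> UNIV}. \<sigma> s = s" for \<sigma>
  proof -
    have "\<sigma> i \<in> U i" for i using \<sigma>(2) U(1) by (cases "U i = UNIV") (auto simp: PiE_iff)
    then have "\<sigma> \<in> W \<inter> carrier Gal_group" using U(2) \<sigma>(1) by (auto simp: simps(1) PiE_iff)
    then show ?thesis unfolding eq[symmetric] by simp
  qed
  with fin show ?thesis by (rule that)
qed

lemma cohomological_dimension_le_1:
  assumes "perfect_field TYPE('k::field)" "cohomological_dimension TYPE('k) \<le> 1"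
  shows "primary_cohomology_vanishes TYPE('m) (Gal_group :: ('k alg_closure \<Rightarrow> _) monoid) krull_topology 2 2"
proof -
  let ?G = "Gal_group :: ('k alg_closure \<Rightarrow> 'k alg_closure) monoid"
  let ?E = "{enat n | n. \<forall>q>n. primary_cohomology_vanishes TYPE(('k alg_closure \<Rightarrow> 'k alg_closure) list list) ?G krull_topology 2 q}"
  have "p_cohomological_dimension ?G krull_topology 2 \<le> cohomological_dimension TYPE('k)"
    unfolding cohomological_dimension_def by (intro SUP_upper) (simp add: two_is_prime_nat)
  then have le: "Inf ?E \<le> 1" using assms(2) unfolding p_cohomological_dimension_def by (rule order_trans)
  have "?E \<noteq> {}" 
  proof
    assume "?E = {}"
    then have "Inf ?E = \<infinity>" by (simp only: Inf_empty top_enat_def)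
    then show False using le by simp
  qed
  then have "Inf ?E \<in> ?E" by (metis (no_types, lifting) Inf_enat_def LeastI ex_in_conv)
  then obtain n where n: "Inf ?E = enat n"
    "\<forall>q>n. primary_cohomology_vanishes TYPE(('k alg_closure \<Rightarrow> 'k alg_closure) list list) ?G krull_topology 2 q"
    by blast
  have "n < 2" using le n(1) by (simp add: one_enat_def)
  then have "primary_cohomology_vanishes TYPE(('k alg_closure \<Rightarrow> 'k alg_closure) list list) ?G krull_topology 2 (Suc 1)"
    using n(2) by simp
  from primary_cohomology_vanishes_all_types[OF galois_group_group[OF assms(1)] topspace_krull[OF assms(1)] this]
  show ?thesis by (simp add: numeral_2_eq_2)
qed

text \<open>The group of order \<open>2\<close> as coefficient module. With truth values instead of residues, identities
  between cochains are propositional tautologies.\<close>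

definition Z2 :: "bool monoid" where
  "Z2 = \<lparr>carrier = UNIV, mult = (\<noteq>), one = False\<rparr>"

lemma Z2_simps [simp]: "carrier Z2 = UNIV" "x \<otimes>\<^bsub>Z2\<^esub> y = (x \<noteq> y)" "\<one>\<^bsub>Z2\<^esub> = False"
  by (simp_all add: Z2_def)

lemma Z2_comm_group: "comm_group Z2"
  by (rule comm_groupI) auto

lemma Z2_inv [simp]: "inv\<^bsub>Z2\<^esub> x = x"
proof -
  interpret comm_group Z2 by (rule Z2_comm_group)
  show ?thesis by (rule inv_equality) auto
qed

lemma Z2_torsion: "torsion_group Z2"
proof -
  interpret comm_group Z2 by (rule Z2_comm_group)
  have "a [^]\<^bsub>Z2\<^esub> (2 :: nat) = \<one>\<^bsub>Z2\<^esub>" for a by (simp add: numeral_2_eq_2)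
  then show ?thesis unfolding torsion_group_def by (metis zero_less_numeral)
qed

lemma Z2_trivial_module:
  assumes "group G" shows "discrete_module G T Z2 (\<lambda>_ x. x)"
proof -
  have "(\<lambda>_ x. x) \<in> hom G (AutoGroup Z2)"
    by (auto simp: hom_def AutoGroup_def auto_def BijGroup_def Bij_def compose_def bij_betw_def inj_on_def)
  moreover have "(\<lambda>(g :: 'a, x :: bool). x) = snd" by auto
  then have "continuous_map (prod_topology T (discrete_topology (carrier Z2))) (discrete_topology (carrier Z2)) (\<lambda>(g, x). x)"
    using continuous_map_snd by metis
  ultimately show ?thesis unfolding discrete_module_def using Z2_comm_group by blast
qed

lemma Z2_coboundary_1:
  assumes "s \<in> tuples G (Suc 1)"
  shows "coboundary G Z2 1 h s \<longleftrightarrow> ((h (face 1 0 s) \<noteq> h (face 1 1 s)) \<noteq> h (face 1 2 s))"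
proof -
  interpret comm_group Z2 by (rule Z2_comm_group)
  show ?thesis using assms unfolding coboundary_def by (simp add: numeral_2_eq_2) auto
qed

lemma Z2_coboundary_2:
  assumes "s \<in> tuples G (Suc 2)"
  shows "coboundary G Z2 2 h s \<longleftrightarrow>
    ((h (face 2 0 s) \<noteq> h (face 2 1 s)) \<noteq> (h (face 2 2 s) \<noteq> h (face 2 3 s)))"
proof -
  interpret comm_group Z2 by (rule Z2_comm_group)
  show ?thesis using assms unfolding coboundary_def by (simp add: numeral_2_eq_2 numeral_3_eq_3) auto
qed

lemma continuous_map_discrete_op:
  assumes "continuous_map W (discrete_topology UNIV) f" "continuous_map W (discrete_topology UNIV) g"
  shows "continuous_map W (discrete_topology UNIV) (\<lambda>x. H (f x) (g x))"
proof -
  have "continuous_map W (prod_topology (discrete_topology UNIV) (discrete_topology UNIV)) (\<lambda>s. (f s, g s))"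
    using assms by (simp add: continuous_map_pairedI)
  then have "continuous_map W (discrete_topology UNIV) (\<lambda>s. (f s, g s))"
    by (simp flip: prod_topology_discrete_topology)
  from continuous_map_compose[OF this, of "discrete_topology UNIV" "\<lambda>(x, y). H x y"]
  show ?thesis by (simp add: o_def continuous_map_from_discrete_topology)
qed

text \<open>The homogeneous \<open>2\<close>-cochain \<open>F\<close> represents the cup product of the two quadratic characters. It is a
  cocycle killed by \<open>2\<close>, hence the coboundary of some \<open>h\<close>. The inhomogeneous form of \<open>h\<close> is
  \<open>f \<sigma> = h(1, \<sigma>)\<close>, and evaluating \<open>F\<close> at \<open>(1, \<sigma>, \<sigma> \<tau>)\<close> gives the relation for \<open>f\<close>.\<close>

theorem cup_product_splits:
  fixes a b :: "'k::field"
  assumes perfect: "perfect_field TYPE('k)" and cd: "cohomological_dimension TYPE('k) \<le> 1"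
    and \<alpha>: "\<alpha> * \<alpha> = to_ac a" and \<beta>: "\<beta> * \<beta> = to_ac b"
  shows "\<exists>f S. finite S \<and>
    (\<forall>\<sigma> \<tau>. galois_automorphism \<sigma> \<longrightarrow> galois_automorphism \<tau> \<longrightarrow>
      f (\<sigma> \<circ> \<tau>) = ((f \<sigma> \<noteq> f \<tau>) \<noteq> (moves \<beta> \<sigma> \<and> moves \<alpha> \<tau>))) \<and>
    (\<forall>\<sigma>. galois_automorphism \<sigma> \<longrightarrow> (\<forall>s\<in>S. \<sigma> s = s) \<longrightarrow> \<not> f \<sigma>)"
proof -
  let ?G = "Gal_group :: ('k alg_closure \<Rightarrow> 'k alg_closure) monoid"
  let ?T = "krull_topology :: ('k alg_closure \<Rightarrow> 'k alg_closure) topology"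
  let ?act = "\<lambda>_ x. x"
  note simps = galois_group_simps[OF perfect]
  interpret cohomology_setup ?G ?T Z2 ?act
    using galois_group_group[OF perfect] topspace_krull[OF perfect] Z2_trivial_module
    by (intro cohomology_setup.intro) auto
  define F where "F = (\<lambda>s\<in>tuples ?G 2. (moves \<beta> (s 0) \<noteq> moves \<beta> (s 1)) \<and> (moves \<alpha> (s 1) \<noteq> moves \<alpha> (s 2)))"
  have evalc: "continuous_map (P 2) (discrete_topology UNIV) (\<lambda>s. moves x (s i))" if "i \<le> 2" for i x
  proof -
    have "continuous_map (P 2) ?T (\<lambda>s. s i)" using that by (intro continuous_map_product_projection) simp
    from continuous_map_compose[OF this continuous_evaluation[OF perfect, of "\<lambda>y. y \<noteq> x" x]]
    show ?thesis by (simp add: o_def moves_def)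
  qed
  have FC: "F \<in> carrier (C 2)"
    unfolding cochain_iff
  proof (intro conjI ballI)
    show "F \<in> extensional (tuples ?G 2)" by (simp add: F_def)
    show "continuous_map (P 2) D F"
    proof -
      have "continuous_map (P 2) (discrete_topology UNIV) (\<lambda>s. moves \<beta> (s 0) \<noteq> moves \<beta> (s 1))"
        by (rule continuous_map_discrete_op[where H = "(\<noteq>)", OF evalc evalc]) simp_all
      moreover have "continuous_map (P 2) (discrete_topology UNIV) (\<lambda>s. moves \<alpha> (s 1) \<noteq> moves \<alpha> (s 2))"
        by (rule continuous_map_discrete_op[where H = "(\<noteq>)", OF evalc evalc]) simp_all
      ultimately have "continuous_map (P 2) D
          (\<lambda>s. (moves \<beta> (s 0) \<noteq> moves \<beta> (s 1)) \<and> (moves \<alpha> (s 1) \<noteq> moves \<alpha> (s 2)))"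
        unfolding Z2_simps by (rule continuous_map_discrete_op[where H = "(\<and>)"])
      then show ?thesis unfolding F_def by (rule continuous_map_restrict_D)
    qed
    fix g s assume g: "g \<in> carrier ?G" and s: "s \<in> tuples ?G 2"
    have gg: "galois_automorphism g" using g simps(1) by simp
    have gs: "galois_automorphism (s i)" if "i \<le> 2" for i using s that simps(1) by (auto simp: PiE_iff)
    have "moves \<beta> (g \<circ> s i) \<longleftrightarrow> moves \<beta> g \<noteq> moves \<beta> (s i)" "moves \<alpha> (g \<circ> s i) \<longleftrightarrow> moves \<alpha> g \<noteq> moves \<alpha> (s i)"
      if "i \<le> 2" for i using moves_comp[OF gg gs[OF that]] \<alpha> \<beta> by blast+
    then show "F (\<lambda>i\<in>{..2}. g \<otimes>\<^bsub>?G\<^esub> s i) = ?act g (F s)"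
      unfolding F_def using translate[OF g s] s gg gs by (auto simp: simps(2))
  qed
  have "coboundary ?G Z2 2 F = \<one>\<^bsub>C 3\<^esub>"
  proof (rule extensionalityI[of _ "tuples ?G 3"])
    fix s assume s: "s \<in> tuples ?G 3"
    then have s': "s \<in> tuples ?G (Suc 2)" by (simp add: numeral_3_eq_3 numeral_2_eq_2)
    have faces: "face 2 i s \<in> tuples ?G 2" if "i \<le> 3" for i using face_tuples[OF s', of i] that by simp
    have F_face: "F (face 2 i s) \<longleftrightarrow> (moves \<beta> (face 2 i s 0) \<noteq> moves \<beta> (face 2 i s 1)) \<and>
        (moves \<alpha> (face 2 i s 1) \<noteq> moves \<alpha> (face 2 i s 2))" if "i \<le> 3" for i
      unfolding F_def using faces[OF that] by simp
    have "F (face 2 0 s) \<longleftrightarrow> (moves \<beta> (s 1) \<noteq> moves \<beta> (s 2)) \<and> (moves \<alpha> (s 2) \<noteq> moves \<alpha> (s 3))"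
      "F (face 2 1 s) \<longleftrightarrow> (moves \<beta> (s 0) \<noteq> moves \<beta> (s 2)) \<and> (moves \<alpha> (s 2) \<noteq> moves \<alpha> (s 3))"
      "F (face 2 2 s) \<longleftrightarrow> (moves \<beta> (s 0) \<noteq> moves \<beta> (s 1)) \<and> (moves \<alpha> (s 1) \<noteq> moves \<alpha> (s 3))"
      "F (face 2 3 s) \<longleftrightarrow> (moves \<beta> (s 0) \<noteq> moves \<beta> (s 1)) \<and> (moves \<alpha> (s 1) \<noteq> moves \<alpha> (s 2))"
      by (simp_all add: F_face) (simp_all add: face_def numeral_2_eq_2 numeral_3_eq_3)
    then have "\<not> coboundary ?G Z2 2 F s"
      unfolding Z2_coboundary_2[OF s'] by argo
    then show "coboundary ?G Z2 2 F s = \<one>\<^bsub>C 3\<^esub> s" using s by (simp add: C_one)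
  qed (simp_all add: coboundary_def C_one numeral_3_eq_3 numeral_2_eq_2)
  then have FZ: "F \<in> Z (Suc 1)"
    using FC unfolding cocycles_def kernel_def by (simp add: numeral_2_eq_2 numeral_3_eq_3)
  interpret Cg: comm_group "C (Suc 1)" by (rule C_comm_group)
  have FC': "F \<in> carrier (C (Suc 1))" using FC by (simp add: numeral_2_eq_2)
  have pow: "(2 ^ 1 :: nat) = Suc (Suc 0)" by simp
  have "F [^]\<^bsub>C (Suc 1)\<^esub> (2 ^ 1 :: nat) = F \<otimes>\<^bsub>C (Suc 1)\<^esub> F"
    unfolding pow Cg.nat_pow_Suc Cg.nat_pow_0 Cg.l_one[OF FC'] ..
  also have "\<dots> = \<one>\<^bsub>C (Suc 1)\<^esub>" unfolding C_mult C_one by (simp add: fun_eq_iff)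
  finally have "F [^]\<^bsub>C (Suc 1)\<^esub> (2 ^ 1 :: nat) \<in> B (Suc 1)"
    using subgroup.one_closed[OF B_subgroup] by metis
  moreover have "primary_component 2 (cohomology_group ?G ?T Z2 ?act (Suc 1)) = {\<one>\<^bsub>cohomology_group ?G ?T Z2 ?act (Suc 1)\<^esub>}"
    using cohomological_dimension_le_1[OF perfect cd, where 'm = bool] module Z2_torsion
    unfolding primary_cohomology_vanishes_def by (simp add: numeral_2_eq_2)
  ultimately have "F \<in> B (Suc 1)" using FZ unfolding primary_trivial_iff by blast
  then obtain h where h: "h \<in> carrier (C 1)" "F = coboundary ?G Z2 1 h" by auto
  define pair where "pair = (\<lambda>\<sigma>. \<lambda>i\<in>{..1::nat}. if i = 0 then id else \<sigma> :: 'k alg_closure \<Rightarrow> 'k alg_closure)"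
  define f where "f = (\<lambda>\<sigma>. h (pair \<sigma>))"
  have pairT: "pair \<sigma> \<in> tuples ?G 1" if "galois_automorphism \<sigma>" for \<sigma>
    using that by (auto simp: pair_def simps(1) galois_id)
  have split: "f (\<sigma> \<circ> \<tau>) \<longleftrightarrow> ((f \<sigma> \<noteq> f \<tau>) \<noteq> (moves \<beta> \<sigma> \<and> moves \<alpha> \<tau>))"
    if \<sigma>: "galois_automorphism \<sigma>" and \<tau>: "galois_automorphism \<tau>" for \<sigma> \<tau>
  proof -
    define t where "t = (\<lambda>i\<in>{..2::nat}. if i = 0 then id else if i = 1 then \<sigma> else \<sigma> \<circ> \<tau>)"
    have t: "t \<in> tuples ?G 2" using \<sigma> \<tau> by (auto simp: t_def simps(1) galois_id galois_comp)
    then have t': "t \<in> tuples ?G (Suc 1)" by (simp add: numeral_2_eq_2)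
    have faces: "face 1 2 t = pair \<sigma>" "face 1 1 t = pair (\<sigma> \<circ> \<tau>)"
      by (auto simp: face_def t_def pair_def fun_eq_iff)
    have "face 1 0 t = (\<lambda>i\<in>{..1}. \<sigma> \<otimes>\<^bsub>?G\<^esub> pair \<tau> i)"
      using \<sigma> \<tau> by (auto simp: face_def t_def pair_def fun_eq_iff simps(2) galois_id)
    then have "h (face 1 0 t) = f \<tau>"
      using h(1) pairT[OF \<tau>] \<sigma> simps(1) unfolding cochain_iff f_def by auto
    then have "F t \<longleftrightarrow> ((f \<tau> \<noteq> f (\<sigma> \<circ> \<tau>)) \<noteq> f \<sigma>)"
      unfolding h(2) Z2_coboundary_1[OF t'] faces by (simp add: f_def)
    moreover have "F t \<longleftrightarrow> moves \<beta> \<sigma> \<and> moves \<alpha> \<tau>"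
      using t moves_comp[OF \<sigma> \<tau> \<alpha>] by (auto simp: F_def t_def moves_def[of _ id])
    ultimately show ?thesis by auto
  qed
  have "\<not> f id" using split[OF galois_id galois_id] by (auto simp: moves_def)
  have "continuous_map ?T (P 1) pair"
    unfolding continuous_map_componentwise
  proof (intro conjI ballI)
    show "pair ` topspace ?T \<subseteq> extensional {..1}" by (auto simp: pair_def)
    fix i :: nat assume "i \<in> {..1}"
    then have "(\<lambda>\<sigma>. pair \<sigma> i) = (if i = 0 then (\<lambda>_. id) else (\<lambda>\<sigma>. \<sigma>))" by (auto simp: pair_def)
    moreover have "id \<in> topspace ?T" by (simp add: topspace_krull[OF perfect] simps(1) galois_id)
    ultimately show "continuous_map ?T ?T (\<lambda>\<sigma>. pair \<sigma> i)" by simp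
  qed
  moreover have "continuous_map (P 1) D h" using h(1) unfolding cochain_iff by blast
  ultimately have "continuous_map ?T D (h \<circ> pair)" by (rule continuous_map_compose)
  then have "continuous_map ?T (discrete_topology UNIV) f" by (simp add: f_def o_def)
  from krull_neighbourhood[OF perfect this] obtain S where
    "finite S" "\<And>\<sigma>. galois_automorphism \<sigma> \<Longrightarrow> (\<forall>s\<in>S. \<sigma> s = s) \<Longrightarrow> f \<sigma> = f id" by blast
  then show ?thesis using split \<open>\<not> f id\<close> by (intro exI[of _ f] exI[of _ S]) simp
qed

section \<open>The upper radical\<close>

text \<open>A square root in the algebraic closure has no other conjugate than itself.\<close>

lemma square_roots_perfect_char_2:
  fixes x :: "'k::field"
  assumes "perfect_field TYPE('k)" "(2 :: 'k) = 0"
  shows "\<exists>y. y\<^sup>2 = x"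
proof -
  obtain \<beta> where \<beta>: "\<beta> * \<beta> = to_ac x"
    using alg_closed_imp_poly_has_root[of "[:- to_ac x, 0, 1:]"] by (auto simp: algebra_simps)
  have "to_ac (2 :: 'k) = 0" using assms(2) by simp
  then have "\<beta> + \<beta> = 0" by (metis mult_2 mult_zero_left to_ac_numeral)
  then have neg: "- \<beta> = \<beta>" by (simp add: minus_unique)
  have "\<beta> \<in> range to_ac"
  proof (rule ccontr)
    assume "\<beta> \<notin> range to_ac"
    then obtain \<sigma> where "galois_automorphism \<sigma>" "\<sigma> \<beta> \<noteq> \<beta>" by (rule galois_moves[OF assms(1)])
    then show False using galois_square_root[OF _ \<beta>, of \<sigma>] neg by (simp split: if_splits)
  qed
  then obtain y where "\<beta> = to_ac y" by blast
  then have "to_ac (y\<^sup>2) = to_ac x" using \<beta> by (simp add: power2_eq_square)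
  then show ?thesis unfolding to_ac_eq_iff by blast
qed

text \<open>If \<open>x = e\<^sup>2\<close>, the equation factors as \<open>(u - e v) (u + e v) = 4 y\<close> and is solved by the factors \<open>2\<close> and
  \<open>2 y\<close>. Otherwise it says that \<open>4 y\<close> is a norm.\<close>

lemma conic_has_point:
  fixes x y :: "'k::field"
  assumes perfect: "perfect_field TYPE('k)" and cd: "cohomological_dimension TYPE('k) \<le> 1" and x: "x \<noteq> 0"
  shows "\<exists>u v. u\<^sup>2 = x * v\<^sup>2 + y * 2\<^sup>2"
proof -
  have root: "\<exists>\<gamma>. \<gamma> * \<gamma> = to_ac c" for c :: 'k
    using alg_closed_imp_poly_has_root[of "[:- to_ac c, 0, 1:]"] by (auto simp: algebra_simps)
  obtain \<alpha> \<beta> where \<alpha>: "\<alpha> * \<alpha> = to_ac x" and \<beta>: "\<beta> * \<beta> = to_ac y" using root by metis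
  show ?thesis
  proof (cases "\<alpha> \<in> range to_ac")
    case True
    then obtain e where "\<alpha> = to_ac e" by blast
    then have "to_ac (e * e) = to_ac x" using \<alpha> by simp
    then have "x = e * e" unfolding to_ac_eq_iff by simp
    then have e: "x = e * e" "e \<noteq> 0" using x by auto
    have "(y + 1)\<^sup>2 = (y - 1)\<^sup>2 + y * 2\<^sup>2" by (simp add: power2_eq_square algebra_simps)
    moreover have "x * ((y - 1) / e)\<^sup>2 = (y - 1)\<^sup>2" using e by (simp add: power2_eq_square)
    ultimately show ?thesis by metis
  next
    case False
    from cup_product_splits[OF perfect cd \<alpha> \<beta>] obtain f S where finS: "finite S"
      and f1: "\<forall>\<sigma> \<tau>. galois_automorphism \<sigma> \<longrightarrow> galois_automorphism \<tau> \<longrightarrow>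
        f (\<sigma> \<circ> \<tau>) = ((f \<sigma> \<noteq> f \<tau>) \<noteq> (moves \<beta> \<sigma> \<and> moves \<alpha> \<tau>))"
      and f2: "\<forall>\<sigma>. galois_automorphism \<sigma> \<longrightarrow> (\<forall>s\<in>S. \<sigma> s = s) \<longrightarrow> \<not> f \<sigma>"
      by (elim exE conjE)
    have "cup_product_splitting x y \<alpha> \<beta> f (insert \<alpha> S)"
    proof (rule cup_product_splitting.intro)
      show "f (\<sigma> \<circ> \<tau>) \<longleftrightarrow> ((f \<sigma> \<noteq> f \<tau>) \<noteq> (moves \<beta> \<sigma> \<and> moves \<alpha> \<tau>))"
        if "galois_automorphism \<sigma>" "galois_automorphism \<tau>" for \<sigma> \<tau> using f1 that by simp
      show "\<not> f \<sigma>" if "galois_automorphism \<sigma>" "\<forall>s\<in>insert \<alpha> S. \<sigma> s = s" for \<sigma>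
        using f2 that by simp
    qed (simp_all add: perfect \<alpha> \<beta> False finS)
    then show ?thesis by (rule cup_product_splitting.norm_equation)
  qed
qed

lemma ternary_isotropic:
  fixes p q r l m n :: "'k::field"
  assumes perfect: "perfect_field TYPE('k)" and cd: "cohomological_dimension TYPE('k) \<le> 1"
  shows "\<exists>a b c. (a, b, c) \<noteq> (0, 0, 0) \<and>
    p * a\<^sup>2 + q * b\<^sup>2 + r * c\<^sup>2 + l * b * c + m * c * a + n * a * b = 0"
proof (cases "(2 :: 'k) = 0")
  case True
  then show ?thesis by (rule ternary_isotropic_char_2) (rule square_roots_perfect_char_2[OF perfect True])
next
  case False
  then show ?thesis by (rule ternary_isotropic_char_not_2) (rule conic_has_point[OF perfect cd])
qed

theorem theorem1p5:
  fixes smul :: "'k::field \<Rightarrow> 'v::ab_group_add \<Rightarrow> 'v"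
  assumes "vector_space smul"
    and "vector_space.dim smul (UNIV :: 'v set) = 7"
    and "perfect_field TYPE('k)"
    and "cohomological_dimension TYPE('k) \<le> 1"
    and "grassmann_hyperplane smul 3 H"
  shows "upper_radical smul H \<noteq> {}"
proof
  assume empty: "upper_radical smul H = {}"
  obtain Bas where Bas: "Bas \<subseteq> UNIV" "\<not> module.dependent smul Bas" "UNIV \<subseteq> module.span smul Bas"
    "card Bas = vector_space.dim smul (UNIV :: 'v set)"
    by (rule vector_space.basis_exists[OF assms(1)])
  have "finite Bas" using Bas(4) assms(2) by (intro card_ge_0_finite) simp
  then have "finite_dimensional_vector_space smul Bas"
    using assms(1) Bas by (simp add: finite_dimensional_vector_space_def finite_dimensional_vector_space_axioms_def top.extremum_unique)
  then interpret fin_dim_linear_space smul Bas by (simp add: fin_dim_linear_space_def)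
  from hyperplane_trilinear_form[OF assms(5)] obtain \<phi>
    where form: "alternating_trilinear_form smul \<phi>" and "\<forall>x y z. \<phi> x y z = 0 \<longleftrightarrow> coplanar H x y z"
    by (elim exE conjE)
  then have \<phi>: "\<phi> x y z = 0 \<longleftrightarrow> coplanar H x y z" for x y z by simp
  have "H \<subseteq> grassmann_points smul 3"
    using assms(5) by (simp add: grassmann_hyperplane_def grassmann_subspace_def)
  then have "alternating_trilinear_form.nondegenerate smul \<phi>"
    using no_upper_radical_nondegenerate[OF form \<phi>] empty by blast
  moreover have "\<not> alternating_trilinear_form.nondegenerate smul \<phi>"
    using alternating_trilinear_form.no_nondegenerate_form[OF form assms(2) ternary_isotropic[OF assms(3,4)]] .
  ultimately show False by blast
qed

end
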